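(* Let $\alpha>-1/4$ and $g\in L_1(\mathbb{R};[\cosh(\pi\tau)]^{-1}d\tau)$. Then $x^{1/4}(G_\alpha g)(x)$ is bounded and continuous on $\mathbb{R}_+$ and $$\sup_{x>0}x^{1/4}\left|(G_\alpha g)(x)\right|\le C\,\|g\|_{L_1(\mathbb{R};[\cosh(\pi\tau)]^{-1}d\tau)},$$ where $C>0$ is a constant not depending on $g$. Besides, if $g\in L_1(\mathbb{R})$ and $G_\alpha g\in L_{\nu,1}((0,1))$ with $\max(-\alpha,0)<\nu<1/2$, then for all $y>0$ $$\frac{1}{2\pi i}\int_{\nu-i\infty}^{\nu+i\infty}\frac{\Gamma(s)\,\Gamma(1+\alpha-s)}{\Gamma(s+\alpha)}\,(G_\alpha g)^*(s)\,y^{-s}\,ds=\sqrt\pi\int_{-\infty}^\infty e^{y/2}K_{i\tau}\left(\frac y2\right)\frac{g(\tau)}{\cosh(\pi\tau)}\,d\tau.$$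
   Context: $\mathbb{R}_+=(0,\infty)$. $K_\mu$ and $I_\mu$ are the modified Bessel functions, $\Gamma$ is the gamma function. For real $\alpha$ the index transform $G_\alpha$ is $$(G_\alpha g)(x)=2\sqrt\pi\int_{-\infty}^\infty\mathrm{Re}\left[K_{\alpha+i\tau}(\sqrt x)\,I_{\alpha-i\tau}(\sqrt x)\right]\frac{g(\tau)}{\cosh(\pi\tau)}\,d\tau,\qquad x\in\mathbb{R}_+.$$ $L_1(\mathbb{R};w(\tau)d\tau)$ is the weighted space with norm $\int_{-\infty}^\infty|g(\tau)|w(\tau)d\tau$. $L_{\nu,1}((0,1))$ is the space of measurable $h$ with $\int_0^1|h(x)|x^{\nu-1}dx<\infty$. The Mellin transform is $h^*(s)=\int_0^\infty h(x)x^{s-1}dx$. *)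

theory Defs
  imports "HOL-Analysis.Analysis"
begin

text \<open>
  Modified Bessel functions of complex order, on the principal branch. Since \<open>rGamma\<close> is
  entire, the series for \<open>bessel_I\<close> makes sense for every order. The quotient defining
  \<open>bessel_K\<close> has removable singularities at the integers, where the value is the limit in the
  order. At \<open>z = 0\<close> (never used below) the values are not meaningful, because \<open>0 powr \<mu> = 0\<close>.
\<close>

definition bessel_I :: "complex \<Rightarrow> complex \<Rightarrow> complex" where
  "bessel_I \<mu> z =
     (z / 2) powr \<mu> * (\<Sum>k. (z\<^sup>2 / 4) ^ k * rGamma (\<mu> + of_nat k + 1) / fact k)"

definition bessel_K :: "complex \<Rightarrow> complex \<Rightarrow> complex" where
  "bessel_K \<mu> z =
     (let Q = (\<lambda>w. of_real pi / 2 * (bessel_I (- w) z - bessel_I w z) / sin (of_real pi * w))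
      in if \<mu> \<in> \<int> then Lim (at \<mu>) Q else Q \<mu>)"

definition weighted_L1 :: "real set \<Rightarrow> (real \<Rightarrow> real) \<Rightarrow> (real \<Rightarrow> complex) set" where
  "weighted_L1 S w =
     {h. set_borel_measurable lebesgue S h \<and>
         set_integrable lebesgue S (\<lambda>x. norm (h x) * w x)}"

definition weighted_L1_norm :: "real set \<Rightarrow> (real \<Rightarrow> real) \<Rightarrow> (real \<Rightarrow> complex) \<Rightarrow> real" where
  "weighted_L1_norm S w h = (LINT x:S|lebesgue. norm (h x) * w x)"

definition G_integrand :: "real \<Rightarrow> (real \<Rightarrow> complex) \<Rightarrow> real \<Rightarrow> real \<Rightarrow> complex" where
  "G_integrand \<alpha> g x \<tau> =
     of_real (Re (bessel_K (Complex \<alpha> \<tau>) (of_real (sqrt x)) *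
                  bessel_I (Complex \<alpha> (- \<tau>)) (of_real (sqrt x)))) *
     (g \<tau> / of_real (cosh (pi * \<tau>)))"

definition G_transform :: "real \<Rightarrow> (real \<Rightarrow> complex) \<Rightarrow> real \<Rightarrow> complex" where
  "G_transform \<alpha> g x = of_real (2 * sqrt pi) * (LINT \<tau>|lebesgue. G_integrand \<alpha> g x \<tau>)"

definition mellin :: "(real \<Rightarrow> complex) \<Rightarrow> complex \<Rightarrow> complex" where
  "mellin h s = (LINT x:{0<..}|lebesgue. h x * of_real x powr (s - 1))"

text \<open>
  Integration upwards along the line \<open>Re s = \<nu>\<close>, parametrised by \<open>s = \<nu> + \<i> t\<close>, \<open>ds = \<i> dt\<close>.
\<close>

definition vertical_integrable :: "real \<Rightarrow> (complex \<Rightarrow> complex) \<Rightarrow> bool" where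
  "vertical_integrable \<nu> F \<longleftrightarrow> integrable lebesgue (\<lambda>t. F (Complex \<nu> t))"

definition vertical_integral :: "real \<Rightarrow> (complex \<Rightarrow> complex) \<Rightarrow> complex" where
  "vertical_integral \<nu> F = \<i> * (LINT t|lebesgue. F (Complex \<nu> t))"

definition inversion_integrand ::
    "real \<Rightarrow> (real \<Rightarrow> complex) \<Rightarrow> real \<Rightarrow> complex \<Rightarrow> complex" where
  "inversion_integrand \<alpha> g y s =
     Gamma s * Gamma (1 + of_real \<alpha> - s) / Gamma (s + of_real \<alpha>) *
     mellin (G_transform \<alpha> g) s * of_real y powr (- s)"

definition K_integrand :: "(real \<Rightarrow> complex) \<Rightarrow> real \<Rightarrow> real \<Rightarrow> complex" where
  "K_integrand g y \<tau> =
     of_real (exp (y / 2)) * bessel_K (Complex 0 \<tau>) (of_real (y / 2)) *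
     (g \<tau> / of_real (cosh (pi * \<tau>)))"

end

theory Submission
  imports Defs "HOL-Complex_Analysis.Residue_Theorem"
begin

text \<open>
  Everything follows from one Mellin-Barnes formula. Write \<open>\<mu> = \<alpha> + \<i> \<tau>\<close>. For \<open>max (-\<alpha>) 0 < c < 1/2\<close>,
  \<open>x > 0\<close> and \<open>\<tau> \<noteq> 0\<close>,
  \[ \mathrm{Re}\,[K_\mu(\sqrt x) I_{\bar\mu}(\sqrt x)] = \frac{1}{2\pi} \int_{-\infty}^\infty \Phi_\tau(c + i t)\, x^{-c-it}\, dt, \]
  \[ \Phi_\tau(s) = \frac{\cosh(\pi\tau)}{2\sqrt\pi}\,
     \frac{\Gamma(s+i\tau)\Gamma(s-i\tau)\Gamma(1/2-s)\,\Gamma(s+\alpha)}{\Gamma(s)\,\Gamma(1+\alpha-s)}. \]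
  To see it, push the line of integration to the left. The decay of the Gamma quotient makes the
  remainder vanish, and the residues form two power series, which are the Cauchy products
  \<open>I\<^sub>\<mu> I\<^sub>\<nu>\<close> and \<open>I\<^sub>-\<^sub>\<mu> I\<^sub>\<nu>\<close> (Vandermonde's convolution), where \<open>\<nu>\<close> is the conjugate of \<open>\<mu>\<close>. The real part
  arises from averaging over \<open>\<tau>\<close> and \<open>-\<tau>\<close>; the reflection formula then gives the symbol \<open>\<Phi>\<^sub>\<tau>\<close>.
  
  Boundedness is the case \<open>c = 1/4\<close>. There \<open>\<Gamma>(1/2 - s) / \<Gamma>(s)\<close> has modulus one, \<open>\<Gamma>(s + \<alpha>) / \<Gamma>(1 + \<alpha> - s)\<close>
  is of order \<open>\<bar>t\<bar>\<^sup>-\<^sup>1\<^sup>/\<^sup>2\<close>, and \<open>\<bar>\<Gamma>(1/4 + \<i> y)\<bar>\<close> is at most a multiple of \<open>\<bar>y\<bar>\<^sup>-\<^sup>1\<^sup>/\<^sup>4 exp (-\<pi> \<bar>y\<bar> / 2)\<close>. Hence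
  \<open>\<bar>\<Phi>\<^sub>\<tau>\<bar>\<close> is bounded by a multiple of \<open>\<bar>t\<bar>\<^sup>-\<^sup>1\<^sup>/\<^sup>2 \<bar>t\<^sup>2 - \<tau>\<^sup>2\<bar>\<^sup>-\<^sup>1\<^sup>/\<^sup>4\<close> for \<open>\<bar>t\<bar> < \<bar>\<tau>\<bar>\<close> and exponentially small
  beyond, so its integral is bounded independently of \<open>\<tau>\<close> by scaling. Both Gamma estimates come from the
  reflection formula and one inequality, \<open>\<bar>\<Gamma>(s)\<bar>\<^sup>2 \<bar>s\<bar> \<le> exp (1 / (4 Re s)) \<bar>\<Gamma>(s + 1/2)\<bar>\<^sup>2\<close>, which is read off from Gauss's product.
  
  For the inversion formula, two lines \<open>c < \<nu> < d\<close> show that the kernel is absolutely integrable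
  against \<open>x powr (\<nu> - 1)\<close>, with a bound proportional to \<open>cosh (\<pi> \<tau>)\<close>, which the weight \<open>1 / cosh (\<pi> \<tau>)\<close>
  absorbs. Using the line \<open>c\<close> on \<open>(0,1)\<close> and the line \<open>d\<close> on \<open>[1,\<infinity>)\<close>, the Mellin transform of the kernel
  becomes the difference of two Cauchy integrals, and so equals \<open>\<Phi>\<^sub>\<tau>(s)\<close>. The factor
  \<open>\<Gamma>(s) \<Gamma>(1 + \<alpha> - s) / \<Gamma>(s + \<alpha>)\<close> then removes everything that depends on \<open>\<alpha>\<close> and leaves
  \<open>\<Gamma>(s + \<i> \<tau>) \<Gamma>(s - \<i> \<tau>) \<Gamma>(1/2 - s)\<close>. The same residue argument identifies the inverse Mellin transform of
  this product as \<open>sqrt \<pi> exp (y/2) K\<^sub>\<i>\<^sub>\<tau>(y/2) / cosh (\<pi> \<tau>)\<close>. The lemmas that carry the proof are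
  \<open>Gamma_pair_residue_expansion\<close>, \<open>bessel_product_Mellin_Barnes\<close>, \<open>exp_bessel_K_Mellin_Barnes\<close>,
  \<open>real_symbol_quarter_pointwise\<close> and \<open>split_kernel_Mellin\<close>.
\<close>

section \<open>Estimates for the Gamma function\<close>

lemma pochhammer_Re_pos_nonzero:
  fixes s :: complex
  assumes "0 < Re s"
  shows "pochhammer s n \<noteq> 0"
proof
  assume "pochhammer s n = 0"
  then obtain k where "s = - of_nat k" by (auto simp: pochhammer_eq_0_iff)
  then show False using assms by simp
qed

text \<open>
  In Gauss's product, each factor \<open>\<bar>b + k + \<i> t\<bar> / \<bar>a + k + \<i> t\<bar>\<close> is largest at \<open>t = 0\<close>.
\<close>

lemma norm_Gamma_ratio_le:
  assumes "0 < a" "a \<le> b"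
  shows "norm (Gamma (Complex a t)) * Gamma b \<le> Gamma a * norm (Gamma (Complex b t))"
proof -
  have poch: "pochhammer a n * norm (pochhammer (Complex b t) n)
      \<le> norm (pochhammer (Complex a t) n) * pochhammer b n" for n
  proof -
    have fac: "(a + real k) * norm (Complex b t + of_nat k)
        \<le> norm (Complex a t + of_nat k) * (b + real k)" for k
    proof (rule power2_le_imp_le)
      have "(a + k)\<^sup>2 * t\<^sup>2 \<le> (b + k)\<^sup>2 * t\<^sup>2"
        using assms by (intro mult_right_mono power_mono) auto
      then show "((a + real k) * norm (Complex b t + of_nat k))\<^sup>2
          \<le> (norm (Complex a t + of_nat k) * (b + real k))\<^sup>2"
        unfolding power_mult_distrib cmod_power2 by (simp add: algebra_simps)
    qed (use assms in auto)
    have "pochhammer a n * norm (pochhammer (Complex b t) n)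
        = (\<Prod>k<n. (a + real k) * norm (Complex b t + of_nat k))"
      by (simp add: pochhammer_prod prod_norm[symmetric] prod.distrib lessThan_atLeast0)
    also have "\<dots> \<le> (\<Prod>k<n. norm (Complex a t + of_nat k) * (b + real k))"
      using fac assms by (intro prod_mono) auto
    also have "\<dots> = norm (pochhammer (Complex a t) n) * pochhammer b n"
      by (simp add: pochhammer_prod prod_norm[symmetric] prod.distrib lessThan_atLeast0)
    finally show ?thesis .
  qed
  have pos: "pochhammer a n > 0" "pochhammer b n > 0" for n
    using assms by (auto intro!: pochhammer_pos)
  have nz: "pochhammer (Complex a t) n \<noteq> 0" "pochhammer (Complex b t) n \<noteq> 0" for n
    using assms by (auto intro!: pochhammer_Re_pos_nonzero)
  have "norm (Gamma_series (Complex a t) n) * Gamma_series b n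
      \<le> Gamma_series a n * norm (Gamma_series (Complex b t) n)" for n
  proof -
    have "inverse (norm (pochhammer (Complex a t) (n+1)) * pochhammer b (n+1))
        \<le> inverse (pochhammer a (n+1) * norm (pochhammer (Complex b t) (n+1)))"
      using poch[of "n+1"] pos nz by (intro le_imp_inverse_le) (auto intro!: mult_pos_pos)
    then have "fact n * exp (a * ln n) * (fact n * exp (b * ln n)) *
          inverse (norm (pochhammer (Complex a t) (n+1)) * pochhammer b (n+1))
        \<le> fact n * exp (a * ln n) * (fact n * exp (b * ln n)) *
          inverse (pochhammer a (n+1) * norm (pochhammer (Complex b t) (n+1)))"
      by (intro mult_left_mono) auto
    then show ?thesis
      by (simp add: Gamma_series_def norm_divide norm_mult divide_simps mult_ac del: pochhammer_Suc)
  qed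
  then show ?thesis
    by (intro LIMSEQ_le[OF tendsto_mult[OF tendsto_norm[OF Gamma_series_LIMSEQ] Gamma_series_LIMSEQ]
          tendsto_mult[OF Gamma_series_LIMSEQ tendsto_norm[OF Gamma_series_LIMSEQ]]]) auto
qed

text \<open>
  A weak form of Stirling's formula that loses nothing in the power of \<open>\<bar>s\<bar>\<close>. By Gauss's product,
  \<open>\<Gamma>(s) \<Gamma>(s + 1) / \<Gamma>(s + 1/2)\<^sup>2\<close> is the product of the factors \<open>1 + 1 / (4 (s + k) (s + k + 1))\<close>, whose
  logarithms are dominated by a telescoping series.
\<close>

lemma norm_Gamma_half_step_le:
  fixes s :: complex
  assumes "0 < Re s"
  shows "(norm (Gamma s))\<^sup>2 * norm s \<le> exp (1 / (4 * Re s)) * (norm (Gamma (s + 1/2)))\<^sup>2"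
proof -
  define a where "a = Re s"
  have a: "a > 0" using assms by (simp add: a_def)
  have lower: "norm (s + of_nat k) \<ge> a + k" for k :: nat
    using complex_Re_le_cmod[of "s + of_nat k"] by (simp add: a_def)
  have lower1: "norm (s + 1 + of_nat k) \<ge> a + k + 1" for k :: nat
    using complex_Re_le_cmod[of "s + 1 + of_nat k"] by (simp add: a_def)
  have fac: "(norm (s + 1/2 + of_nat k))\<^sup>2 \<le> norm (s + of_nat k) * norm (s + 1 + of_nat k) *
      exp (1/4 * (1 / (a + k) - 1 / (a + k + 1)))" for k :: nat
  proof -
    let ?A = "norm (s + of_nat k)" and ?B = "norm (s + 1 + of_nat k)"
    have pos: "?A > 0" "?B > 0" using lower[of k] lower1[of k] a by linarith+
    have "(s + 1/2 + of_nat k)\<^sup>2 = (s + of_nat k) * (s + 1 + of_nat k) + 1/4"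
      by (simp add: power2_eq_square field_simps)
    then have "(norm (s + 1/2 + of_nat k))\<^sup>2 \<le> ?A * ?B + 1/4"
      by (metis norm_power norm_mult norm_triangle_ineq norm_divide norm_one norm_numeral)
    also have "\<dots> = ?A * ?B * (1 + 1 / (4 * (?A * ?B)))"
      using pos by (simp add: field_simps)
    also have "\<dots> \<le> ?A * ?B * (1 + 1 / (4 * ((a + k) * (a + k + 1))))"
      using lower[of k] lower1[of k] a pos
      by (intro mult_left_mono add_left_mono divide_left_mono mult_mono mult_pos_pos) auto
    also have "1 / (4 * ((a + k) * (a + k + 1))) = 1/4 * (1 / (a + k) - 1 / (a + k + 1))"
      using a by (simp add: field_simps add_pos_nonneg)
    also have "?A * ?B * (1 + 1/4 * (1 / (a + k) - 1 / (a + k + 1))) \<le> ?A * ?B *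
        exp (1/4 * (1 / (a + k) - 1 / (a + k + 1)))"
      using pos by (intro mult_left_mono exp_ge_add_one_self) auto
    finally show ?thesis .
  qed
  have poch: "(norm (pochhammer (s + 1/2) n))\<^sup>2 \<le> exp (1 / (4 * a)) *
      (norm (pochhammer s n) * norm (pochhammer (s + 1) n))" for n
  proof -
    have "(norm (pochhammer (s + 1/2) n))\<^sup>2 = (\<Prod>k<n. (norm (s + 1/2 + of_nat k))\<^sup>2)"
      by (simp add: pochhammer_prod prod_norm[symmetric] prod_power_distrib lessThan_atLeast0)
    also have "\<dots> \<le> (\<Prod>k<n. norm (s + of_nat k) * norm (s + 1 + of_nat k) *
      exp (1/4 * (1 / (a + k) - 1 / (a + k + 1))))"
      by (intro prod_mono conjI fac) auto
    also have "\<dots> = norm (pochhammer s n) * norm (pochhammer (s + 1) n) *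
        exp (1/4 * (\<Sum>k<n. 1 / (a + k) - 1 / (a + real (Suc k))))"
      by (simp add: pochhammer_prod prod_norm[symmetric] prod.distrib lessThan_atLeast0 exp_sum
          sum_distrib_left add_ac)
    also have "(\<Sum>k<n. 1 / (a + k) - 1 / (a + real (Suc k))) = 1 / (a + real 0) - 1 / (a + real n)"
      using sum_lessThan_telescope'[of "\<lambda>k. 1 / (a + real k)" n] by simp
    also have "norm (pochhammer s n) * norm (pochhammer (s + 1) n) *
          exp (1/4 * (1 / (a + real 0) - 1 / (a + real n)))
        \<le> norm (pochhammer s n) * norm (pochhammer (s + 1) n) * exp (1 / (4 * a))"
      using a by (intro mult_left_mono) auto
    finally show ?thesis by (simp add: mult_ac)
  qed
  have nz: "pochhammer s n \<noteq> 0" "pochhammer (s + 1) n \<noteq> 0" "pochhammer (s + 1/2) n \<noteq> 0" for n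
    using assms by (auto intro!: pochhammer_Re_pos_nonzero)
  have "norm (Gamma_series s n) * norm (Gamma_series (s + 1) n)
      \<le> exp (1 / (4 * a)) * (norm (Gamma_series (s + 1/2) n))\<^sup>2" for n
  proof -
    define L where "L = exp (a * ln n)"
    have L: "exp ((a + 1) * ln (real n)) * L = (exp ((a + 1/2) * ln (real n)))\<^sup>2"
      by (simp add: L_def exp_add[symmetric] exp_double[symmetric] algebra_simps)
    define p q r where "p = norm (pochhammer s (n+1))" "q = norm (pochhammer (s + 1) (n+1))"
      "r = norm (pochhammer (s + 1/2) (n+1))"
    have pqr: "p > 0" "q > 0" "r > 0" and le: "r\<^sup>2 \<le> exp (1 / (4 * a)) * (p * q)"
      using nz poch[of "n+1"] by (auto simp: p_q_r_def simp del: pochhammer_Suc)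
    have "norm (Gamma_series s n) * norm (Gamma_series (s + 1) n) =
        (fact n)\<^sup>2 * (exp ((a + 1) * ln (real n)) * L) * (1 / (p * q))"
      by (simp add: Gamma_series_def norm_divide norm_mult p_q_r_def L_def a_def power2_eq_square
          del: pochhammer_Suc)
    also have "1 / (p * q) \<le> exp (1 / (4 * a)) / r\<^sup>2"
      using le pqr by (simp add: field_simps)
    also have "(fact n)\<^sup>2 * (exp ((a + 1) * ln (real n)) * L) * (exp (1 / (4 * a)) / r\<^sup>2) =
        exp (1 / (4 * a)) * (norm (Gamma_series (s + 1/2) n))\<^sup>2"
      unfolding L
      by (simp add: Gamma_series_def norm_divide norm_mult p_q_r_def a_def power_mult_distrib
          power_divide del: pochhammer_Suc)
    finally show ?thesis by (simp add: L_def mult_left_mono)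
  qed
  then have "norm (Gamma s) * norm (Gamma (s + 1)) \<le> exp (1 / (4 * a)) * (norm (Gamma (s + 1/2)))\<^sup>2"
    by (intro LIMSEQ_le[OF tendsto_mult[OF tendsto_norm[OF Gamma_series_LIMSEQ] tendsto_norm[OF Gamma_series_LIMSEQ]]
          tendsto_mult[OF tendsto_const tendsto_power[OF tendsto_norm[OF Gamma_series_LIMSEQ]]]]) auto
  moreover have "Gamma (s + 1) = s * Gamma s"
    using assms by (intro Gamma_plus1) (auto elim!: nonpos_Ints_cases)
  ultimately show ?thesis by (simp add: norm_mult power2_eq_square a_def mult_ac)
qed

lemma norm_Gamma_half:
  "(norm (Gamma (Complex (1/2) t)))\<^sup>2 = pi / cosh (pi * t)"
proof -
  have "Complex (1/2) t = 1/2 + \<i> * of_real t" by (simp add: complex_eq_iff)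
  have "of_real ((norm (Gamma (Complex (1/2) t)))\<^sup>2)
      = Gamma (Complex (1/2) t) * Gamma (1 - Complex (1/2) t)"
  proof -
    have "1 - Complex (1/2) t = cnj (Complex (1/2) t)" by (simp add: complex_eq_iff)
    then show ?thesis using complex_norm_square[of "Gamma (Complex (1/2) t)"] by (simp add: cnj_Gamma)
  qed
  also have "\<dots> = of_real pi / sin (of_real pi * Complex (1/2) t)"
    by (rule Gamma_reflection_complex)
  also have "sin (of_real pi * Complex (1/2) t) = of_real (cosh (pi * t))"
  proof -
    have "of_real pi * Complex (1/2) t = of_real pi / 2 + \<i> * of_real (pi * t)"
      by (simp add: complex_eq_iff)
    moreover have "sin (complex_of_real pi / 2) = 1" "cos (complex_of_real pi / 2) = 0"
      by (metis of_real_1 of_real_divide of_real_numeral sin_of_real sin_pi_half,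
          metis of_real_0 of_real_divide of_real_numeral cos_of_real cos_pi_half)
    ultimately show ?thesis
      by (simp add: sin_add cosh_def cos_exp_eq exp_of_real scaleR_conv_of_real
         flip: of_real_mult exp_of_real of_real_minus)
  qed
  finally show ?thesis
    by (metis of_real_divide of_real_eq_iff)
qed

lemma half_exp_abs_le_cosh: "exp \<bar>x\<bar> / 2 \<le> cosh (x::real)"
  by (cases "x \<ge> 0") (auto simp: cosh_def)

lemma power_one_plus_le_exp:
  fixes \<delta> :: real
  assumes "\<delta> > 0"
  shows "\<exists>M>0. \<forall>t\<ge>0. (1 + t) ^ k \<le> M * exp (\<delta> * t)"
proof (cases "k = 0")
  case True
  then show ?thesis using assms by (intro exI[of _ 1]) auto
next
  case False
  define m where "m = max 1 (k / \<delta>)"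
  have m: "m \<ge> 1" "m * (\<delta> / k) \<ge> 1"
  proof -
    show "m \<ge> 1" by (simp add: m_def)
    have "k / \<delta> * (\<delta> / k) \<le> m * (\<delta> / k)"
      using assms by (intro mult_right_mono) (auto simp: m_def)
    then show "m * (\<delta> / k) \<ge> 1" using assms False by simp
  qed
  have "(1 + t) ^ k \<le> m ^ k * exp (\<delta> * t)" if "t \<ge> 0" for t
  proof -
    have "1 * t \<le> m * (\<delta> / k) * t" using m that by (intro mult_right_mono) auto
    then have "1 + t \<le> m * (1 + \<delta> * t / k)" using m by (simp add: algebra_simps)
    also have "\<dots> \<le> m * exp (\<delta> * t / k)"
      using m by (intro mult_left_mono exp_ge_add_one_self) auto
    finally have "(1 + t) ^ k \<le> (m * exp (\<delta> * t / k)) ^ k"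
      using that by (intro power_mono) auto
    also have "\<dots> = m ^ k * exp (\<delta> * t)"
      using False by (simp add: power_mult_distrib exp_of_nat_mult[symmetric])
    finally show ?thesis .
  qed
  then show ?thesis using m by (intro exI[of _ "m ^ k"]) auto
qed

lemma Gamma_plus1_complex: "Re s > 0 \<or> Im s \<noteq> 0 \<Longrightarrow> Gamma (s + 1) = s * Gamma (s :: complex)"
  by (rule Gamma_plus1) (auto elim!: nonpos_Ints_cases)

lemma Gamma_unit_strip_bound:
  "\<exists>C>0. \<forall>s. 1/2 \<le> Re s \<and> Re s \<le> 3/2 \<longrightarrow>
     norm (Gamma s) \<le> C * (1 + \<bar>Im s\<bar>) * exp (- (pi / 2) * \<bar>Im s\<bar>)"
proof -
  have "continuous_on {1/2..3/2} (Gamma :: real \<Rightarrow> real)"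
    by (intro continuous_on_Gamma) (auto elim!: nonpos_Ints_cases)
  then have "compact ((Gamma :: real \<Rightarrow> real) ` {1/2..3/2})"
    by (intro compact_continuous_image) auto
  then obtain M where M: "\<And>a. a \<in> {1/2..3/2} \<Longrightarrow> norm (Gamma a :: real) \<le> M" "M > 0"
    using compact_imp_bounded bounded_pos by (metis imageI)
  define G where "G = Gamma (3/2 :: real)"
  have G: "G > 0" unfolding G_def by (intro Gamma_real_pos) simp
  have "norm (Gamma s) \<le> (M * 4 / G) * (1 + \<bar>Im s\<bar>) * exp (- (pi / 2) * \<bar>Im s\<bar>)"
    if s: "1/2 \<le> Re s" "Re s \<le> 3/2" for s
  proof -
    define t where "t = Im s"
    have st: "s = Complex (Re s) t" by (simp add: t_def)
    have "norm (Gamma s) * G \<le> Gamma (Re s) * norm (Gamma (Complex (3/2) t))"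
      unfolding G_def by (subst st, rule norm_Gamma_ratio_le) (use s in auto)
    also have "\<dots> \<le> M * norm (Gamma (Complex (3/2) t))"
      using M(1)[of "Re s"] s by (intro mult_right_mono) auto
    also have "Gamma (Complex (3/2) t) = Complex (1/2) t * Gamma (Complex (1/2) t)"
      using Gamma_plus1_complex[of "Complex (1/2) t"] by (simp add: complex_eq_iff plus_complex.code one_complex.code)
    also have "norm (Complex (1/2) t * Gamma (Complex (1/2) t)) \<le>
        (1 + \<bar>t\<bar>) * (4 * exp (- (pi / 2) * \<bar>t\<bar>))"
      unfolding norm_mult
    proof (intro mult_mono)
      show "norm (Complex (1/2) t) \<le> 1 + \<bar>t\<bar>"
        using cmod_le[of "Complex (1/2) t"] by simp
      show "norm (Gamma (Complex (1/2) t)) \<le> 4 * exp (- (pi / 2) * \<bar>t\<bar>)"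
      proof (rule power2_le_imp_le)
        have "pi / cosh (pi * t) \<le> pi / (exp \<bar>pi * t\<bar> / 2)"
          by (intro divide_left_mono half_exp_abs_le_cosh) (auto simp: cosh_real_pos)
        also have "\<dots> = 2 * pi * exp (- pi * \<bar>t\<bar>)"
          by (simp add: abs_mult exp_minus field_simps)
        also have "\<dots> \<le> 16 * exp (- pi * \<bar>t\<bar>)"
          using pi_less_4 by (intro mult_right_mono) auto
        also have "\<dots> = (4 * exp (- (pi / 2) * \<bar>t\<bar>))\<^sup>2"
          by (simp add: power_mult_distrib exp_double[symmetric])
        finally show "(norm (Gamma (Complex (1/2) t)))\<^sup>2 \<le> \<dots>"
          by (simp add: norm_Gamma_half)
      qed auto
    qed auto
    finally show ?thesis using G M by (simp add: t_def field_simps)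
  qed
  then show ?thesis using M G by (intro exI[of _ "M * 4 / G"]) auto
qed

text \<open>
  The functional equation extends the bound from the strip of width one around \<open>Re s = 1\<close>: each
  step to the right costs a factor of size \<open>1 + \<bar>Im s\<bar>\<close>, while a step to the left divides by
  \<open>\<bar>s\<bar> \<ge> 1\<close>.
\<close>

lemma Gamma_strip_bound_poly:
  "\<exists>C>0. \<forall>s. 1/2 - real n \<le> Re s \<and> Re s \<le> 3/2 + real n \<and> \<bar>Im s\<bar> \<ge> 1 \<longrightarrow>
     norm (Gamma s) \<le> C * (1 + \<bar>Im s\<bar>) ^ (n + 1) * exp (- (pi / 2) * \<bar>Im s\<bar>)"
proof (induction n)
  case 0
  show ?case using Gamma_unit_strip_bound by auto
next
  case (Suc n)
  then obtain C where C: "C > 0" "\<And>s. 1/2 - real n \<le> Re s \<Longrightarrow> Re s \<le> 3/2 + real n \<Longrightarrow> \<bar>Im s\<bar> \<ge> 1 \<Longrightarrow>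
     norm (Gamma s) \<le> C * (1 + \<bar>Im s\<bar>) ^ (n + 1) * exp (- (pi / 2) * \<bar>Im s\<bar>)"
    by blast
  define D where "D = C * (real n + 3)"
  have D: "D \<ge> C" "D > 0" using C by (auto simp: D_def)
  have "norm (Gamma s) \<le> D * (1 + \<bar>Im s\<bar>) ^ (Suc n + 1) * exp (- (pi / 2) * \<bar>Im s\<bar>)"
    if s: "1/2 - real (Suc n) \<le> Re s" "Re s \<le> 3/2 + real (Suc n)" "\<bar>Im s\<bar> \<ge> 1" for s
  proof -
    define t where "t = \<bar>Im s\<bar>"
    define e where "e = exp (- (pi / 2) * t)"
    have up: "C * (1 + t) ^ (n + 1) * e \<le> D * (1 + t) ^ (Suc n + 1) * e"
      using s D C unfolding e_def t_def
      by (intro mult_mono mult_right_mono power_increasing mult_nonneg_nonneg) auto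
    consider "Re s < 1/2 - real n" | "Re s > 3/2 + real n" | "1/2 - real n \<le> Re s" "Re s \<le> 3/2 + real n"
      by linarith
    then have "norm (Gamma s) \<le> D * (1 + t) ^ (Suc n + 1) * e"
    proof cases
      case 1
      have "norm (Gamma s) * 1 \<le> norm (Gamma s) * norm s"
        using s(3) abs_Im_le_cmod[of s] by (intro mult_left_mono) auto
      also have "\<dots> = norm (Gamma (s + 1))"
        using s by (subst Gamma_plus1_complex) (auto simp: norm_mult)
      also have "\<dots> \<le> C * (1 + t) ^ (n + 1) * e"
        using C(2)[of "s + 1"] s 1 by (auto simp: t_def e_def)
      finally show ?thesis using up by simp
    next
      case 2
      have "norm (Gamma s) = norm (s - 1) * norm (Gamma (s - 1))"
        using Gamma_plus1_complex[of "s - 1"] s 2 by (simp add: norm_mult)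
      also have "\<dots> \<le> ((real n + 3) * (1 + t)) * (C * (1 + t) ^ (n + 1) * e)"
      proof (intro mult_mono)
        have "norm (s - 1) \<le> \<bar>Re (s - 1)\<bar> + \<bar>Im (s - 1)\<bar>" by (rule cmod_le)
        also have "\<dots> \<le> (real n + 3) + t" using s 2 by (simp add: t_def)
        also have "\<dots> \<le> (real n + 3) * (1 + t)" by (simp add: algebra_simps t_def)
        finally show "norm (s - 1) \<le> (real n + 3) * (1 + t)" .
        show "norm (Gamma (s - 1)) \<le> C * (1 + t) ^ (n + 1) * e"
          using C(2)[of "s - 1"] s 2 by (auto simp: t_def e_def)
      qed (auto simp: t_def)
      also have "\<dots> = D * (1 + t) ^ (Suc n + 1) * e" by (simp add: D_def)
      finally show ?thesis .
    next
      case 3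
      then have "norm (Gamma s) \<le> C * (1 + t) ^ (n + 1) * e"
        unfolding t_def e_def using s by (intro C(2))
      then show ?thesis using up by linarith
    qed
    then show "norm (Gamma s) \<le> D * (1 + \<bar>Im s\<bar>) ^ (Suc n + 1) * exp (- (pi / 2) * \<bar>Im s\<bar>)"
      unfolding t_def e_def .
  qed
  then show ?case using D by blast
qed

text \<open>
  The rate \<open>3/2\<close> is a convenient number below \<open>\<pi>/2\<close>; the gap absorbs the polynomial factor.
\<close>

lemma Gamma_strip_bound:
  "\<exists>C>0. \<forall>s. l \<le> Re s \<and> Re s \<le> u \<and> \<bar>Im s\<bar> \<ge> 1 \<longrightarrow>
     norm (Gamma s) \<le> C * exp (- (3/2) * \<bar>Im s\<bar>)"
proof -
  define n where "n = nat \<lceil>max (1/2 - l) (u - 3/2)\<rceil>"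
  have n: "1/2 - real n \<le> l" "u \<le> 3/2 + real n" unfolding n_def by linarith+
  obtain C where C: "C > 0" "\<And>s. 1/2 - real n \<le> Re s \<Longrightarrow> Re s \<le> 3/2 + real n \<Longrightarrow> \<bar>Im s\<bar> \<ge> 1 \<Longrightarrow>
     norm (Gamma s) \<le> C * (1 + \<bar>Im s\<bar>) ^ (n + 1) * exp (- (pi / 2) * \<bar>Im s\<bar>)"
    using Gamma_strip_bound_poly[of n] by blast
  have "pi / 2 - 3/2 > 0" using pi_gt3 by simp
  from power_one_plus_le_exp[OF this, of "n + 1"]
  obtain M where M: "M > 0" "\<And>t. t \<ge> 0 \<Longrightarrow> (1 + t) ^ (n + 1) \<le> M * exp ((pi / 2 - 3/2) * t)" by blast
  have "norm (Gamma s) \<le> (C * M) * exp (- (3/2) * \<bar>Im s\<bar>)"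
    if s: "l \<le> Re s" "Re s \<le> u" "\<bar>Im s\<bar> \<ge> 1" for s
  proof -
    have "norm (Gamma s) \<le> C * (1 + \<bar>Im s\<bar>) ^ (n + 1) * exp (- (pi / 2) * \<bar>Im s\<bar>)"
      using C(2)[of s] s n by linarith
    also have "\<dots> \<le> C * (M * exp ((pi / 2 - 3/2) * \<bar>Im s\<bar>)) * exp (- (pi / 2) * \<bar>Im s\<bar>)"
      using C M(2)[of "\<bar>Im s\<bar>"] by (intro mult_right_mono mult_left_mono) auto
    also have "\<dots> = (C * M) * exp (- (3/2) * \<bar>Im s\<bar>)"
      by (simp add: mult_ac exp_add[symmetric] algebra_simps)
    finally show ?thesis .
  qed
  then show ?thesis using C M by (intro exI[of _ "C * M"]) auto
qed

lemma norm_sin_le_exp: "norm (sin (z :: complex)) \<le> exp \<bar>Im z\<bar>"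
proof -
  have "norm (sin z) = norm (exp (\<i> * z) - exp (- (\<i> * z))) / 2"
    by (simp add: sin_exp_eq norm_divide norm_mult)
  also have "\<dots> \<le> (norm (exp (\<i> * z)) + norm (exp (- (\<i> * z)))) / 2"
    by (intro divide_right_mono norm_triangle_ineq4) auto
  also have "\<dots> \<le> (exp \<bar>Im z\<bar> + exp \<bar>Im z\<bar>) / 2"
    by (intro divide_right_mono add_mono) auto
  also have "\<dots> = exp \<bar>Im z\<bar>" by simp
  finally show ?thesis .
qed

text \<open>
  By reflection, the growth rate is at most \<open>\<pi> - 3/2\<close>, which is below \<open>5/3\<close>.
\<close>

lemma rGamma_strip_bound:
  "\<exists>C>0. \<forall>s. l \<le> Re s \<and> Re s \<le> u \<and> \<bar>Im s\<bar> \<ge> 1 \<longrightarrow>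
     norm (rGamma s) \<le> C * exp (5/3 * \<bar>Im s\<bar>)"
proof -
  obtain C where C: "C > 0" "\<And>s. 1 - u \<le> Re s \<Longrightarrow> Re s \<le> 1 - l \<Longrightarrow> \<bar>Im s\<bar> \<ge> 1 \<Longrightarrow>
     norm (Gamma s) \<le> C * exp (- (3/2) * \<bar>Im s\<bar>)"
    using Gamma_strip_bound[of "1 - u" "1 - l"] by blast
  have "norm (rGamma s) \<le> C * exp (5/3 * \<bar>Im s\<bar>)"
    if s: "l \<le> Re s" "Re s \<le> u" "\<bar>Im s\<bar> \<ge> 1" for s
  proof -
    have "Im s \<noteq> 0" using s by auto
    have "1 - s \<notin> \<int>\<^sub>\<le>\<^sub>0"
    proof
      assume "1 - s \<in> \<int>\<^sub>\<le>\<^sub>0"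
      then obtain n where "1 - s = of_int n" by (auto elim!: nonpos_Ints_cases)
      then have "Im (1 - s) = 0" by simp
      then show False using \<open>Im s \<noteq> 0\<close> by simp
    qed
    then have "Gamma (1 - s) \<noteq> 0" by (simp add: Gamma_eq_zero_iff)
    then have "rGamma s = Gamma (1 - s) * (rGamma s * rGamma (1 - s))"
      by (simp add: rGamma_inverse_Gamma)
    then have "rGamma s = Gamma (1 - s) * sin (of_real pi * s) / of_real pi"
      by (simp add: rGamma_reflection_complex)
    then have "norm (rGamma s) = norm (Gamma (1 - s)) * norm (sin (of_real pi * s)) / pi"
      by (simp add: norm_mult norm_divide)
    also have "\<dots> \<le> (C * exp (- (3/2) * \<bar>Im s\<bar>)) * exp (pi * \<bar>Im s\<bar>) / pi"
      using C(2)[of "1 - s"] s norm_sin_le_exp[of "of_real pi * s"] C(1)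
      by (intro divide_right_mono mult_mono) (auto simp: abs_mult)
    also have "\<dots> = C * exp ((pi - 3/2) * \<bar>Im s\<bar>) / pi"
      by (simp add: exp_add[symmetric] algebra_simps)
    also have "\<dots> \<le> C * exp ((pi - 3/2) * \<bar>Im s\<bar>) / 1"
      using C pi_gt3 by (intro divide_left_mono) auto
    also have "\<dots> \<le> C * exp (5/3 * \<bar>Im s\<bar>)"
    proof -
      have "(pi - 3/2) * \<bar>Im s\<bar> \<le> 5/3 * \<bar>Im s\<bar>"
        using pi_approx(2) by (intro mult_right_mono) auto
      then show ?thesis using C(1) by simp
    qed
    finally show ?thesis .
  qed
  then show ?thesis using C by blast
qed

text \<open>
  The reflection formula gives the product \<open>\<bar>\<Gamma>(s) \<Gamma>(s + 1/2)\<bar>\<close> at \<open>s = 1/4 + \<i> y\<close> exactly, because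
  \<open>1 - s\<close> is the conjugate of \<open>s + 1/2\<close>; the half-step inequality compares the two factors. The
  exponential rate \<open>\<pi>/2\<close> must be exact here, as it has to cancel \<open>cosh (\<pi> \<tau>)\<close> uniformly in \<open>\<tau>\<close>.
\<close>

lemma norm_Gamma_quarter_le:
  "norm (Gamma (Complex (1/4) y)) \<le> 4 * norm (Complex (1/4) y) powr (-1/4) * exp (- (pi / 2) * \<bar>y\<bar>)"
proof (rule power2_le_imp_le)
  define s where "s = Complex (1/4) y"
  have s: "norm s > 0" by (simp add: s_def complex_eq_iff)
  have sin_ge: "norm (sin (of_real pi * s)) \<ge> exp (pi * \<bar>y\<bar>) / 2"
  proof (rule power2_le_imp_le)
    have "(norm (sin (of_real pi * s)))\<^sup>2 = (exp (2 * (pi * y)) + inverse (exp (2 * (pi * y)))) / 4"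
      by (simp add: norm_sin_squared s_def)
    also have "\<dots> = cosh (2 * (pi * y)) / 2" by (simp add: cosh_def exp_minus)
    also have "\<dots> \<ge> (exp \<bar>2 * (pi * y)\<bar> / 2) / 2"
      by (intro divide_right_mono half_exp_abs_le_cosh) auto
    also have "(exp \<bar>2 * (pi * y)\<bar> / 2) / 2 = (exp (pi * \<bar>y\<bar>) / 2)\<^sup>2"
      by (simp add: power_divide exp_double[symmetric] abs_mult)
    finally show "(exp (pi * \<bar>y\<bar>) / 2)\<^sup>2 \<le> (norm (sin (of_real pi * s)))\<^sup>2" .
  qed auto
  have refl: "norm (Gamma s) * norm (Gamma (s + 1/2)) * norm (sin (of_real pi * s)) = pi"
  proof -
    have "norm (Gamma (s + 1/2)) = norm (Gamma (1 - s))"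
    proof -
      have "1 - s = cnj (s + 1/2)" by (simp add: s_def complex_eq_iff)
      then show ?thesis by (simp add: cnj_Gamma[symmetric] del: complex_cnj_add)
    qed
    moreover have "sin (of_real pi * s) \<noteq> 0"
      using sin_ge exp_gt_zero[of "pi * \<bar>y\<bar>"] by (auto simp del: exp_gt_zero)
    ultimately show ?thesis
      using arg_cong[OF Gamma_reflection_complex[of s], of norm] by (simp add: norm_mult norm_divide)
  qed
  have "norm (Gamma s) * norm (Gamma (s + 1/2)) * (exp (pi * \<bar>y\<bar>) / 2) \<le> pi"
    using mult_left_mono[OF sin_ge, of "norm (Gamma s) * norm (Gamma (s + 1/2))"] refl by simp
  then have prod: "norm (Gamma s) * norm (Gamma (s + 1/2)) \<le> 2 * pi * exp (- pi * \<bar>y\<bar>)"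
    by (simp add: exp_minus field_simps)
  have e1: "exp (1::real) \<le> 4" using exp_le by simp
  have "(norm (Gamma s))\<^sup>2 * norm s \<le> exp 1 * (norm (Gamma (s + 1/2)))\<^sup>2"
    using norm_Gamma_half_step_le[of s] by (simp add: s_def)
  also have "\<dots> \<le> 4 * (norm (Gamma (s + 1/2)))\<^sup>2" using e1 by (intro mult_right_mono) auto
  finally have "(norm (Gamma s))\<^sup>2 * (sqrt (norm s))\<^sup>2 \<le> 4 * (norm (Gamma (s + 1/2)))\<^sup>2" by simp
  then have "(norm (Gamma s) * sqrt (norm s))\<^sup>2 \<le> (2 * norm (Gamma (s + 1/2)))\<^sup>2"
    by (simp add: power_mult_distrib)
  then have "norm (Gamma s) * sqrt (norm s) \<le> 2 * norm (Gamma (s + 1/2))"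
    by (rule power2_le_imp_le) auto
  then have "norm (Gamma s) * (norm (Gamma s) * sqrt (norm s)) \<le> norm (Gamma s) * (2 * norm (Gamma (s + 1/2)))"
    by (intro mult_left_mono) auto
  also have "\<dots> \<le> 4 * pi * exp (- pi * \<bar>y\<bar>)" using prod by simp
  also have "\<dots> \<le> 16 * exp (- pi * \<bar>y\<bar>)" using pi_less_4 by (intro mult_right_mono) auto
  finally have "(norm (Gamma s))\<^sup>2 \<le> 16 * exp (- pi * \<bar>y\<bar>) / sqrt (norm s)"
    using s by (simp add: field_simps power2_eq_square)
  also have "16 * exp (- pi * \<bar>y\<bar>) / sqrt (norm s) =
      (4 * norm s powr (-1/4) * exp (- (pi / 2) * \<bar>y\<bar>))\<^sup>2"
  proof -
    have "(norm s powr (-1/4))\<^sup>2 = norm s powr (-(1/2))"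
      by (simp add: power2_eq_square powr_add[symmetric])
    also have "\<dots> = 1 / sqrt (norm s)"
      using s by (simp add: powr_minus_divide powr_half_sqrt)
    finally show ?thesis by (simp add: power_mult_distrib exp_double[symmetric])
  qed
  finally show "(norm (Gamma (Complex (1/4) y)))\<^sup>2 \<le>
      (4 * norm (Complex (1/4) y) powr (-1/4) * exp (- (pi / 2) * \<bar>y\<bar>))\<^sup>2" unfolding s_def .
qed auto

section \<open>Moving vertical lines of integration\<close>

lemma integrable_exp_neg_abs:
  fixes c :: real
  assumes "c > 0"
  shows "integrable lborel (\<lambda>t. exp (- c * \<bar>t\<bar>))"
proof -
  have "(\<lambda>t. exp (- c * t)) absolutely_integrable_on {0..}"
    using has_integral_exp_minus_to_infinity[OF assms, of 0]
    by (intro nonnegative_absolutely_integrable_1) (auto simp: integrable_on_def)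
  then have "integrable lborel (\<lambda>t. indicator {0..} t * exp (- c * t))"
    by (simp add: set_integrable_def integrable_completion)
  then have R: "integrable lborel (\<lambda>t. indicator {0..} t * exp (- c * \<bar>t\<bar>))"
    by (rule Bochner_Integration.integrable_cong[THEN iffD1, rotated 2]) (auto simp: indicator_def)
  then have "integrable lborel (\<lambda>t. indicator {0..} (0 + (-1) * t) * exp (- c * \<bar>0 + (-1) * t\<bar>))"
    by (rule lborel_integrable_real_affine) simp
  then have L: "integrable lborel (\<lambda>t. indicator {0..} (- t) * exp (- c * \<bar>t\<bar>))" by simp
  have "integrable lborel (\<lambda>t. indicator {0..} t * exp (- c * \<bar>t\<bar>) + indicator {0..} (- t) * exp (- c * \<bar>t\<bar>))"
    using R L by (rule Bochner_Integration.integrable_add)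
  then show ?thesis
    by (rule Bochner_Integration.integrable_bound) (auto simp: indicator_def)
qed

lemma integrable_exp_decay:
  fixes f :: "real \<Rightarrow> complex"
  assumes cont: "continuous_on UNIV f" and c: "c > 0"
    and bound: "\<And>t. \<bar>t\<bar> \<ge> T \<Longrightarrow> norm (f t) \<le> C * exp (- c * \<bar>t\<bar>)"
  shows "integrable lborel f"
proof -
  have "compact (f ` {-T..T})"
    by (intro compact_continuous_image continuous_on_subset[OF cont]) auto
  then obtain M where M: "M > 0" "\<And>t. t \<in> {-T..T} \<Longrightarrow> norm (f t) \<le> M"
    using compact_imp_bounded bounded_pos by (metis imageI)
  have bd: "norm (f t) \<le> (\<bar>C\<bar> + M * exp (c * T)) * exp (- c * \<bar>t\<bar>)" for t
  proof (cases "\<bar>t\<bar> \<ge> T")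
    case True
    have "norm (f t) \<le> C * exp (- c * \<bar>t\<bar>)" using bound[OF True] .
    also have "\<dots> \<le> (\<bar>C\<bar> + M * exp (c * T)) * exp (- c * \<bar>t\<bar>)"
      using M by (intro mult_right_mono) (auto intro: add_increasing2)
    finally show ?thesis .
  next
    case False
    then have "t \<in> {-T..T}" by auto
    then have "norm (f t) \<le> M * 1" using M(2)[of t] by auto
    also have "\<dots> \<le> M * (exp (c * T) * exp (- c * \<bar>t\<bar>))"
      using False M c by (intro mult_left_mono) (auto simp: exp_add[symmetric] mult_left_mono)
    also have "\<dots> \<le> (\<bar>C\<bar> + M * exp (c * T)) * exp (- c * \<bar>t\<bar>)"
      by (simp add: algebra_simps)
    finally show ?thesis .
  qed
  have int: "integrable lborel (\<lambda>t. (\<bar>C\<bar> + M * exp (c * T)) * exp (- c * \<bar>t\<bar>))"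
    by (intro integrable_mult_right integrable_exp_neg_abs c)
  have "f \<in> borel_measurable lborel"
    using borel_measurable_continuous_onI[OF cont] by simp
  from Bochner_Integration.integrable_bound[OF int this] show ?thesis
    using order_trans[OF bd abs_ge_self] by simp
qed

lemma tendsto_symmetric_integral:
  fixes f :: "real \<Rightarrow> complex"
  assumes cont: "continuous_on UNIV f" and int: "integrable lborel f"
  shows "(\<lambda>n. integral {- real n..real n} f) \<longlonglongrightarrow> (LINT t|lborel. f t)"
proof -
  have "(\<lambda>n. LINT t|lborel. indicator {- real n..real n} t *\<^sub>R f t) \<longlonglongrightarrow> (LINT t|lborel. f t)"
  proof (rule integral_dominated_convergence)
    show "AE t in lborel. (\<lambda>n. indicator {- real n..real n} t *\<^sub>R f t) \<longlonglongrightarrow> f t"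
    proof (rule AE_I2, rule tendsto_eventually)
      fix t :: real
      obtain N :: nat where N: "\<bar>t\<bar> \<le> N" using real_arch_simple by blast
      have "indicator {- real n..real n} t *\<^sub>R f t = f t" if "n \<ge> N" for n
        using N that by (auto simp: indicator_def)
      then show "\<forall>\<^sub>F n in sequentially. indicator {- real n..real n} t *\<^sub>R f t = f t"
        by (rule eventually_sequentiallyI)
    qed
    show "integrable lborel (\<lambda>t. norm (f t))" using int by simp
  qed (use borel_measurable_continuous_onI[OF cont] in \<open>auto simp: indicator_def\<close>)
  moreover have "(LINT t|lborel. indicator {- real n..real n} t *\<^sub>R f t) = integral {- real n..real n} f" for n
  proof -
    have "set_integrable lborel {- real n..real n} f"
      using int unfolding set_integrable_def by (intro integrable_mult_indicator) auto
    from set_borel_integral_eq_integral(2)[OF this] show ?thesis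
      by (simp add: set_lebesgue_integral_def)
  qed
  ultimately show ?thesis by simp
qed

lemma contour_integral_rectpath:
  assumes cont: "continuous_on (path_image (rectpath (Complex l (-T)) (Complex u T))) f"
    and lu: "l < u" "T > 0"
  shows "contour_integral (rectpath (Complex l (-T)) (Complex u T)) f
      = contour_integral (linepath (Complex l (-T)) (Complex u (-T))) f
      + \<i> * integral {-T..T} (\<lambda>t. f (Complex u t))
      - contour_integral (linepath (Complex l T) (Complex u T)) f
      - \<i> * integral {-T..T} (\<lambda>t. f (Complex l t))"
proof -
  have pi: "path_image (rectpath (Complex l (-T)) (Complex u T)) =
      closed_segment (Complex l (-T)) (Complex u (-T)) \<union> closed_segment (Complex u (-T)) (Complex u T)
      \<union> closed_segment (Complex u T) (Complex l T) \<union> closed_segment (Complex l T) (Complex l (-T))"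
    by (simp add: rectpath_def Let_def path_image_join Un_assoc)
  have c: "continuous_on (closed_segment (Complex l (-T)) (Complex u (-T))) f"
      "continuous_on (closed_segment (Complex u (-T)) (Complex u T)) f"
      "continuous_on (closed_segment (Complex u T) (Complex l T)) f"
      "continuous_on (closed_segment (Complex l T) (Complex l (-T))) f"
    using continuous_on_subset[OF cont] unfolding pi by blast+
  note ci = c[THEN contour_integrable_continuous_linepath]
  have "contour_integral (rectpath (Complex l (-T)) (Complex u T)) f =
      contour_integral (linepath (Complex l (-T)) (Complex u (-T))) f +
      contour_integral (linepath (Complex u (-T)) (Complex u T)) f +
      contour_integral (linepath (Complex u T) (Complex l T)) f +
      contour_integral (linepath (Complex l T) (Complex l (-T))) f"
    using ci by (simp add: rectpath_def Let_def)
  also have "contour_integral (linepath (Complex u (-T)) (Complex u T)) f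
      = \<i> * integral {-T..T} (\<lambda>t. f (Complex u t))"
    using lu by (intro contour_integral_linepath_same_Re) auto
  also have "contour_integral (linepath (Complex u T) (Complex l T)) f =
      - contour_integral (linepath (Complex l T) (Complex u T)) f"
    using c(3) by (subst contour_integral_reverse_linepath) (auto simp: closed_segment_commute)
  also have "contour_integral (linepath (Complex l T) (Complex l (-T))) f =
      - contour_integral (linepath (Complex l (-T)) (Complex l T)) f"
    using c(4) by (subst contour_integral_reverse_linepath) (auto simp: closed_segment_commute)
  also have "contour_integral (linepath (Complex l (-T)) (Complex l T)) f
      = \<i> * integral {-T..T} (\<lambda>t. f (Complex l t))"
    using lu by (intro contour_integral_linepath_same_Re) auto
  finally show ?thesis by simp
qed

text \<open>
  The residue theorem on rectangles of growing height, whose horizontal sides contribute nothing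
  in the limit. It is used twice: to collect the residues of a Mellin-Barnes integrand, and as
  Cauchy's integral formula in a strip.
\<close>

lemma vertical_line_shift:
  fixes \<Psi> :: "complex \<Rightarrow> complex"
  assumes lu: "l < u" and S: "open S" "connected S" "{s. l \<le> Re s \<and> Re s \<le> u} \<subseteq> S"
    and P: "finite P" "P \<subseteq> {s. l < Re s \<and> Re s < u}"
    and holo: "\<Psi> holomorphic_on S - P"
    and c: "c > 0"
    and decay: "\<And>s. l \<le> Re s \<Longrightarrow> Re s \<le> u \<Longrightarrow> \<bar>Im s\<bar> \<ge> T \<Longrightarrow> norm (\<Psi> s) \<le> C * exp (- c * \<bar>Im s\<bar>)"
  shows "(LINT t|lborel. \<Psi> (Complex u t)) - (LINT t|lborel. \<Psi> (Complex l t))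
      = 2 * of_real pi * (\<Sum>p\<in>P. residue \<Psi> p)"
proof -
  have contP: "continuous_on (S - P) \<Psi>" by (rule holomorphic_on_imp_continuous_on[OF holo])
  have line: "continuous_on UNIV (\<lambda>t. \<Psi> (Complex x t))" if "x = l \<or> x = u" for x
    unfolding Complex_eq
    by (rule continuous_on_compose2[OF contP])
      (use that lu S P in \<open>auto intro!: continuous_intros\<close>)
  have int: "integrable lborel (\<lambda>t. \<Psi> (Complex x t))" if "x = l \<or> x = u" for x
    using that lu decay[of "Complex x t" for t]
    by (intro integrable_exp_decay[OF line[OF that] c, of T C]) auto
  define R where "R n = rectpath (Complex l (- real n)) (Complex u (real n))" for n :: nat
  obtain N0 :: nat where N0: "\<And>p. p \<in> P \<Longrightarrow> \<bar>Im p\<bar> < N0"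
  proof -
    obtain N0 :: nat where "Max (insert 0 ((\<lambda>p. \<bar>Im p\<bar>) ` P)) < N0" using reals_Archimedean2 by blast
    then have "\<bar>Im p\<bar> < N0" if "p \<in> P" for p using P(1) that by simp
    then show ?thesis using that by blast
  qed
  define N where "N = max (Suc N0) (nat \<lceil>T\<rceil>)"
  have N: "real n > 0" "real n \<ge> T" "\<And>p. p \<in> P \<Longrightarrow> \<bar>Im p\<bar> < n" if "n \<ge> N" for n
  proof -
    show "real n > 0" "real n \<ge> T" using that unfolding N_def by linarith+
    fix p assume "p \<in> P"
    from N0[OF this] that show "\<bar>Im p\<bar> < n" unfolding N_def by linarith
  qed
  have im: "path_image (R n) \<subseteq> S - P" if "n \<ge> N" for n
    unfolding R_def
    by (subst path_image_rectpath) (use lu S P N[OF that] in \<open>fastforce+\<close>)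
  have res: "contour_integral (R n) \<Psi> = 2 * pi * \<i> * (\<Sum>p\<in>P. residue \<Psi> p)" if "n \<ge> N" for n
  proof -
    have "contour_integral (R n) \<Psi> = 2 * pi * \<i> * (\<Sum>p\<in>P. winding_number (R n) p * residue \<Psi> p)"
    proof (rule Residue_theorem[OF S(1,2) P(1) holo _ _ im[OF that]])
      show "\<forall>z. z \<notin> S \<longrightarrow> winding_number (R n) z = 0"
        unfolding R_def using lu S N[OF that]
        by (intro allI impI winding_number_rectpath_outside) (auto simp: in_cbox_complex_iff)
    qed (auto simp: R_def)
    also have "(\<Sum>p\<in>P. winding_number (R n) p * residue \<Psi> p) = (\<Sum>p\<in>P. residue \<Psi> p)"
    proof (rule sum.cong[OF refl])
      fix p assume p: "p \<in> P"
      have "winding_number (R n) p = 1"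
        unfolding R_def using N(3)[OF that p] P(2) p
        by (intro winding_number_rectpath) (auto simp: in_box_complex_iff)
      then show "winding_number (R n) p * residue \<Psi> p = residue \<Psi> p" by simp
    qed
    finally show ?thesis .
  qed
  have horiz: "(\<lambda>n. contour_integral (linepath (Complex l (\<sigma> * real n)) (Complex u (\<sigma> * real n))) \<Psi>) \<longlonglongrightarrow> 0"
    if \<sigma>: "\<sigma> = 1 \<or> \<sigma> = -1" for \<sigma> :: real
  proof (rule Lim_null_comparison)
    show "\<forall>\<^sub>F n in sequentially.
        norm (contour_integral (linepath (Complex l (\<sigma> * real n)) (Complex u (\<sigma> * real n))) \<Psi>)
        \<le> \<bar>C\<bar> * exp (- c * real n) * (u - l)"
    proof (rule eventually_sequentiallyI[of N])
      fix n assume n: "N \<le> n"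
      let ?g = "linepath (Complex l (\<sigma> * real n)) (Complex u (\<sigma> * real n))"
      have seg: "\<bar>Im z\<bar> = n \<and> l \<le> Re z \<and> Re z \<le> u"
        if "z \<in> closed_segment (Complex l (\<sigma> * real n)) (Complex u (\<sigma> * real n))" for z
        using that \<sigma> lu by (auto simp: closed_segment_same_Im closed_segment_eq_real_ivl)
      have "continuous_on (closed_segment (Complex l (\<sigma> * real n)) (Complex u (\<sigma> * real n))) \<Psi>"
        using seg N(3)[OF n] S(3) by (intro continuous_on_subset[OF contP]) (fastforce+)
      then have "norm (contour_integral ?g \<Psi>) \<le> (\<bar>C\<bar> * exp (- c * real n)) *
          norm (Complex u (\<sigma> * real n) - Complex l (\<sigma> * real n))"
      proof (intro contour_integral_bound_linepath contour_integrable_continuous_linepath)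
        fix z assume "z \<in> closed_segment (Complex l (\<sigma> * real n)) (Complex u (\<sigma> * real n))"
        from seg[OF this] have "norm (\<Psi> z) \<le> C * exp (- c * real n)"
          using decay[of z] N(2)[OF n] by auto
        also have "\<dots> \<le> \<bar>C\<bar> * exp (- c * real n)" by (intro mult_right_mono) auto
        finally show "norm (\<Psi> z) \<le> \<bar>C\<bar> * exp (- c * real n)" .
      qed auto
      also have "norm (Complex u (\<sigma> * real n) - Complex l (\<sigma> * real n)) = u - l"
        using lu by (simp add: minus_complex.code cmod_def)
      finally show "norm (contour_integral ?g \<Psi>) \<le> \<bar>C\<bar> * exp (- c * real n) * (u - l)" .
    qed
    have e0: "(\<lambda>n. exp (- c * real n)) \<longlonglongrightarrow> 0"
    proof -
      have "(\<lambda>n. exp (- c) ^ n) \<longlonglongrightarrow> 0" using c by (intro LIMSEQ_realpow_zero) auto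
      then show ?thesis by (simp add: exp_of_nat_mult[symmetric] mult.commute)
    qed
    then show "(\<lambda>n. \<bar>C\<bar> * exp (- c * real n) * (u - l)) \<longlonglongrightarrow> 0"
      using tendsto_mult[OF tendsto_mult[OF tendsto_const[of "\<bar>C\<bar>"] e0] tendsto_const[of "u - l"]] by simp
  qed
  have "(\<lambda>n. contour_integral (R n) \<Psi>) \<longlonglongrightarrow> 0 + \<i> * (LINT t|lborel. \<Psi> (Complex u t)) - 0
      - \<i> * (LINT t|lborel. \<Psi> (Complex l t))"
  proof (rule Lim_transform_eventually)
    show "(\<lambda>n. contour_integral (linepath (Complex l ((-1) * real n)) (Complex u ((-1) * real n))) \<Psi>
        + \<i> * integral {- real n..real n} (\<lambda>t. \<Psi> (Complex u t))
        - contour_integral (linepath (Complex l (1 * real n)) (Complex u (1 * real n))) \<Psi>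
        - \<i> * integral {- real n..real n} (\<lambda>t. \<Psi> (Complex l t))) \<longlonglongrightarrow>
        0 + \<i> * (LINT t|lborel. \<Psi> (Complex u t)) - 0 - \<i> * (LINT t|lborel. \<Psi> (Complex l t))"
      by (intro tendsto_diff tendsto_add tendsto_mult tendsto_const horiz tendsto_symmetric_integral line int) auto
    show "\<forall>\<^sub>F n in sequentially. contour_integral (linepath (Complex l ((-1) * real n)) (Complex u ((-1) * real n))) \<Psi>
        + \<i> * integral {- real n..real n} (\<lambda>t. \<Psi> (Complex u t))
        - contour_integral (linepath (Complex l (1 * real n)) (Complex u (1 * real n))) \<Psi>
        - \<i> * integral {- real n..real n} (\<lambda>t. \<Psi> (Complex l t)) = contour_integral (R n) \<Psi>"
    proof (rule eventually_sequentiallyI[of N])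
      fix n assume n: "N \<le> n"
      from continuous_on_subset[OF contP im[OF n]]
      show "contour_integral (linepath (Complex l ((-1) * real n)) (Complex u ((-1) * real n))) \<Psi>
        + \<i> * integral {- real n..real n} (\<lambda>t. \<Psi> (Complex u t))
        - contour_integral (linepath (Complex l (1 * real n)) (Complex u (1 * real n))) \<Psi>
        - \<i> * integral {- real n..real n} (\<lambda>t. \<Psi> (Complex l t)) = contour_integral (R n) \<Psi>"
        unfolding R_def by (subst contour_integral_rectpath) (use lu N[OF n] in auto)
    qed
  qed
  moreover have "(\<lambda>n. contour_integral (R n) \<Psi>) \<longlonglongrightarrow> 2 * pi * \<i> * (\<Sum>p\<in>P. residue \<Psi> p)"
    by (rule tendsto_eventually, rule eventually_sequentiallyI[of N], rule res)
  ultimately have "0 + \<i> * (LINT t|lborel. \<Psi> (Complex u t)) - 0 - \<i> * (LINT t|lborel. \<Psi> (Complex l t))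
      = 2 * pi * \<i> * (\<Sum>p\<in>P. residue \<Psi> p)"
    by (rule LIMSEQ_unique)
  then have "\<i> * ((LINT t|lborel. \<Psi> (Complex u t)) - (LINT t|lborel. \<Psi> (Complex l t)))
      = \<i> * (2 * of_real pi * (\<Sum>p\<in>P. residue \<Psi> p))"
    by (simp add: algebra_simps)
  then show ?thesis by simp
qed

section \<open>Residue expansion of Mellin-Barnes integrals\<close>

lemma ratio_tendsto_zero_imp_tendsto_zero:
  fixes J :: "nat \<Rightarrow> real"
  assumes nonneg: "\<And>n. J n \<ge> 0" and q: "q \<longlonglongrightarrow> 0"
    and step: "\<forall>\<^sub>F n in sequentially. J (Suc n) \<le> q n * J n"
  shows "J \<longlonglongrightarrow> 0"
proof -
  have "\<forall>\<^sub>F n in sequentially. q n < 1/2" using q by (rule order_tendstoD) auto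
  with step have "\<forall>\<^sub>F n in sequentially. norm (J (Suc n)) \<le> 1/2 * norm (J n)"
  proof eventually_elim
    case (elim n)
    then have "J (Suc n) \<le> 1/2 * J n"
      using nonneg[of n] mult_right_mono[of "q n" "1/2" "J n"] by linarith
    then show ?case using nonneg by simp
  qed
  then obtain N where "\<And>n. n \<ge> N \<Longrightarrow> norm (J (Suc n)) \<le> 1/2 * norm (J n)"
    by (auto simp: eventually_sequentially)
  then have "summable J" by (intro summable_ratio_test[of "1/2" N]) auto
  then show ?thesis by (rule summable_LIMSEQ_zero)
qed

text \<open>
  Only the first factor is singular at the pole, so the residue is that of \<open>\<Gamma>\<close> at \<open>-k\<close> times the
  value of \<open>h\<close>.
\<close>

lemma residue_Gamma_times:
  assumes U: "open U" "- a - of_nat k \<in> U" and h: "h holomorphic_on U"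
  shows "residue (\<lambda>s. Gamma (s + a) * h s) (- a - of_nat k) = (-1) ^ k / fact k * h (- a - of_nat k)"
proof -
  let ?p = "- a - of_nat k"
  have np: "s + a \<notin> \<int>\<^sub>\<le>\<^sub>0" if "s \<in> ball ?p 1 - {?p}" for s
  proof
    assume "s + a \<in> \<int>\<^sub>\<le>\<^sub>0"
    then obtain j where "s + a = of_int j" by (auto elim!: nonpos_Ints_cases)
    then have s: "s = of_int j - a" by (simp add: algebra_simps)
    with that have "norm (of_int j + of_nat k :: complex) < 1"
      by (simp add: dist_norm norm_minus_commute)
    then have "norm (of_int (j + int k) :: complex) < 1" by simp
    then have "\<bar>j + int k\<bar> < 1" unfolding norm_of_int by linarith
    then have "j = - int k" by simp
    then show False using s that by simp
  qed
  show ?thesis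
  proof (rule residue_simple')
    show "open (U \<inter> ball ?p 1)" "?p \<in> U \<inter> ball ?p 1" using U by auto
    show "(\<lambda>s. Gamma (s + a) * h s) holomorphic_on U \<inter> ball ?p 1 - {?p}"
      using np by (intro holomorphic_intros holomorphic_on_subset[OF h]) auto
    have "((\<lambda>w. Gamma w * (w + of_nat k)) \<longlongrightarrow> (-1) ^ k / fact k) (at (- of_nat k))"
      by (rule Gamma_residues)
    then have G: "((\<lambda>s. Gamma (s + a) * (s + a + of_nat k)) \<longlongrightarrow> (-1) ^ k / fact k) (at ?p)"
      by (subst at_to_0, subst (asm) at_to_0) (simp add: filterlim_filtermap algebra_simps)
    have "isCont h ?p"
      using h U by (meson continuous_on_eq_continuous_at holomorphic_on_imp_continuous_on)
    then have H: "(h \<longlongrightarrow> h ?p) (at ?p)" by (simp add: isCont_def)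
    show "((\<lambda>s. Gamma (s + a) * h s * (s - ?p)) \<longlongrightarrow> (-1) ^ k / fact k * h ?p) (at ?p)"
      using tendsto_mult[OF G H] by (simp add: algebra_simps)
  qed
qed

text \<open>
  The integrand has two arithmetic progressions of simple poles to the left of the line
  \<open>Re s = c\<close>; they do not collide since \<open>a - b\<close> is not an integer. The line is moved to
  \<open>Re s = d - N\<close>, where the offset \<open>d\<close> is chosen so that no line of this family meets a pole. The
  hypothesis on \<open>\<rho>\<close> compares the integrand on consecutive lines; as \<open>\<rho>\<close> tends to zero, it beats
  the factor \<open>x\<close> that each step costs, and the remainder vanishes for every \<open>x\<close>.
\<close>

lemma Gamma_pair_residue_expansion:
  fixes a b :: complex and E :: "complex \<Rightarrow> complex" and x c d r :: real
  defines "\<Phi> \<equiv> \<lambda>s. Gamma (s + a) * Gamma (s + b) * E s"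
  assumes ab: "a - b \<notin> \<int>" and x: "x > 0" and dcr: "d < c" "c < r"
    and right: "Re a + c > 0" "Re b + c > 0"
    and gen: "d + Re a \<notin> \<int>" "d + Re b \<notin> \<int>"
    and E: "E holomorphic_on {s. Re s < r}"
    and decay: "\<And>l. \<exists>C T. \<forall>s. l \<le> Re s \<and> Re s \<le> c \<and> \<bar>Im s\<bar> \<ge> T \<longrightarrow> norm (\<Phi> s) \<le> C * exp (- \<bar>Im s\<bar>)"
    and rho: "\<rho> \<longlonglongrightarrow> (0::real)"
      "\<forall>\<^sub>F n in sequentially. \<forall>t. norm (\<Phi> (Complex (d - real (Suc n)) t)) \<le> \<rho> n * norm (\<Phi> (Complex (d - real n) t))"
    and A: "(\<lambda>k. (-1) ^ k / fact k * (Gamma (b - a - of_nat k) * E (- a - of_nat k) * of_real x powr (a + of_nat k))) sums A"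
    and B: "(\<lambda>k. (-1) ^ k / fact k * (Gamma (a - b - of_nat k) * E (- b - of_nat k) * of_real x powr (b + of_nat k))) sums B"
  shows "(LINT t|lborel. \<Phi> (Complex c t) * of_real x powr (- Complex c t)) = 2 * of_real pi * (A + B)"
proof -
  define \<Psi> where "\<Psi> s = \<Phi> s * of_real x powr (- s)" for s
  define m where "m (z::complex) N = nat \<lceil>real N - d - Re z\<rceil>" for z N
  define Q where "Q z N = (\<lambda>k. - z - of_nat k) ` {..<m z N}" for z :: complex and N
  have mlt: "k < m z N \<longleftrightarrow> real k < real N - d - Re z" for k z N
    unfolding m_def by linarith
  have powr_norm: "norm (of_real x powr s :: complex) = x powr (Re s)" for s
    using x by (simp add: norm_powr_real_powr)
  have Q: "finite (Q z N)" "p \<in> Q z N \<Longrightarrow> d - real N < Re p" for z N p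
    unfolding Q_def by (auto simp: mlt)
  \<comment> \<open>The left edge of the region extends past \<open>Re s = d - N\<close> by the fractional part of \<open>d + Re z\<close>,
    which is the distance to the next pole on the left.\<close>
  have no_pole: "s + z \<notin> \<int>\<^sub>\<le>\<^sub>0"
    if "z = a \<or> z = b" "s \<notin> Q z N" "d - real N - frac (d + Re z) < Re s" for s z N
  proof
    assume "s + z \<in> \<int>\<^sub>\<le>\<^sub>0"
    then obtain k where k: "s + z = - of_nat k" by (auto elim!: nonpos_Ints_cases')
    have "s = (s + z) - z" by simp
    then have s: "s = - z - of_nat k" unfolding k by simp
    then have "k \<ge> m z N" using that(2) unfolding Q_def by (metis imageI lessThan_iff not_less)
    then have "real_of_int (int N - int k) \<le> d + Re z" using mlt[of k z N] by simp
    then have "int N - int k \<le> \<lfloor>d + Re z\<rfloor>" by (simp only: le_floor_iff)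
    then have "frac (d + Re z) \<le> d + Re z - (real N - real k)" unfolding frac_def by linarith
    then show False using that(3) s by simp
  qed
  have frac_pos: "frac (d + Re a) > 0" "frac (d + Re b) > 0"
    using gen by (simp_all add: frac_gt_0_iff)
  have \<Phi>_holo: "\<Phi> holomorphic_on {s. d - real N - min (frac (d + Re a)) (frac (d + Re b)) < Re s \<and> Re s < r} - (Q a N \<union> Q b N)" for N
  proof -
    have "s + a \<notin> \<int>\<^sub>\<le>\<^sub>0" "s + b \<notin> \<int>\<^sub>\<le>\<^sub>0"
      if "d - real N - min (frac (d + Re a)) (frac (d + Re b)) < Re s" "s \<notin> Q a N" "s \<notin> Q b N" for s
      using no_pole[of a s N] no_pole[of b s N] that by auto
    then show ?thesis unfolding \<Phi>_def
      by (intro holomorphic_intros holomorphic_on_subset[OF E]) auto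
  qed
  have pw_holo: "(\<lambda>s. of_real x powr (- s)) holomorphic_on X" for X
    using x by (intro holomorphic_intros) auto
  have \<Phi>_line: "continuous_on UNIV (\<lambda>t. \<Phi> (Complex (d - real N) t))" for N
    unfolding Complex_eq
    by (rule continuous_on_compose2[OF holomorphic_on_imp_continuous_on[OF \<Phi>_holo[of N]]])
      (use frac_pos dcr Q(2)[of _ _ N] in \<open>fastforce intro!: continuous_intros\<close>)+
  have \<Phi>_int: "integrable lborel (\<lambda>t. \<Phi> (Complex (d - real N) t))" for N
  proof -
    obtain C T where CT: "\<And>s. d - real N \<le> Re s \<Longrightarrow> Re s \<le> c \<Longrightarrow> \<bar>Im s\<bar> \<ge> T \<Longrightarrow> norm (\<Phi> s) \<le> C * exp (- \<bar>Im s\<bar>)"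
      using decay[of "d - real N"] by blast
    have "norm (\<Phi> (Complex (d - real N) t)) \<le> C * exp (- 1 * \<bar>t\<bar>)" if "\<bar>t\<bar> \<ge> T" for t
      using CT[of "Complex (d - real N) t"] that dcr by simp
    then show ?thesis by (rule integrable_exp_decay[OF \<Phi>_line zero_less_one])
  qed
  have res: "residue \<Psi> (- z - of_nat k) = (-1) ^ k / fact k *
      (Gamma (w - z - of_nat k) * E (- z - of_nat k) * of_real x powr (z + of_nat k))"
    if zw: "z = a \<and> w = b \<or> z = b \<and> w = a" for z w k
  proof -
    define U where "U = {s. Re s < r} - {s. s + w \<in> \<int>\<^sub>\<le>\<^sub>0}"
    have "closed ((\<lambda>s. s + w) -` \<int>\<^sub>\<le>\<^sub>0)" by (intro closed_vimage continuous_intros) auto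
    then have "open U" unfolding U_def vimage_def by (intro open_Diff open_halfspace_Re_lt)
    moreover have "w - z - of_nat k \<notin> \<int>\<^sub>\<le>\<^sub>0"
    proof
      assume "w - z - of_nat k \<in> \<int>\<^sub>\<le>\<^sub>0"
      then obtain n where n: "w - z - of_nat k = of_int n" by (auto elim!: nonpos_Ints_cases)
      have "w - z = (w - z - of_nat k) + of_nat k" by simp
      then have "w - z \<in> \<int>" unfolding n by simp
      then have "w - z \<in> \<int>" "z - w \<in> \<int>" using Ints_minus[of "w - z"] by auto
      then show False using ab zw by auto
    qed
    then have "- z - of_nat k \<in> U"
      using right dcr zw by (auto simp: U_def algebra_simps)
    moreover have "(\<lambda>s. Gamma (s + w) * E s * of_real x powr (- s)) holomorphic_on U"
      by (intro holomorphic_on_mult holomorphic_Gamma' holomorphic_intros holomorphic_on_subset[OF E] pw_holo)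
        (auto simp: U_def)
    ultimately have "residue (\<lambda>s. Gamma (s + z) * (Gamma (s + w) * E s * of_real x powr (- s))) (- z - of_nat k)
        = (-1) ^ k / fact k * (Gamma (- z - of_nat k + w) * E (- z - of_nat k) * of_real x powr (- (- z - of_nat k)))"
      by (rule residue_Gamma_times)
    moreover have "\<Psi> = (\<lambda>s. Gamma (s + z) * (Gamma (s + w) * E s * of_real x powr (- s)))"
      using zw by (auto simp: \<Psi>_def \<Phi>_def mult_ac)
    ultimately show ?thesis by (simp add: algebra_simps)
  qed
  have resA: "residue \<Psi> (- a - of_nat k) = (-1) ^ k / fact k *
      (Gamma (b - a - of_nat k) * E (- a - of_nat k) * of_real x powr (a + of_nat k))"
    and resB: "residue \<Psi> (- b - of_nat k) = (-1) ^ k / fact k *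
      (Gamma (a - b - of_nat k) * E (- b - of_nat k) * of_real x powr (b + of_nat k))" for k
    by (rule res; simp)+
  \<comment> \<open>The numbers \<open>m a N\<close> and \<open>m b N\<close> count the poles of either family to the right of \<open>Re s = d - N\<close>.\<close>
  have shift: "(LINT t|lborel. \<Psi> (Complex c t)) - (LINT t|lborel. \<Psi> (Complex (d - real N) t))
      = 2 * of_real pi * ((\<Sum>k<m a N. residue \<Psi> (- a - of_nat k)) + (\<Sum>k<m b N. residue \<Psi> (- b - of_nat k)))" for N
  proof -
    define S where "S = {s. d - real N - min (frac (d + Re a)) (frac (d + Re b)) < Re s \<and> Re s < r}"
    have Seq: "S = {s. d - real N - min (frac (d + Re a)) (frac (d + Re b)) < Re s} \<inter> {s. Re s < r}"
      by (auto simp: S_def)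
    obtain C T where CT: "\<And>s. d - real N \<le> Re s \<Longrightarrow> Re s \<le> c \<Longrightarrow> \<bar>Im s\<bar> \<ge> T \<Longrightarrow> norm (\<Phi> s) \<le> C * exp (- \<bar>Im s\<bar>)"
      using decay[of "d - real N"] by blast
    define M where "M = x powr (- (d - real N)) + x powr (- c)"
    have M: "x powr (- \<sigma>) \<le> M" if "d - real N \<le> \<sigma>" "\<sigma> \<le> c" for \<sigma>
    proof (cases "x \<ge> 1")
      case True
      then have "x powr (- \<sigma>) \<le> x powr (- (d - real N))" using that by (intro powr_mono) auto
      then show ?thesis by (simp add: M_def add_increasing2)
    next
      case False
      then have "x powr (- \<sigma>) \<le> x powr (- c)" using that x by (intro powr_mono') auto
      then show ?thesis by (simp add: M_def add_increasing)
    qed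
    have "(LINT t|lborel. \<Psi> (Complex c t)) - (LINT t|lborel. \<Psi> (Complex (d - real N) t))
      = 2 * of_real pi * (\<Sum>p\<in>Q a N \<union> Q b N. residue \<Psi> p)"
    proof (rule vertical_line_shift[where S = S and T = T and C = "\<bar>C\<bar> * M" and c = 1])
      show "open S" unfolding Seq by (intro open_Int open_halfspace_Re_gt open_halfspace_Re_lt)
      have fpos: "0 < min (frac (d + Re a)) (frac (d + Re b))"
        using frac_pos by (simp only: min_less_iff_conj)
      show "{s. d - real N \<le> Re s \<and> Re s \<le> c} \<subseteq> S"
      proof (intro subsetI)
        fix s assume "s \<in> {s. d - real N \<le> Re s \<and> Re s \<le> c}"
        then show "s \<in> S" unfolding S_def mem_Collect_eq using dcr fpos by linarith
      qed
      show "connected S" unfolding Seq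
        by (intro convex_connected convex_Int convex_halfspace_Re_gt convex_halfspace_Re_lt)
      show "Q a N \<union> Q b N \<subseteq> {s. d - real N < Re s \<and> Re s < c}"
        using right by (auto simp: Q_def mlt)
      show "\<Psi> holomorphic_on S - (Q a N \<union> Q b N)"
        unfolding \<Psi>_def[abs_def] S_def by (intro holomorphic_on_mult \<Phi>_holo pw_holo)
      fix s assume s: "d - real N \<le> Re s" "Re s \<le> c" "T \<le> \<bar>Im s\<bar>"
      have "norm (\<Psi> s) = norm (\<Phi> s) * x powr (- Re s)"
        by (simp add: \<Psi>_def norm_mult powr_norm)
      also have "\<dots> \<le> (\<bar>C\<bar> * exp (- \<bar>Im s\<bar>)) * M"
        using s M by (intro mult_mono order_trans[OF CT] mult_right_mono) auto
      finally show "norm (\<Psi> s) \<le> \<bar>C\<bar> * M * exp (- 1 * \<bar>Im s\<bar>)" by (simp add: mult_ac)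
    qed (use dcr Q in auto)
    also have "(\<Sum>p\<in>Q a N \<union> Q b N. residue \<Psi> p) = (\<Sum>p\<in>Q a N. residue \<Psi> p) + (\<Sum>p\<in>Q b N. residue \<Psi> p)"
    proof (rule sum.union_disjoint)
      have "a - b \<in> \<int>" if "- a - of_nat j = - b - of_nat k" for j k
      proof -
        have "a - b = of_nat k - of_nat j" using that by (simp add: algebra_simps)
        then show ?thesis by simp
      qed
      then show "Q a N \<inter> Q b N = {}" using ab unfolding Q_def by blast
    qed (use Q in auto)
    also have "(\<Sum>p\<in>Q a N. residue \<Psi> p) = (\<Sum>k<m a N. residue \<Psi> (- a - of_nat k))"
      unfolding Q_def by (subst sum.reindex) (auto simp: inj_on_def)
    also have "(\<Sum>p\<in>Q b N. residue \<Psi> p) = (\<Sum>k<m b N. residue \<Psi> (- b - of_nat k))"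
      unfolding Q_def by (subst sum.reindex) (auto simp: inj_on_def)
    finally show ?thesis .
  qed
  have mlim: "filterlim (m z) at_top sequentially" for z
  proof (rule filterlim_at_top_mono[where f = "\<lambda>N. N - nat \<lceil>d + Re z\<rceil>"])
    show "filterlim (\<lambda>N. N - nat \<lceil>d + Re z\<rceil>) at_top sequentially"
      by (rule filterlim_minus_const_nat_at_top)
    show "\<forall>\<^sub>F N in sequentially. N - nat \<lceil>d + Re z\<rceil> \<le> m z N"
      unfolding m_def by (intro always_eventually allI) linarith
  qed
  have remainder: "(\<lambda>N. LINT t|lborel. \<Psi> (Complex (d - real N) t)) \<longlonglongrightarrow> 0"
  proof (rule Lim_null_comparison)
    define J where "J N = x powr (- (d - real N)) * (LINT t|lborel. norm (\<Phi> (Complex (d - real N) t)))" for N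
    show "\<forall>\<^sub>F N in sequentially. norm (LINT t|lborel. \<Psi> (Complex (d - real N) t)) \<le> J N"
    proof (intro always_eventually allI)
      fix N
      have "norm (LINT t|lborel. \<Psi> (Complex (d - real N) t)) \<le> (LINT t|lborel. norm (\<Psi> (Complex (d - real N) t)))"
        by (rule integral_norm_bound)
      also have "\<dots> = J N"
        by (simp add: J_def \<Psi>_def norm_mult powr_norm mult.commute)
      finally show "norm (LINT t|lborel. \<Psi> (Complex (d - real N) t)) \<le> J N" .
    qed
    show "J \<longlonglongrightarrow> 0"
    proof (rule ratio_tendsto_zero_imp_tendsto_zero[where q = "\<lambda>n. x * \<rho> n"])
      show "J n \<ge> 0" for n by (auto simp: J_def)
      show "(\<lambda>n. x * \<rho> n) \<longlonglongrightarrow> 0" using tendsto_mult[OF tendsto_const rho(1)] by simp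
      show "\<forall>\<^sub>F n in sequentially. J (Suc n) \<le> x * \<rho> n * J n"
        using rho(2)
      proof eventually_elim
        case (elim n)
        have "(LINT t|lborel. norm (\<Phi> (Complex (d - real (Suc n)) t))) \<le>
            (LINT t|lborel. \<rho> n * norm (\<Phi> (Complex (d - real n) t)))"
          using elim by (intro integral_mono integrable_mult_right integrable_norm \<Phi>_int) auto
        then have "J (Suc n) \<le> x powr (- (d - real (Suc n))) * (\<rho> n * (LINT t|lborel. norm (\<Phi> (Complex (d - real n) t))))"
          unfolding J_def by (intro mult_left_mono) auto
        also have "x powr (- (d - real (Suc n))) = x * x powr (- (d - real n))"
          using x powr_add[of x 1 "- (d - real n)"] by (simp add: algebra_simps)
        finally show ?case by (simp add: J_def mult_ac)
      qed
    qed
  qed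
  have "(\<lambda>N. (LINT t|lborel. \<Psi> (Complex c t)) - (LINT t|lborel. \<Psi> (Complex (d - real N) t)))
      \<longlonglongrightarrow> (LINT t|lborel. \<Psi> (Complex c t)) - 0"
    by (intro tendsto_diff tendsto_const remainder)
  moreover have "(\<lambda>N. 2 * of_real pi * ((\<Sum>k<m a N. residue \<Psi> (- a - of_nat k)) + (\<Sum>k<m b N. residue \<Psi> (- b - of_nat k))))
      \<longlonglongrightarrow> 2 * of_real pi * (A + B)"
    unfolding resA resB
    by (intro tendsto_mult tendsto_add tendsto_const filterlim_compose[OF A[unfolded sums_def] mlim]
          filterlim_compose[OF B[unfolded sums_def] mlim])
  ultimately have "(LINT t|lborel. \<Psi> (Complex c t)) - 0 = 2 * of_real pi * (A + B)"
    unfolding shift by (rule LIMSEQ_unique)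
  then show ?thesis by (simp add: \<Psi>_def)
qed

section \<open>Power series for products of Bessel functions\<close>

lemma bessel_series_summable_norm:
  fixes w \<mu> :: complex
  shows "summable (\<lambda>k. norm (w ^ k * rGamma (\<mu> + of_nat k + 1) / fact k))"
proof -
  define t where "t k = w ^ k * rGamma (\<mu> + of_nat k + 1) / fact k" for k
  define N where "N = nat \<lceil>2 * norm w + norm \<mu> + 2\<rceil>"
  have "norm (t (Suc k)) \<le> 1/2 * norm (t k)" if "k \<ge> N" for k
  proof -
    define n where "n = norm (\<mu> + of_nat k + 1)"
    have k: "real k \<ge> 2 * norm w + norm \<mu> + 2" using that unfolding N_def by linarith
    have "real k = norm (of_nat k :: complex)" by simp
    also have "\<dots> \<le> n + norm (\<mu> + 1)"
      unfolding n_def using norm_triangle_ineq4[of "\<mu> + of_nat k + 1" "\<mu> + 1"] by simp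
    also have "\<dots> \<le> n + (norm \<mu> + 1)"
      using norm_triangle_ineq[of \<mu> 1] by simp
    finally have n: "2 * norm w < n" using k by simp
    then have npos: "n > 0" using norm_ge_zero[of w] by linarith
    define R where "R = rGamma (\<mu> + of_nat (Suc k) + 1)"
    have rec: "rGamma (\<mu> + of_nat k + 1) = (\<mu> + of_nat k + 1) * R"
      using rGamma_plus1[of "\<mu> + of_nat k + 1"] by (simp add: R_def add_ac)
    have nt: "norm (t k) = norm w ^ k * (n * norm R) / fact k"
      unfolding t_def rec by (simp add: norm_mult norm_divide norm_power n_def)
    have nts: "norm (t (Suc k)) = norm w ^ Suc k * norm R / fact (Suc k)"
      unfolding t_def R_def[symmetric] by (simp add: norm_mult norm_divide norm_power del: power_Suc fact_Suc)
    have "norm (t k) * norm w = norm (t (Suc k)) * (n * real (Suc k))"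
      unfolding nt nts by (simp add: field_simps del: of_nat_Suc)
    moreover have "n * real (Suc k) \<noteq> 0" using npos by simp
    ultimately have "norm (t (Suc k)) = norm (t k) * (norm w / (n * real (Suc k)))"
      by (metis nonzero_mult_div_cancel_right times_divide_eq_right)
    also have "norm w / (n * real (Suc k)) \<le> norm w / (n * 1)"
      using npos by (intro divide_left_mono mult_left_mono mult_pos_pos) auto
    also have "\<dots> \<le> 1/2" using n npos by (simp add: field_simps)
    finally show ?thesis by (simp add: mult_left_mono)
  qed
  then show ?thesis unfolding t_def[symmetric]
    by (intro summable_ratio_test[of "1/2" N]) auto
qed

text \<open>
  Pulling \<open>1 / \<Gamma>(\<mu> + m + 1)\<close> and \<open>1 / \<Gamma>(\<nu> + m + 1)\<close> out of every term leaves generalised binomial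
  coefficients, to which Vandermonde's convolution applies.
\<close>

lemma bessel_coeff_convolution:
  fixes \<mu> \<nu> :: complex
  shows "(\<Sum>i\<le>m. rGamma (\<mu> + of_nat i + 1) / fact i * (rGamma (\<nu> + of_nat (m - i) + 1) / fact (m - i)))
      = pochhammer (\<mu> + \<nu> + of_nat m + 1) m * rGamma (\<mu> + of_nat m + 1) * rGamma (\<nu> + of_nat m + 1) / fact m"
proof -
  have "rGamma (\<mu> + of_nat i + 1) / fact i * (rGamma (\<nu> + of_nat (m - i) + 1) / fact (m - i)) =
      rGamma (\<mu> + of_nat m + 1) * rGamma (\<nu> + of_nat m + 1) *
      (((\<nu> + of_nat m) gchoose i) * ((\<mu> + of_nat m) gchoose (m - i)))" if "i \<in> {0..m}" for i
  proof -
    have i: "i \<le> m" using that by simp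
    have 1: "rGamma (\<mu> + of_nat i + 1) = pochhammer (\<mu> + of_nat i + 1) (m - i) * rGamma (\<mu> + of_nat m + 1)"
      using pochhammer_rGamma[of "\<mu> + of_nat i + 1" "m - i"] i by (simp add: of_nat_diff add_ac)
    have 2: "rGamma (\<nu> + of_nat (m - i) + 1) = pochhammer (\<nu> + of_nat (m - i) + 1) i * rGamma (\<nu> + of_nat m + 1)"
      using pochhammer_rGamma[of "\<nu> + of_nat (m - i) + 1" i] i by (simp add: of_nat_diff add_ac)
    have 3: "(\<mu> + of_nat m) gchoose (m - i) = pochhammer (\<mu> + of_nat i + 1) (m - i) / fact (m - i)"
      using i by (simp add: gbinomial_pochhammer' of_nat_diff)
    have 4: "(\<nu> + of_nat m) gchoose i = pochhammer (\<nu> + of_nat (m - i) + 1) i / fact i"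
      using i by (simp add: gbinomial_pochhammer' of_nat_diff algebra_simps)
    show ?thesis unfolding 1 2 3 4 by simp
  qed
  then have "(\<Sum>i\<le>m. rGamma (\<mu> + of_nat i + 1) / fact i * (rGamma (\<nu> + of_nat (m - i) + 1) / fact (m - i))) =
      rGamma (\<mu> + of_nat m + 1) * rGamma (\<nu> + of_nat m + 1) *
      (\<Sum>i\<in>{0..m}. ((\<nu> + of_nat m) gchoose i) * ((\<mu> + of_nat m) gchoose (m - i)))"
    unfolding sum_distrib_left atLeast0AtMost[symmetric] by (rule sum.cong[OF refl])
  also have "(\<Sum>i\<in>{0..m}. ((\<nu> + of_nat m) gchoose i) * ((\<mu> + of_nat m) gchoose (m - i)))
      = ((\<nu> + of_nat m) + (\<mu> + of_nat m)) gchoose m"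
    by (rule gbinomial_Vandermonde)
  also have "\<dots> = pochhammer (\<mu> + \<nu> + of_nat m + 1) m / fact m"
    by (simp add: gbinomial_pochhammer' algebra_simps)
  finally show ?thesis by simp
qed

lemma bessel_I_mult_sums:
  assumes z: "z > 0"
  shows "(\<lambda>m. of_real (z / 2) powr (\<mu> + \<nu>) * (of_real (z\<^sup>2 / 4) ^ m *
      (pochhammer (\<mu> + \<nu> + of_nat m + 1) m * rGamma (\<mu> + of_nat m + 1) * rGamma (\<nu> + of_nat m + 1) / fact m)))
    sums (bessel_I \<mu> (of_real z) * bessel_I \<nu> (of_real z))"
proof -
  define w :: complex where "w = of_real (z\<^sup>2 / 4)"
  let ?f = "\<lambda>\<mu> k. w ^ k * rGamma (\<mu> + of_nat k + 1) / fact k"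
  have "(\<Sum>i\<le>m. ?f \<mu> i * ?f \<nu> (m - i)) = w ^ m *
      (pochhammer (\<mu> + \<nu> + of_nat m + 1) m * rGamma (\<mu> + of_nat m + 1) * rGamma (\<nu> + of_nat m + 1) / fact m)" for m
  proof -
    have "?f \<mu> i * ?f \<nu> (m - i) = w ^ m *
        (rGamma (\<mu> + of_nat i + 1) / fact i * (rGamma (\<nu> + of_nat (m - i) + 1) / fact (m - i)))" if "i \<in> {..m}" for i
    proof -
      have "w ^ m = w ^ i * w ^ (m - i)" using that by (simp flip: power_add)
      then show ?thesis by simp
    qed
    then have "(\<Sum>i\<le>m. ?f \<mu> i * ?f \<nu> (m - i)) = w ^ m *
      (\<Sum>i\<le>m. rGamma (\<mu> + of_nat i + 1) / fact i * (rGamma (\<nu> + of_nat (m - i) + 1) / fact (m - i)))"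
      unfolding sum_distrib_left by (rule sum.cong[OF refl])
    then show ?thesis by (simp only: bessel_coeff_convolution)
  qed
  then have "(\<lambda>m. w ^ m *
      (pochhammer (\<mu> + \<nu> + of_nat m + 1) m * rGamma (\<mu> + of_nat m + 1) * rGamma (\<nu> + of_nat m + 1) / fact m))
      sums ((\<Sum>k. ?f \<mu> k) * (\<Sum>k. ?f \<nu> k))"
    using Cauchy_product_sums[OF bessel_series_summable_norm[of w \<mu>] bessel_series_summable_norm[of w \<nu>]] by simp
  from sums_mult[OF this, of "of_real (z / 2) powr (\<mu> + \<nu>)"]
  show ?thesis
    by (simp add: bessel_I_def powr_add w_def mult_ac)
qed

lemma Gamma_reflection_shift:
  fixes \<kappa> :: complex
  assumes "\<kappa> \<notin> \<int>"
  shows "Gamma (- \<kappa> - of_nat k) = - ((-1) ^ k) * of_real pi / sin (of_real pi * \<kappa>) * rGamma (\<kappa> + of_nat k + 1)"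
proof -
  have ni: "\<kappa> + of_nat k + 1 \<notin> \<int>\<^sub>\<le>\<^sub>0"
  proof
    assume "\<kappa> + of_nat k + 1 \<in> \<int>\<^sub>\<le>\<^sub>0"
    then obtain n where n: "\<kappa> + of_nat k + 1 = of_int n" by (auto elim!: nonpos_Ints_cases)
    have "\<kappa> = (\<kappa> + of_nat k + 1) - of_nat k - 1" by simp
    then have "\<kappa> \<in> \<int>" unfolding n by simp
    then show False using assms by simp
  qed
  then have g: "Gamma (\<kappa> + of_nat k + 1) \<noteq> 0" by (simp add: Gamma_eq_zero_iff)
  have sin_pi: "sin (A + of_real pi) = - sin A" for A :: complex
    unfolding sin_add by (simp add: cos_of_real sin_of_real)
  have "sin (of_real pi * (\<kappa> + of_nat (k + 1))) = (-1) ^ (k + 1) * sin (of_real pi * \<kappa>)"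
  proof (induction k)
    case 0
    show ?case using sin_pi[of "of_real pi * \<kappa>"] by (simp add: distrib_left)
  next
    case (Suc k)
    have "of_real pi * (\<kappa> + of_nat (Suc k + 1)) = of_real pi * (\<kappa> + of_nat (k + 1)) + of_real pi"
      by (simp add: algebra_simps)
    then show ?case using Suc.IH sin_pi by simp
  qed
  then have s: "sin (of_real pi * (\<kappa> + of_nat k + 1)) = - ((-1) ^ k) * sin (of_real pi * \<kappa>)"
  proof -
    have e: "\<kappa> + of_nat k + 1 = \<kappa> + of_nat (k + 1)" by simp
    assume "sin (of_real pi * (\<kappa> + of_nat (k + 1))) = (-1) ^ (k + 1) * sin (of_real pi * \<kappa>)"
    then show ?thesis unfolding e by simp
  qed
  have "Gamma (\<kappa> + of_nat k + 1) * Gamma (1 - (\<kappa> + of_nat k + 1)) = of_real pi / sin (of_real pi * (\<kappa> + of_nat k + 1))"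
    by (rule Gamma_reflection_complex)
  then have "Gamma (\<kappa> + of_nat k + 1) * Gamma (- \<kappa> - of_nat k) = of_real pi / (- ((-1) ^ k) * sin (of_real pi * \<kappa>))"
    unfolding s by (simp add: algebra_simps)
  then have "Gamma (- \<kappa> - of_nat k) = of_real pi / (- ((-1) ^ k) * sin (of_real pi * \<kappa>)) / Gamma (\<kappa> + of_nat k + 1)"
    using g by (metis nonzero_mult_div_cancel_left)
  then show ?thesis
    by (cases "even k") (simp_all add: rGamma_inverse_Gamma divide_inverse)
qed

text \<open>
  The terms on the left are the residues that occur below. Reflection turns \<open>\<Gamma>(-\<kappa> - k)\<close> into
  \<open>1 / \<Gamma>(\<kappa> + k + 1)\<close>, and Legendre duplication merges the Gamma functions at \<open>1/2 + e + k\<close> and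
  \<open>1 + e + k\<close> into the Pochhammer symbol of the product series.
\<close>

lemma bessel_product_residue_sums:
  assumes x: "x > 0" and lam: "\<kappa> \<notin> \<int>" and e: "\<kappa> + \<nu> = 2 * e" "Re e > -1/2"
  shows "(\<lambda>k. (-1) ^ k / fact k * (Gamma (- \<kappa> - of_nat k) *
      (Gamma (1/2 + e + of_nat k) * Gamma (1 + e + of_nat k) * rGamma (1 + 2 * e + of_nat k) *
        rGamma (1 + \<nu> + of_nat k) / (2 * of_real (sqrt pi))) * of_real x powr (e + of_nat k)))
    sums (- of_real pi / (2 * sin (of_real pi * \<kappa>)) * (bessel_I \<kappa> (of_real (sqrt x)) * bessel_I \<nu> (of_real (sqrt x))))"
proof -
  let ?c = "- complex_of_real pi / (2 * sin (of_real pi * \<kappa>))"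
  have eq: "?c * (of_real (sqrt x / 2) powr (\<kappa> + \<nu>) * (of_real ((sqrt x)\<^sup>2 / 4) ^ k *
      (pochhammer (\<kappa> + \<nu> + of_nat k + 1) k * rGamma (\<kappa> + of_nat k + 1) * rGamma (\<nu> + of_nat k + 1) / fact k)))
    = (-1) ^ k / fact k * (Gamma (- \<kappa> - of_nat k) *
      (Gamma (1/2 + e + of_nat k) * Gamma (1 + e + of_nat k) * rGamma (1 + 2 * e + of_nat k) *
        rGamma (1 + \<nu> + of_nat k) / (2 * of_real (sqrt pi))) * of_real x powr (e + of_nat k))" for k
  proof -
    have np: "z \<notin> \<int>\<^sub>\<le>\<^sub>0" if "Re z > 0" for z :: complex
      using that by (auto elim!: nonpos_Ints_cases)
    have dup: "Gamma (1/2 + e + of_nat k) * Gamma (1 + e + of_nat k) =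
        exp (- 2 * (e + of_nat k) * of_real (ln 2)) * of_real (sqrt pi) * Gamma (1 + 2 * e + of_nat k + of_nat k)"
    proof -
      define v where "v = 1/2 + e + of_nat k"
      have v: "v + 1/2 = 1 + e + of_nat k" "2 * v = 1 + 2 * e + of_nat k + of_nat k"
          "1 - 2 * v = - 2 * (e + of_nat k)"
        by (simp_all add: v_def algebra_simps)
      have "Gamma v * Gamma (v + 1/2) = exp ((1 - 2 * v) * of_real (ln 2)) * of_real (sqrt pi) * Gamma (2 * v)"
        using e(2) by (intro Gamma_legendre_duplication np) (simp_all add: v_def)
      then show ?thesis unfolding v(3) unfolding v(1,2) unfolding v_def .
    qed
    have poch: "Gamma (1 + 2 * e + of_nat k + of_nat k) * rGamma (1 + 2 * e + of_nat k) = pochhammer (1 + 2 * e + of_nat k) k"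
    proof -
      have "Re (1 + 2 * e + of_nat k) > 0" using e(2) by simp
      from pochhammer_Gamma[OF np[OF this], of k] show ?thesis
        unfolding rGamma_inverse_Gamma divide_inverse by (rule sym)
    qed
    have pw: "of_real (sqrt x / 2) powr (2 * e) * of_real ((sqrt x)\<^sup>2 / 4) ^ k =
        exp (- 2 * (e + of_nat k) * of_real (ln 2)) * of_real x powr (e + of_nat k)"
    proof -
      have "of_real ((sqrt x)\<^sup>2 / 4) ^ k = exp (of_nat k * complex_of_real (ln (x / 4)))"
      proof -
        have "of_real ((sqrt x)\<^sup>2 / 4) = exp (complex_of_real (ln (x / 4)))"
          using x by (simp add: exp_of_real)
        then show ?thesis by (simp only: exp_of_nat_mult)
      qed
      moreover have "of_real (sqrt x / 2) powr (2 * e) = exp (2 * e * complex_of_real (ln (sqrt x / 2)))"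
        using x by (simp add: powr_def Ln_of_real del: of_real_divide)
      moreover have "of_real x powr (e + of_nat k) = exp ((e + of_nat k) * complex_of_real (ln x))"
        using x by (simp add: powr_def Ln_of_real)
      moreover have "ln (x / 4) = ln x - 2 * ln 2" "ln (sqrt x / 2) = ln x / 2 - ln 2"
        using x ln_realpow[of 2 2] by (simp_all add: ln_div ln_sqrt)
      ultimately show ?thesis by (simp add: exp_add[symmetric] algebra_simps)
    qed
    have "(-1) ^ k / fact k * (Gamma (- \<kappa> - of_nat k) *
      (Gamma (1/2 + e + of_nat k) * Gamma (1 + e + of_nat k) * rGamma (1 + 2 * e + of_nat k) *
        rGamma (1 + \<nu> + of_nat k) / (2 * of_real (sqrt pi))) * of_real x powr (e + of_nat k)) =
      ((-1) ^ k * Gamma (- \<kappa> - of_nat k)) * (exp (- 2 * (e + of_nat k) * of_real (ln 2)) * of_real x powr (e + of_nat k)) *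
        (Gamma (1 + 2 * e + of_nat k + of_nat k) * rGamma (1 + 2 * e + of_nat k)) * rGamma (1 + \<nu> + of_nat k) / (2 * fact k)"
      unfolding dup using pi_gt_zero by (simp add: field_simps)
    also have "(-1) ^ k * Gamma (- \<kappa> - of_nat k) = - of_real pi / sin (of_real pi * \<kappa>) * rGamma (\<kappa> + of_nat k + 1)"
      by (cases "even k") (simp_all add: Gamma_reflection_shift[OF lam])
    finally show ?thesis unfolding poch pw[symmetric] e(1) by (simp add: field_simps)
  qed
  show ?thesis
    using sums_mult[OF bessel_I_mult_sums[of "sqrt x" \<kappa> \<nu>], of ?c] x unfolding eq by simp
qed

text \<open>
  The coefficients of \<open>(z/2) powr (-\<nu>) * bessel_I \<nu> z\<close>.
\<close>

definition bessel_fps :: "complex \<Rightarrow> complex fps" where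
  "bessel_fps \<nu> = Abs_fps (\<lambda>n. if even n then (1/4) ^ (n div 2) * rGamma (\<nu> + of_nat (n div 2) + 1) / fact (n div 2) else 0)"

lemma bessel_fps_recurrence:
  "of_nat (n + 1) * (of_nat n + 2 * \<nu> + 1) * fps_nth (bessel_fps \<nu>) (n + 1) = (if n = 0 then 0 else fps_nth (bessel_fps \<nu>) (n - 1))"
proof (cases "even n")
  case True
  then show ?thesis by (auto simp: bessel_fps_def)
next
  case False
  then obtain j where n: "n = 2 * j + 1" by (elim oddE)
  define R where "R = rGamma (\<nu> + of_nat (Suc j) + 1)"
  have rec: "rGamma (\<nu> + of_nat j + 1) = (\<nu> + of_nat j + 1) * R"
  proof -
    have "R = rGamma (\<nu> + of_nat j + 1 + 1)" unfolding R_def by (rule arg_cong[of _ _ rGamma]) simp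
    then show ?thesis by (simp only: rGamma_plus1)
  qed
  define J where "J = (of_nat (Suc j) :: complex)"
  have J: "J \<noteq> 0" "fact (Suc j) = J * (fact j :: complex)"
    by (simp_all only: J_def of_nat_eq_0_iff fact_Suc)
  have 1: "fps_nth (bessel_fps \<nu>) (n - 1) = (1/4) ^ j * ((\<nu> + J) * R) / fact j"
  proof -
    have "\<nu> + of_nat j + 1 = \<nu> + J" by (simp add: J_def)
    with rec have "rGamma (\<nu> + of_nat j + 1) = (\<nu> + J) * R" by (simp only:)
    moreover have "fps_nth (bessel_fps \<nu>) (n - 1) = (1/4) ^ j * rGamma (\<nu> + of_nat j + 1) / fact j"
      by (simp add: bessel_fps_def n)
    ultimately show ?thesis by (simp only:)
  qed
  have "fps_nth (bessel_fps \<nu>) (n + 1) = (1/4) ^ Suc j * R / fact (Suc j)"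
    by (simp add: bessel_fps_def n R_def del: power_Suc fact_Suc)
  then have 2: "fps_nth (bessel_fps \<nu>) (n + 1) = (1/4) * (1/4) ^ j * R / (J * fact j)"
    unfolding J(2) by simp
  have 3: "of_nat (n + 1) = 2 * J" "of_nat n + 2 * \<nu> + 1 = 2 * (\<nu> + J)"
    by (simp_all add: n J_def algebra_simps)
  define V where "V = \<nu> + J"
  show ?thesis unfolding 1 2 3 V_def[symmetric] using J(1) n by simp
qed

text \<open>
  Kummer's formula that expresses \<open>exp z * I\<^sub>\<nu>(z)\<close> through \<open>\<^sub>1F\<^sub>1(\<nu> + 1/2; 2 \<nu> + 1; 2 z)\<close>. Multiplication by the
  exponential turns Bessel's equation \<open>z f'' + (2 \<nu> + 1) f' = z f\<close> into
  \<open>z h'' + (2 \<nu> + 1 - 2 z) h' = (2 \<nu> + 1) h\<close>, and the latter is a two-term recurrence for the coefficients.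
\<close>

lemma exp_times_bessel_fps_nth:
  assumes "Re \<nu> > -1/2"
  shows "fps_nth (fps_exp 1 * bessel_fps \<nu>) n = 2 ^ n * exp (2 * \<nu> * of_real (ln 2)) *
    Gamma (1/2 + \<nu> + of_nat n) * rGamma (1 + 2 * \<nu> + of_nat n) / (of_real (sqrt pi) * fact n)"
proof -
  define F E where "F = bessel_fps \<nu>" and "E = (fps_exp 1 :: complex fps)"
  define H where "H = E * F"
  have np: "z \<notin> \<int>\<^sub>\<le>\<^sub>0" if "Re z > 0" for z :: complex
    using that by (auto elim!: nonpos_Ints_cases)
  \<comment> \<open>Bessel's equation for \<open>(z/2) powr (-\<nu>) * bessel_I \<nu> z\<close>.\<close>
  have ode: "fps_X * fps_deriv (fps_deriv F) + fps_const (2 * \<nu> + 1) * fps_deriv F = fps_X * F"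
  proof (rule fps_ext)
    fix n
    show "fps_nth (fps_X * fps_deriv (fps_deriv F) + fps_const (2 * \<nu> + 1) * fps_deriv F) n = fps_nth (fps_X * F) n"
      using bessel_fps_recurrence[of n \<nu>] by (cases n) (simp_all add: F_def algebra_simps)
  qed
  have E': "fps_deriv E = E" by (simp add: E_def)
  have "fps_X * fps_deriv (fps_deriv H) + fps_const (2 * \<nu> + 1) * fps_deriv H
      - fps_X * fps_deriv H - fps_X * fps_deriv H - fps_const (2 * \<nu> + 1) * H
    = E * (fps_X * fps_deriv (fps_deriv F) + fps_const (2 * \<nu> + 1) * fps_deriv F - fps_X * F)"
    by (simp add: H_def E' algebra_simps)
  also have "\<dots> = 0" by (simp add: ode)
  finally have odeH: "fps_nth (fps_X * fps_deriv (fps_deriv H) + fps_const (2 * \<nu> + 1) * fps_deriv H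
      - fps_X * fps_deriv H - fps_X * fps_deriv H - fps_const (2 * \<nu> + 1) * H) n = 0" for n
    by simp
  have rec: "of_nat (n + 1) * (of_nat n + 2 * \<nu> + 1) * fps_nth H (n + 1) = (2 * of_nat n + 2 * \<nu> + 1) * fps_nth H n" for n
    using odeH[of n] unfolding fps_sub_nth fps_add_nth fps_mult_left_const_nth by (cases n) (simp_all add: algebra_simps)
  have "fps_nth H n = 2 ^ n * exp (2 * \<nu> * of_real (ln 2)) *
    Gamma (1/2 + \<nu> + of_nat n) * rGamma (1 + 2 * \<nu> + of_nat n) / (of_real (sqrt pi) * fact n)"
  proof (induction n)
    case 0
    have g: "Gamma (1 + 2 * \<nu>) \<noteq> 0" "Gamma (1 + \<nu>) \<noteq> 0"
      using assms by (simp_all add: Gamma_eq_zero_iff np)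
    define v where "v = 1/2 + \<nu>"
    have v: "v + 1/2 = 1 + \<nu>" "2 * v = 1 + 2 * \<nu>" "1 - 2 * v = - (2 * \<nu>)"
      by (simp_all add: v_def algebra_simps)
    have "Gamma v * Gamma (v + 1/2) = exp ((1 - 2 * v) * of_real (ln 2)) * of_real (sqrt pi) * Gamma (2 * v)"
      using assms by (intro Gamma_legendre_duplication np) (simp_all add: v_def)
    then have "Gamma (1/2 + \<nu>) * Gamma (1 + \<nu>) = exp (- (2 * \<nu>) * of_real (ln 2)) * of_real (sqrt pi) * Gamma (1 + 2 * \<nu>)"
      unfolding v(3) unfolding v(1,2) unfolding v_def .
    then have "exp (2 * \<nu> * of_real (ln 2)) * Gamma (1/2 + \<nu>) * Gamma (1 + \<nu>) = of_real (sqrt pi) * Gamma (1 + 2 * \<nu>)"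
      by (simp add: mult.assoc exp_minus)
    then have "exp (2 * \<nu> * of_real (ln 2)) * Gamma (1/2 + \<nu>) = of_real (sqrt pi) * Gamma (1 + 2 * \<nu>) / Gamma (1 + \<nu>)"
      using g(2) by (metis nonzero_mult_div_cancel_right)
    then have eq: "exp (2 * \<nu> * of_real (ln 2)) * Gamma (1/2 + \<nu>) = of_real (sqrt pi) * (Gamma (1 + 2 * \<nu>) * rGamma (1 + \<nu>))"
      by (simp only: rGamma_inverse_Gamma divide_inverse mult.assoc)
    have "2 ^ 0 * exp (2 * \<nu> * of_real (ln 2)) * Gamma (1/2 + \<nu> + of_nat 0) * rGamma (1 + 2 * \<nu> + of_nat 0) /
        (of_real (sqrt pi) * fact 0) = (exp (2 * \<nu> * of_real (ln 2)) * Gamma (1/2 + \<nu>)) * rGamma (1 + 2 * \<nu>) / of_real (sqrt pi)"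
      by simp
    also have "\<dots> = rGamma (1 + \<nu>) * (Gamma (1 + 2 * \<nu>) * rGamma (1 + 2 * \<nu>))"
      unfolding eq by simp
    also have "\<dots> = rGamma (1 + \<nu>)" using g(1) by (simp add: rGamma_inverse_Gamma)
    also have "\<dots> = fps_nth H 0"
      by (simp add: H_def E_def F_def bessel_fps_def add_ac)
    finally show ?case by (rule sym)
  next
    case (Suc n)
    define G R where "G = Gamma (1/2 + \<nu> + of_nat n)" and "R = rGamma (1 + 2 * \<nu> + of_nat (Suc n))"
    have nz: "of_nat n + 2 * \<nu> + 1 \<noteq> 0"
    proof
      assume "of_nat n + 2 * \<nu> + 1 = 0"
      then have "Re (of_nat n + 2 * \<nu> + 1) = 0" by simp
      then show False using assms by simp
    qed
    have "Gamma ((1/2 + \<nu> + of_nat n) + 1) = (1/2 + \<nu> + of_nat n) * G"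
      unfolding G_def using assms by (intro Gamma_plus1 np) simp
    then have G': "Gamma (1/2 + \<nu> + of_nat (Suc n)) = (1/2 + \<nu> + of_nat n) * G"
      by (simp add: add_ac)
    have R': "rGamma (1 + 2 * \<nu> + of_nat n) = (of_nat n + 2 * \<nu> + 1) * R"
      using rGamma_plus1[of "1 + 2 * \<nu> + of_nat n"] by (simp add: R_def add_ac)
    define e where "e = exp (2 * \<nu> * complex_of_real (ln 2))"
    define N D Q where "N = (of_nat (Suc n) :: complex)" and "D = of_nat n + 2 * \<nu> + 1"
      and "Q = 2 * of_nat n + 2 * \<nu> + 1"
    have N: "N \<noteq> 0" "fact (Suc n) = N * (fact n :: complex)"
      by (simp_all only: N_def of_nat_eq_0_iff fact_Suc)
    have D: "D \<noteq> 0" using nz by (simp add: D_def)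
    have half: "1/2 + \<nu> + of_nat n = Q / 2" by (simp add: Q_def)
    have "N * D * fps_nth H (Suc n) = Q * (2 ^ n * e * G * (D * R) / (of_real (sqrt pi) * fact n))"
      using rec[of n] unfolding Suc.IH R' G_def e_def N_def D_def Q_def by simp
    then have "fps_nth H (Suc n) = Q * (2 ^ n * e * G * (D * R) / (of_real (sqrt pi) * fact n)) / (N * D)"
      using N(1) D by (metis mult_eq_0_iff nonzero_mult_div_cancel_left)
    also have "\<dots> = 2 ^ Suc n * e * ((1/2 + \<nu> + of_nat n) * G) * R / (of_real (sqrt pi) * fact (Suc n))"
      unfolding N(2) half using N(1) D by (simp add: mult_ac)
    finally have "fps_nth H (Suc n) = 2 ^ Suc n * e * ((1/2 + \<nu> + of_nat n) * G) * R / (of_real (sqrt pi) * fact (Suc n))" .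
    then show ?case unfolding G' R_def e_def by simp
  qed
  then show ?thesis unfolding H_def F_def E_def .
qed

lemma exp_bessel_I_sums:
  assumes nu: "Re \<nu> > -1/2" and y: "y > 0"
  shows "(\<lambda>m. of_real y powr (\<nu> + of_nat m) * (Gamma (1/2 + \<nu> + of_nat m) * rGamma (1 + 2 * \<nu> + of_nat m) / fact m))
    sums (of_real (sqrt pi) * (of_real (exp (y / 2)) * bessel_I \<nu> (of_real (y / 2))))"
proof -
  define w :: complex where "w = of_real (y / 2)"
  define f where "f n = fps_nth (bessel_fps \<nu>) n * w ^ n" for n
  define g where "g j = (w\<^sup>2 / 4) ^ j * rGamma (\<nu> + of_nat j + 1) / fact j" for j
  have f0: "f n = 0" if "n \<notin> range (\<lambda>j. 2 * j)" for n
  proof -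
    have "odd n" using that by (auto elim!: evenE)
    then show ?thesis by (simp add: f_def bessel_fps_def)
  qed
  have fg: "f (2 * j) = g j" for j
    by (simp add: f_def g_def bessel_fps_def power_mult power_divide power_one_over)
  have sm: "strict_mono (\<lambda>j::nat. 2 * j)" by (auto intro!: strict_monoI)
  have gsum: "summable (\<lambda>j. norm (g j))" unfolding g_def by (rule bessel_series_summable_norm)
  then have "summable (\<lambda>n. norm (f n))"
    using summable_mono_reindex[OF sm, of "\<lambda>n. norm (f n)"] f0 by (simp add: fg)
  moreover have "summable (\<lambda>n. norm (w ^ n /\<^sub>R fact n))" by (rule summable_norm_exp)
  ultimately have "(\<lambda>k. \<Sum>i\<le>k. w ^ i /\<^sub>R fact i * f (k - i)) sums ((\<Sum>k. w ^ k /\<^sub>R fact k) * (\<Sum>k. f k))"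
    by (intro Cauchy_product_sums)
  moreover have "(\<Sum>k. w ^ k /\<^sub>R fact k) = exp w" by (simp add: exp_def)
  moreover have "(\<Sum>k. f k) = (\<Sum>k. g k)"
  proof -
    have "g sums (\<Sum>k. g k)" using summable_norm_cancel[OF gsum] by (rule summable_sums)
    then have "(\<lambda>j. f (2 * j)) sums (\<Sum>k. g k)" by (simp only: fg)
    then have "f sums (\<Sum>k. g k)" by (subst (asm) sums_mono_reindex[OF sm]) (auto intro: f0)
    then show ?thesis by (rule sums_unique[symmetric])
  qed
  moreover have "(\<Sum>i\<le>k. w ^ i /\<^sub>R fact i * f (k - i)) = w ^ k * fps_nth (fps_exp 1 * bessel_fps \<nu>) k" for k
  proof -
    have "w ^ i /\<^sub>R fact i * f (k - i) = w ^ k * (fps_nth (fps_exp 1) i * fps_nth (bessel_fps \<nu>) (k - i))" if "i \<in> {0..k}" for i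
    proof -
      have "w ^ k = w ^ i * w ^ (k - i)" using that by (simp flip: power_add)
      then show ?thesis by (simp add: f_def scaleR_conv_of_real field_simps)
    qed
    then show ?thesis unfolding fps_mult_nth sum_distrib_left atLeast0AtMost[symmetric] by (rule sum.cong[OF refl])
  qed
  ultimately have "(\<lambda>k. w ^ k * fps_nth (fps_exp 1 * bessel_fps \<nu>) k) sums (exp w * (\<Sum>k. g k))" by simp
  from sums_mult[OF this, of "of_real (sqrt pi) * (w / 2) powr \<nu>"]
  have sums: "(\<lambda>k. of_real (sqrt pi) * (w / 2) powr \<nu> * (w ^ k * fps_nth (fps_exp 1 * bessel_fps \<nu>) k)) sums
      (of_real (sqrt pi) * (w / 2) powr \<nu> * (exp w * (\<Sum>k. g k)))" .
  have trm: "of_real (sqrt pi) * (w / 2) powr \<nu> * (w ^ k * fps_nth (fps_exp 1 * bessel_fps \<nu>) k) =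
      of_real y powr (\<nu> + of_nat k) * (Gamma (1/2 + \<nu> + of_nat k) * rGamma (1 + 2 * \<nu> + of_nat k) / fact k)" for k
  proof -
    have pw: "(w / 2) powr \<nu> * w ^ k * 2 ^ k * exp (2 * \<nu> * of_real (ln 2)) = of_real y powr (\<nu> + of_nat k)"
    proof -
      have "w / 2 = of_real (y / 4)" by (simp add: w_def)
      then have "(w / 2) powr \<nu> = exp (\<nu> * complex_of_real (ln (y / 4)))"
        using y by (simp add: powr_def Ln_of_real del: of_real_divide)
      moreover have "w ^ k * 2 ^ k = exp (of_nat k * complex_of_real (ln y))"
      proof -
        have "w * 2 = exp (complex_of_real (ln y))" using y by (simp add: w_def exp_of_real)
        then show ?thesis by (simp only: exp_of_nat_mult power_mult_distrib[symmetric])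
      qed
      moreover have "of_real y powr (\<nu> + of_nat k) = exp ((\<nu> + of_nat k) * complex_of_real (ln y))"
        using y by (simp add: powr_def Ln_of_real)
      moreover have "ln (y / 4) = ln y - 2 * ln 2"
        using y ln_realpow[of 2 2] by (simp add: ln_div)
      ultimately show ?thesis by (simp add: mult.assoc exp_add[symmetric]) (simp add: algebra_simps exp_add[symmetric])
    qed
    show ?thesis unfolding exp_times_bessel_fps_nth[OF nu] pw[symmetric] by (simp add: field_simps)
  qed
  have total: "of_real (sqrt pi) * (w / 2) powr \<nu> * (exp w * (\<Sum>k. g k)) =
      of_real (sqrt pi) * (of_real (exp (y / 2)) * bessel_I \<nu> (of_real (y / 2)))"
    unfolding bessel_I_def g_def w_def exp_of_real by (simp only: mult_ac)
  show ?thesis using sums unfolding trm total .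
qed

section \<open>The Mellin symbol of the product of Bessel functions\<close>

lemma Gamma_strip_bound_affine:
  fixes a :: complex and e :: real
  assumes "e = 1 \<or> e = -1"
  shows "\<exists>C>0. \<forall>s. l \<le> Re s \<and> Re s \<le> u \<and> \<bar>Im s\<bar> \<ge> \<bar>Im a\<bar> + 1 \<longrightarrow>
     norm (Gamma (of_real e * s + a)) \<le> C * exp (- (3/2) * \<bar>Im s\<bar>)"
proof -
  obtain C where C: "C > 0" "\<And>s. - \<bar>l\<bar> - \<bar>u\<bar> - \<bar>Re a\<bar> \<le> Re s \<Longrightarrow> Re s \<le> \<bar>l\<bar> + \<bar>u\<bar> + \<bar>Re a\<bar> \<Longrightarrow> \<bar>Im s\<bar> \<ge> 1 \<Longrightarrow>
     norm (Gamma s) \<le> C * exp (- (3/2) * \<bar>Im s\<bar>)"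
    using Gamma_strip_bound[of "- \<bar>l\<bar> - \<bar>u\<bar> - \<bar>Re a\<bar>" "\<bar>l\<bar> + \<bar>u\<bar> + \<bar>Re a\<bar>"] by blast
  have "norm (Gamma (of_real e * s + a)) \<le> C * exp (3/2 * \<bar>Im a\<bar>) * exp (- (3/2) * \<bar>Im s\<bar>)"
    if s: "l \<le> Re s" "Re s \<le> u" "\<bar>Im s\<bar> \<ge> \<bar>Im a\<bar> + 1" for s
  proof -
    have "norm (Gamma (of_real e * s + a)) \<le> C * exp (- (3/2) * \<bar>Im (of_real e * s + a)\<bar>)"
      using assms s by (intro C(2)) auto
    also have "\<dots> \<le> C * exp (3/2 * \<bar>Im a\<bar> - 3/2 * \<bar>Im s\<bar>)"
    proof -
      have "\<bar>Im s\<bar> - \<bar>Im a\<bar> \<le> \<bar>Im (of_real e * s + a)\<bar>"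
        using assms by (elim disjE) simp_all
      then show ?thesis using C(1) by simp
    qed
    also have "\<dots> = C * exp (3/2 * \<bar>Im a\<bar>) * exp (- (3/2) * \<bar>Im s\<bar>)"
      by (simp flip: exp_add)
    finally show ?thesis .
  qed
  then show ?thesis using C by (intro exI[of _ "C * exp (3/2 * \<bar>Im a\<bar>)"]) auto
qed

lemma rGamma_strip_bound_affine:
  fixes a :: complex
  shows "\<exists>C>0. \<forall>s. l \<le> Re s \<and> Re s \<le> u \<and> \<bar>Im s\<bar> \<ge> \<bar>Im a\<bar> + 1 \<longrightarrow>
     norm (rGamma (a - s)) \<le> C * exp (5/3 * \<bar>Im s\<bar>)"
proof -
  obtain C where C: "C > 0" "\<And>s. Re a - u \<le> Re s \<Longrightarrow> Re s \<le> Re a - l \<Longrightarrow> \<bar>Im s\<bar> \<ge> 1 \<Longrightarrow>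
     norm (rGamma s) \<le> C * exp (5/3 * \<bar>Im s\<bar>)"
    using rGamma_strip_bound[of "Re a - u" "Re a - l"] by blast
  have "norm (rGamma (a - s)) \<le> C * exp (5/3 * \<bar>Im a\<bar>) * exp (5/3 * \<bar>Im s\<bar>)"
    if s: "l \<le> Re s" "Re s \<le> u" "\<bar>Im s\<bar> \<ge> \<bar>Im a\<bar> + 1" for s
  proof -
    have "norm (rGamma (a - s)) \<le> C * exp (5/3 * \<bar>Im (a - s)\<bar>)"
      using s by (intro C(2)) auto
    also have "\<dots> \<le> C * exp (5/3 * \<bar>Im a\<bar> + 5/3 * \<bar>Im s\<bar>)"
    proof -
      have "\<bar>Im (a - s)\<bar> \<le> \<bar>Im a\<bar> + \<bar>Im s\<bar>" by simp
      then show ?thesis using C(1) by simp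
    qed
    also have "\<dots> = C * exp (5/3 * \<bar>Im a\<bar>) * exp (5/3 * \<bar>Im s\<bar>)"
      by (simp add: exp_add)
    finally show ?thesis .
  qed
  then show ?thesis using C by (intro exI[of _ "C * exp (5/3 * \<bar>Im a\<bar>)"]) auto
qed

lemma bessel_K_nonint:
  assumes "\<mu> \<notin> \<int>"
  shows "bessel_K \<mu> z = of_real pi / 2 * (bessel_I (- \<mu>) z - bessel_I \<mu> z) / sin (of_real pi * \<mu>)"
  using assms by (simp add: bessel_K_def Let_def)

lemma sin_pi_nonint:
  fixes \<kappa> :: complex
  assumes "\<kappa> \<notin> \<int>" shows "sin (of_real pi * \<kappa>) \<noteq> 0"
proof
  assume "sin (of_real pi * \<kappa>) = 0"
  then obtain n :: int where "of_real pi * \<kappa> = of_real (n * pi)"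
    by (auto simp: sin_eq_0)
  then have "\<kappa> = of_int n" by simp
  then show False using assms by simp
qed

lemma not_Int_if_Im: "Im z \<noteq> 0 \<Longrightarrow> z \<notin> \<int>"
  by (auto elim!: Ints_cases)

text \<open>
  The Mellin transform of \<open>K\<^sub>\<mu>(sqrt x) * I\<^sub>\<nu>(sqrt x)\<close> with \<open>\<mu> = \<alpha> + \<i> \<tau>\<close> and \<open>\<nu> = \<alpha> - \<i> \<tau>\<close>. The first two factors
  carry the poles to the left of the strip of convergence; the bracket is holomorphic for
  \<open>Re s < 1/2\<close>.
\<close>

definition KI_symbol :: "real \<Rightarrow> real \<Rightarrow> complex \<Rightarrow> complex" where
  "KI_symbol \<alpha> \<tau> s = Gamma (s + of_real \<alpha>) * Gamma (s + Complex 0 (-\<tau>)) *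
     (Gamma (1/2 - s) * Gamma (1 - s) * rGamma (1 + of_real \<alpha> - s) * rGamma (1 + Complex 0 (-\<tau>) - s) / (2 * of_real (sqrt pi)))"

lemma KI_symbol_decay:
  "\<exists>C T. \<forall>s. l \<le> Re s \<and> Re s \<le> c \<and> \<bar>Im s\<bar> \<ge> T \<longrightarrow> norm (KI_symbol \<alpha> \<tau> s) \<le> C * exp (- \<bar>Im s\<bar>)"
proof -
  note G = Gamma_strip_bound_affine[of 1 l c] and G' = Gamma_strip_bound_affine[of "-1" l c]
  obtain C1 where C1: "C1 > 0" "\<And>s. l \<le> Re s \<Longrightarrow> Re s \<le> c \<Longrightarrow> \<bar>Im s\<bar> \<ge> 1 \<Longrightarrow>
      norm (Gamma (s + of_real \<alpha>)) \<le> C1 * exp (- (3/2) * \<bar>Im s\<bar>)" using G[of "of_real \<alpha>"] by auto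
  obtain C2 where C2: "C2 > 0" "\<And>s. l \<le> Re s \<Longrightarrow> Re s \<le> c \<Longrightarrow> \<bar>Im s\<bar> \<ge> \<bar>\<tau>\<bar> + 1 \<Longrightarrow>
      norm (Gamma (s + Complex 0 (-\<tau>))) \<le> C2 * exp (- (3/2) * \<bar>Im s\<bar>)" using G[of "Complex 0 (-\<tau>)"] by auto
  obtain C3 where C3: "C3 > 0" "\<And>s. l \<le> Re s \<Longrightarrow> Re s \<le> c \<Longrightarrow> \<bar>Im s\<bar> \<ge> 1 \<Longrightarrow>
      norm (Gamma (1/2 - s)) \<le> C3 * exp (- (3/2) * \<bar>Im s\<bar>)" using G'[of "1/2"] by auto
  obtain C4 where C4: "C4 > 0" "\<And>s. l \<le> Re s \<Longrightarrow> Re s \<le> c \<Longrightarrow> \<bar>Im s\<bar> \<ge> 1 \<Longrightarrow>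
      norm (Gamma (1 - s)) \<le> C4 * exp (- (3/2) * \<bar>Im s\<bar>)" using G'[of 1] by auto
  obtain C5 where C5: "C5 > 0" "\<And>s. l \<le> Re s \<Longrightarrow> Re s \<le> c \<Longrightarrow> \<bar>Im s\<bar> \<ge> 1 \<Longrightarrow>
      norm (rGamma (1 + of_real \<alpha> - s)) \<le> C5 * exp (5/3 * \<bar>Im s\<bar>)"
    using rGamma_strip_bound_affine[of l c "1 + of_real \<alpha>"] by auto
  obtain C6 where C6: "C6 > 0" "\<And>s. l \<le> Re s \<Longrightarrow> Re s \<le> c \<Longrightarrow> \<bar>Im s\<bar> \<ge> \<bar>\<tau>\<bar> + 1 \<Longrightarrow>
      norm (rGamma (1 + Complex 0 (-\<tau>) - s)) \<le> C6 * exp (5/3 * \<bar>Im s\<bar>)"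
    using rGamma_strip_bound_affine[of l c "1 + Complex 0 (-\<tau>)"] by auto
  define D where "D = C1 * C2 * (C3 * C4 * C5 * C6 / (2 * sqrt pi))"
  have D: "D > 0" using C1 C2 C3 C4 C5 C6 by (simp add: D_def)
  have "norm (KI_symbol \<alpha> \<tau> s) \<le> D * exp (- \<bar>Im s\<bar>)"
    if s: "l \<le> Re s" "Re s \<le> c" "\<bar>Im s\<bar> \<ge> \<bar>\<tau>\<bar> + 1" for s
  proof -
    define g r where "g = exp (- (3/2) * \<bar>Im s\<bar>)" and "r = exp (5/3 * \<bar>Im s\<bar>)"
    have s': "\<bar>Im s\<bar> \<ge> 1" using s by linarith
    have bounds: "norm (Gamma (s + of_real \<alpha>)) \<le> C1 * g" "norm (Gamma (s + Complex 0 (-\<tau>))) \<le> C2 * g"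
        "norm (Gamma (1/2 - s)) \<le> C3 * g" "norm (Gamma (1 - s)) \<le> C4 * g"
        "norm (rGamma (1 + of_real \<alpha> - s)) \<le> C5 * r" "norm (rGamma (1 + Complex 0 (-\<tau>) - s)) \<le> C6 * r"
      unfolding g_def r_def
      by (rule C1(2)[OF s(1,2) s'] C2(2)[OF s] C3(2)[OF s(1,2) s'] C4(2)[OF s(1,2) s'] C5(2)[OF s(1,2) s'] C6(2)[OF s])+
    have gr: "g > 0" "r > 0" by (simp_all add: g_def r_def)
    have pos: "0 \<le> C1 * g" "0 \<le> C2 * g" "0 \<le> C3 * g" "0 \<le> C4 * g" "0 \<le> C5 * r" "0 \<le> C6 * r"
      using C1 C2 C3 C4 C5 C6 gr by simp_all
    have "norm (KI_symbol \<alpha> \<tau> s) \<le> (C1 * g) * (C2 * g) * ((C3 * g) * (C4 * g) * (C5 * r) * (C6 * r) / norm (2 * complex_of_real (sqrt pi)))"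
      unfolding KI_symbol_def norm_mult[of "_ * _"] norm_mult[of "Gamma _"] norm_divide
      by (intro mult_mono divide_right_mono mult_nonneg_nonneg divide_nonneg_nonneg bounds pos norm_ge_zero)
    also have "\<dots> = D * (g * g * g * g * r * r)" by (simp add: D_def norm_mult)
    \<comment> \<open>Four factors decay at rate \<open>3/2\<close>, and the two reciprocal ones grow at rate \<open>5/3\<close>.\<close>
    also have "g * g * g * g * r * r = exp (- (8/3) * \<bar>Im s\<bar>)"
      by (simp add: g_def r_def flip: exp_add)
    also have "D * exp (- (8/3) * \<bar>Im s\<bar>) \<le> D * exp (- \<bar>Im s\<bar>)" using D by simp
    finally show ?thesis .
  qed
  then show ?thesis by blast
qed

lemma KI_symbol_shift:
  assumes "s - 1 + of_real \<alpha> \<notin> \<int>\<^sub>\<le>\<^sub>0" "s - 1 + Complex 0 (-\<tau>) \<notin> \<int>\<^sub>\<le>\<^sub>0" "Re s < 1/2"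
  shows "KI_symbol \<alpha> \<tau> (s - 1) * ((s - 1 + of_real \<alpha>) * (s - 1 + Complex 0 (-\<tau>)) *
      (1 + of_real \<alpha> - s) * (1 + Complex 0 (-\<tau>) - s)) = KI_symbol \<alpha> \<tau> s * ((1/2 - s) * (1 - s))"
proof -
  define b where "b = Complex 0 (-\<tau>)"
  have 1: "Gamma (s + of_real \<alpha>) = (s - 1 + of_real \<alpha>) * Gamma (s - 1 + of_real \<alpha>)"
    using Gamma_plus1[OF assms(1)] by (simp add: algebra_simps)
  have 2: "Gamma (s + b) = (s - 1 + b) * Gamma (s - 1 + b)"
    using Gamma_plus1[OF assms(2)] by (simp add: algebra_simps b_def)
  have 3: "Gamma (1/2 - (s - 1)) = (1/2 - s) * Gamma (1/2 - s)"
    using Gamma_plus1_complex[of "1/2 - s"] assms(3) by (simp add: algebra_simps)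
  have 4: "Gamma (1 - (s - 1)) = (1 - s) * Gamma (1 - s)"
    using Gamma_plus1_complex[of "1 - s"] assms(3) by (simp add: algebra_simps)
  have 5: "rGamma (1 + of_real \<alpha> - s) = (1 + of_real \<alpha> - s) * rGamma (1 + of_real \<alpha> - (s - 1))"
    using rGamma_plus1[of "1 + of_real \<alpha> - s"] by (simp add: algebra_simps)
  have 6: "rGamma (1 + b - s) = (1 + b - s) * rGamma (1 + b - (s - 1))"
    using rGamma_plus1[of "1 + b - s"] by (simp add: algebra_simps)
  have rearrange: "g1 * g2 * ((h3 * g3) * (h4 * g4) * r5 * r6 / q) * (p1 * p2 * p5 * p6)
      = (p1 * g1) * (p2 * g2) * (g3 * g4 * (p5 * r5) * (p6 * r6) / q) * (h3 * h4)"
    for g1 g2 g3 g4 r5 r6 q p1 p2 p5 p6 h3 h4 :: complex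
    by (simp add: mult_ac)
  show ?thesis unfolding KI_symbol_def b_def[symmetric] 1 2 3 4 5 6 by (rule rearrange)
qed

lemma KI_symbol_ratio:
  fixes d \<alpha> :: real
  assumes gen: "d \<notin> \<int>" "d + \<alpha> \<notin> \<int>" and d: "d < 0" and n: "real n \<ge> 2 * \<bar>\<alpha>\<bar> + 1"
  shows "norm (KI_symbol \<alpha> \<tau> (Complex (d - real (Suc n)) t)) \<le> 4 / real n * norm (KI_symbol \<alpha> \<tau> (Complex (d - real n) t))"
proof -
  define s where "s = Complex (d - real n) t"
  define w where "w = 1 - s"
  define b where "b = Complex 0 (-\<tau>)"
  have s1: "Complex (d - real (Suc n)) t = s - 1" by (simp add: s_def complex_eq_iff)
  have ni: "s - 1 + z \<notin> \<int>\<^sub>\<le>\<^sub>0" if "d + Re z \<notin> \<int>" for z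
  proof
    assume "s - 1 + z \<in> \<int>\<^sub>\<le>\<^sub>0"
    then obtain m where "s - 1 + z = of_int m" by (auto elim!: nonpos_Ints_cases)
    then have "Re (s - 1 + z) = of_int m" by simp
    then have "d + Re z = of_int m + real n + 1" by (simp add: s_def)
    then show False using that by simp
  qed
  have w: "Re w = 1 - d + real n" by (simp add: w_def s_def)
  then have nw: "norm w \<ge> real n" using complex_Re_le_cmod[of w] d by linarith
  have n0: "real n \<ge> 1" using n by linarith
  have wb: "norm (w - b) \<ge> real n" "norm (w + b) \<ge> real n"
    using complex_Re_le_cmod[of "w - b"] complex_Re_le_cmod[of "w + b"] w d by (simp_all add: b_def)
  have wa: "norm (w - of_real \<alpha>) \<ge> norm w / 2" "norm (w + of_real \<alpha>) \<ge> norm w / 2"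
    using norm_triangle_ineq2[of w "of_real \<alpha>"] norm_diff_ineq[of w "of_real \<alpha>"] nw n by simp_all
  have wh: "norm (w - 1/2) \<le> norm w"
  proof (rule power2_le_imp_le)
    have "(norm (w - 1/2))\<^sup>2 = (norm w)\<^sup>2 - Re w + 1/4"
      unfolding cmod_power2 by (simp add: power2_eq_square algebra_simps)
    then show "(norm (w - 1/2))\<^sup>2 \<le> (norm w)\<^sup>2" using w d by linarith
  qed auto
  have key: "norm (KI_symbol \<alpha> \<tau> (s - 1)) * (norm (w - of_real \<alpha>) * norm (w - b) * norm (w + of_real \<alpha>) * norm (w + b))
      = norm (KI_symbol \<alpha> \<tau> s) * (norm (w - 1/2) * norm w)"
  proof -
    have "d + Re b \<notin> \<int>" using gen by (simp add: b_def)
    then have "KI_symbol \<alpha> \<tau> (s - 1) * ((s - 1 + of_real \<alpha>) * (s - 1 + b) * (1 + of_real \<alpha> - s) * (1 + b - s))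
        = KI_symbol \<alpha> \<tau> s * ((1/2 - s) * (1 - s))"
      unfolding b_def using gen d by (intro KI_symbol_shift ni) (auto simp: s_def)
    also have "s - 1 + of_real \<alpha> = - (w - of_real \<alpha>)" by (simp add: w_def)
    also have "s - 1 + b = - (w - b)" by (simp add: w_def)
    also have "1 + of_real \<alpha> - s = w + of_real \<alpha>" by (simp add: w_def)
    also have "1 + b - s = w + b" by (simp add: w_def)
    also have "1/2 - s = w - 1/2" by (simp add: w_def)
    also have "1 - s = w" by (simp add: w_def)
    finally have eq: "KI_symbol \<alpha> \<tau> (s - 1) * (- (w - of_real \<alpha>) * - (w - b) * (w + of_real \<alpha>) * (w + b))
        = KI_symbol \<alpha> \<tau> s * ((w - 1/2) * w)" .
    show ?thesis using arg_cong[OF eq, of norm] by (simp only: norm_mult norm_minus_cancel)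
  qed
  have "norm (KI_symbol \<alpha> \<tau> (s - 1)) * (norm w / 2 * real n * (norm w / 2) * 1)
      \<le> norm (KI_symbol \<alpha> \<tau> (s - 1)) * (norm (w - of_real \<alpha>) * norm (w - b) * norm (w + of_real \<alpha>) * norm (w + b))"
    using wa wb n0 by (intro mult_left_mono mult_mono) auto
  also have "\<dots> \<le> norm (KI_symbol \<alpha> \<tau> s) * (norm w * norm w)"
    unfolding key using wh by (intro mult_left_mono mult_right_mono) auto
  finally have "(norm (KI_symbol \<alpha> \<tau> (s - 1)) * real n / 4) * (norm w)\<^sup>2 \<le> norm (KI_symbol \<alpha> \<tau> s) * (norm w)\<^sup>2"
    by (simp add: power2_eq_square mult_ac)
  moreover have "(norm w)\<^sup>2 > 0" using nw n0 by (intro zero_less_power) linarith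
  ultimately have "norm (KI_symbol \<alpha> \<tau> (s - 1)) * real n / 4 \<le> norm (KI_symbol \<alpha> \<tau> s)"
    by (rule mult_right_le_imp_le)
  then show ?thesis unfolding s1 using n0 by (simp add: s_def field_simps)
qed

text \<open>
  The poles at \<open>-\<alpha> - k\<close> yield the series of \<open>I\<^sub>\<mu> I\<^sub>\<nu>\<close>, those at \<open>\<i> \<tau> - k\<close> the series of \<open>I\<^sub>-\<^sub>\<mu> I\<^sub>\<nu>\<close>; together they
  are the two terms in the definition of \<open>K\<^sub>\<mu>\<close>.
\<close>

lemma bessel_product_Mellin_Barnes:
  assumes al: "\<alpha> > -1/2" and tau: "\<tau> \<noteq> 0" and c: "max (-\<alpha>) 0 < c" "c < 1/2" and x: "x > 0"
  shows "(LINT t|lborel. KI_symbol \<alpha> \<tau> (Complex c t) * of_real x powr (- Complex c t)) =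
    2 * of_real pi * (bessel_K (Complex \<alpha> \<tau>) (of_real (sqrt x)) * bessel_I (Complex \<alpha> (-\<tau>)) (of_real (sqrt x)))"
proof -
  define b where "b = Complex 0 (-\<tau>)"
  define \<mu> where "\<mu> = Complex \<alpha> \<tau>"
  define \<nu> where "\<nu> = Complex \<alpha> (-\<tau>)"
  let ?z = "complex_of_real (sqrt x)"
  define E where "E s = Gamma (1/2 - s) * Gamma (1 - s) * rGamma (1 + of_real \<alpha> - s) * rGamma (1 + b - s) / (2 * of_real (sqrt pi))" for s
  have sym: "KI_symbol \<alpha> \<tau> s = Gamma (s + of_real \<alpha>) * Gamma (s + b) * E s" for s
    by (simp add: KI_symbol_def E_def b_def)
  have mu: "\<mu> \<notin> \<int>" "- \<mu> \<notin> \<int>" using tau by (auto intro!: not_Int_if_Im simp: \<mu>_def)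
  have ab: "of_real \<alpha> - b = \<mu>" "b - of_real \<alpha> = - \<mu>" by (simp_all add: b_def \<mu>_def complex_eq_iff)
  have anu: "of_real \<alpha> + b = \<nu>" by (simp add: b_def \<nu>_def complex_eq_iff)
  \<comment> \<open>The poles have real parts in \<open>\<int>\<close> and in \<open>- \<alpha> + \<int>\<close>; since \<open>-1/2\<close> and \<open>-1/3\<close> do not differ
    by an integer, one of them avoids both sets.\<close>
  obtain d :: real where d: "d \<notin> \<int>" "d + \<alpha> \<notin> \<int>" "d < 0"
  proof (cases "-1/2 + \<alpha> \<in> \<int>")
    case False
    have "(-1/2 :: real) \<notin> \<int>"
      using fraction_not_in_Ints[of 2 "-1", where 'a = real] by simp
    then show ?thesis using that[of "-1/2"] False by simp
  next
    case True
    have third: "(-1/3 :: real) \<notin> \<int>"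
      using fraction_not_in_Ints[of 3 "-1", where 'a = real] by simp
    have sixth: "(1/6 :: real) \<notin> \<int>"
      using fraction_not_in_Ints[of 6 1, where 'a = real] by simp
    have "-1/3 + \<alpha> \<notin> \<int>"
    proof
      assume "-1/3 + \<alpha> \<in> \<int>"
      from Ints_diff[OF this True] have "(1/6 :: real) \<in> \<int>" by simp
      then show False using sixth by simp
    qed
    then show ?thesis using that[of "-1/3"] third by simp
  qed
  have resA: "(\<lambda>k. (-1) ^ k / fact k * (Gamma (b - of_real \<alpha> - of_nat k) * E (- of_real \<alpha> - of_nat k) * of_real x powr (of_real \<alpha> + of_nat k)))
      sums (- of_real pi / (2 * sin (of_real pi * \<mu>)) * (bessel_I \<mu> ?z * bessel_I \<nu> ?z))"
  proof -
    have "E (- of_real \<alpha> - of_nat k) = Gamma (1/2 + of_real \<alpha> + of_nat k) * Gamma (1 + of_real \<alpha> + of_nat k) *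
        rGamma (1 + 2 * of_real \<alpha> + of_nat k) * rGamma (1 + \<nu> + of_nat k) / (2 * of_real (sqrt pi))" for k
      unfolding E_def anu[symmetric] by (simp add: algebra_simps)
    moreover have "\<mu> + \<nu> = 2 * of_real \<alpha>" by (simp add: \<mu>_def \<nu>_def complex_eq_iff)
    ultimately show ?thesis
      unfolding ab using bessel_product_residue_sums[OF x mu(1), of \<nu> "of_real \<alpha>"] al by simp
  qed
  have resB: "(\<lambda>k. (-1) ^ k / fact k * (Gamma (of_real \<alpha> - b - of_nat k) * E (- b - of_nat k) * of_real x powr (b + of_nat k)))
      sums (- of_real pi / (2 * sin (of_real pi * - \<mu>)) * (bessel_I (- \<mu>) ?z * bessel_I \<nu> ?z))"
  proof -
    have "E (- b - of_nat k) = Gamma (1/2 + b + of_nat k) * Gamma (1 + b + of_nat k) *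
        rGamma (1 + 2 * b + of_nat k) * rGamma (1 + \<nu> + of_nat k) / (2 * of_real (sqrt pi))" for k
      unfolding E_def anu[symmetric] by (simp add: algebra_simps)
    moreover have "- \<mu> + \<nu> = 2 * b" by (simp add: \<mu>_def \<nu>_def b_def complex_eq_iff)
    ultimately show ?thesis
      unfolding ab using bessel_product_residue_sums[OF x mu(2), of \<nu> b] by (simp add: b_def)
  qed
  have "(LINT t|lborel. Gamma (Complex c t + of_real \<alpha>) * Gamma (Complex c t + b) * E (Complex c t) * of_real x powr (- Complex c t)) =
      2 * of_real pi * (- of_real pi / (2 * sin (of_real pi * \<mu>)) * (bessel_I \<mu> ?z * bessel_I \<nu> ?z) +
       - of_real pi / (2 * sin (of_real pi * - \<mu>)) * (bessel_I (- \<mu>) ?z * bessel_I \<nu> ?z))"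
  proof (rule Gamma_pair_residue_expansion[where r = "1/2" and d = d and \<rho> = "\<lambda>n. 4 / real n", OF _ x _ _ _ _ _ _ _ _ _ _ resA resB])
    show "of_real \<alpha> - b \<notin> \<int>" using mu by (simp add: ab)
    show "E holomorphic_on {s. Re s < 1/2}"
      unfolding E_def[abs_def]
      by (intro holomorphic_intros) (auto elim!: nonpos_Ints_cases simp: complex_eq_iff)
    show "\<exists>C T. \<forall>s. l \<le> Re s \<and> Re s \<le> c \<and> T \<le> \<bar>Im s\<bar> \<longrightarrow>
        norm (Gamma (s + of_real \<alpha>) * Gamma (s + b) * E s) \<le> C * exp (- \<bar>Im s\<bar>)" for l
      using KI_symbol_decay[of l c \<alpha> \<tau>] unfolding sym .
    show "(\<lambda>n. 4 / real n) \<longlonglongrightarrow> 0" by (rule lim_const_over_n)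
    show "\<forall>\<^sub>F n in sequentially. \<forall>t.
         norm (Gamma (Complex (d - real (Suc n)) t + of_real \<alpha>) * Gamma (Complex (d - real (Suc n)) t + b) * E (Complex (d - real (Suc n)) t))
         \<le> 4 / real n * norm (Gamma (Complex (d - real n) t + of_real \<alpha>) * Gamma (Complex (d - real n) t + b) * E (Complex (d - real n) t))"
      unfolding sym[symmetric]
    proof (rule eventually_sequentiallyI[of "nat \<lceil>2 * \<bar>\<alpha>\<bar> + 1\<rceil>"], intro allI)
      fix n t assume "nat \<lceil>2 * \<bar>\<alpha>\<bar> + 1\<rceil> \<le> n"
      then have "real n \<ge> 2 * \<bar>\<alpha>\<bar> + 1" by linarith
      from KI_symbol_ratio[OF d this]
      show "norm (KI_symbol \<alpha> \<tau> (Complex (d - real (Suc n)) t)) \<le> 4 / real n * norm (KI_symbol \<alpha> \<tau> (Complex (d - real n) t))" .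
    qed
  qed (use c d in \<open>auto simp: b_def\<close>)
  also have "- of_real pi / (2 * sin (of_real pi * \<mu>)) * (bessel_I \<mu> ?z * bessel_I \<nu> ?z) +
       - of_real pi / (2 * sin (of_real pi * - \<mu>)) * (bessel_I (- \<mu>) ?z * bessel_I \<nu> ?z) = bessel_K \<mu> ?z * bessel_I \<nu> ?z"
    using sin_pi_nonint[OF mu(1)] by (simp add: bessel_K_nonint[OF mu(1)] field_simps)
  finally show ?thesis unfolding sym \<mu>_def \<nu>_def .
qed

section \<open>The symmetrised symbol and the symbol of the Macdonald kernel\<close>

text \<open>
  Up to a constant, the Mellin transform of \<open>exp (y/2) * K\<^sub>\<i>\<^sub>\<tau>(y/2) / cosh (\<pi> \<tau>)\<close>. It is the part of the symbol
  below that survives after the factor in the inversion formula is removed.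
\<close>

definition core_symbol :: "real \<Rightarrow> complex \<Rightarrow> complex" where
  "core_symbol \<tau> s = Gamma (s + Complex 0 \<tau>) * Gamma (s + Complex 0 (-\<tau>)) * Gamma (1/2 - s)"

text \<open>
  The Mellin transform of \<open>Re (K\<^sub>\<mu>(sqrt x) * I\<^sub>\<nu>(sqrt x))\<close>, with \<open>\<mu>\<close> and \<open>\<nu>\<close> as for \<open>KI_symbol\<close>.
\<close>

definition real_symbol :: "real \<Rightarrow> real \<Rightarrow> complex \<Rightarrow> complex" where
  "real_symbol \<alpha> \<tau> s = of_real (cosh (pi * \<tau>)) / (2 * of_real (sqrt pi)) *
     (core_symbol \<tau> s * (Gamma (s + of_real \<alpha>) * rGamma s * rGamma (1 + of_real \<alpha> - s)))"

lemma core_symbol_decay: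
  "\<exists>C T. \<forall>s. l \<le> Re s \<and> Re s \<le> c \<and> \<bar>Im s\<bar> \<ge> T \<longrightarrow> norm (core_symbol \<tau> s) \<le> C * exp (- \<bar>Im s\<bar>)"
proof -
  note G = Gamma_strip_bound_affine[of 1 l c] and G' = Gamma_strip_bound_affine[of "-1" l c]
  obtain C1 where C1: "C1 > 0" "\<And>s. l \<le> Re s \<Longrightarrow> Re s \<le> c \<Longrightarrow> \<bar>Im s\<bar> \<ge> \<bar>\<tau>\<bar> + 1 \<Longrightarrow>
      norm (Gamma (s + Complex 0 \<tau>)) \<le> C1 * exp (- (3/2) * \<bar>Im s\<bar>)" using G[of "Complex 0 \<tau>"] by auto
  obtain C2 where C2: "C2 > 0" "\<And>s. l \<le> Re s \<Longrightarrow> Re s \<le> c \<Longrightarrow> \<bar>Im s\<bar> \<ge> \<bar>\<tau>\<bar> + 1 \<Longrightarrow>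
      norm (Gamma (s + Complex 0 (-\<tau>))) \<le> C2 * exp (- (3/2) * \<bar>Im s\<bar>)" using G[of "Complex 0 (-\<tau>)"] by auto
  obtain C3 where C3: "C3 > 0" "\<And>s. l \<le> Re s \<Longrightarrow> Re s \<le> c \<Longrightarrow> \<bar>Im s\<bar> \<ge> 1 \<Longrightarrow>
      norm (Gamma (1/2 - s)) \<le> C3 * exp (- (3/2) * \<bar>Im s\<bar>)" using G'[of "1/2"] by auto
  have "norm (core_symbol \<tau> s) \<le> (C1 * C2 * C3) * exp (- \<bar>Im s\<bar>)"
    if s: "l \<le> Re s" "Re s \<le> c" "\<bar>Im s\<bar> \<ge> \<bar>\<tau>\<bar> + 1" for s
  proof -
    define g where "g = exp (- (3/2) * \<bar>Im s\<bar>)"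
    have s': "\<bar>Im s\<bar> \<ge> 1" using s by linarith
    have bounds: "norm (Gamma (s + Complex 0 \<tau>)) \<le> C1 * g" "norm (Gamma (s + Complex 0 (-\<tau>))) \<le> C2 * g"
        "norm (Gamma (1/2 - s)) \<le> C3 * g"
      unfolding g_def by (rule C1(2)[OF s] C2(2)[OF s] C3(2)[OF s(1,2) s'])+
    have pos: "0 \<le> C1 * g" "0 \<le> C2 * g" "0 \<le> C3 * g"
      using C1 C2 C3 by (simp_all add: g_def)
    have "norm (core_symbol \<tau> s) \<le> (C1 * g) * (C2 * g) * (C3 * g)"
      unfolding core_symbol_def norm_mult
      by (intro mult_mono mult_nonneg_nonneg bounds pos norm_ge_zero)
    also have "\<dots> = (C1 * C2 * C3) * (g * g * g)" by simp
    also have "g * g * g = exp (- (9/2) * \<bar>Im s\<bar>)" by (simp add: g_def flip: exp_add)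
    also have "(C1 * C2 * C3) * exp (- (9/2) * \<bar>Im s\<bar>) \<le> (C1 * C2 * C3) * exp (- \<bar>Im s\<bar>)"
      using C1 C2 C3 by simp
    finally show ?thesis .
  qed
  then show ?thesis by blast
qed

lemma core_symbol_ratio:
  assumes n: "n \<ge> 1"
  shows "norm (core_symbol \<tau> (Complex (-1/2 - real (Suc n)) t)) \<le> 1 / real n * norm (core_symbol \<tau> (Complex (-1/2 - real n) t))"
proof -
  define s where "s = Complex (-1/2 - real n) t"
  define w where "w = 1 - s"
  define b where "b = Complex 0 \<tau>"
  have nb: "Complex 0 (-\<tau>) = - b" by (simp add: b_def complex_eq_iff)
  have s1: "Complex (-1/2 - real (Suc n)) t = s - 1" by (simp add: s_def complex_eq_iff)
  have ni: "s - 1 + z \<notin> \<int>\<^sub>\<le>\<^sub>0" if "Re z = 0" for z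
  proof
    assume "s - 1 + z \<in> \<int>\<^sub>\<le>\<^sub>0"
    then obtain m where "s - 1 + z = of_int m" by (auto elim!: nonpos_Ints_cases)
    then have "Re (s - 1 + z) = of_int m" by simp
    then have "(1/2 :: real) = of_int (- m - int n - 1)" using that by (simp add: s_def)
    then have "(1/2 :: real) \<in> \<int>" by (metis Ints_of_int)
    then show False using fraction_not_in_Ints[of 2 1, where 'a = real] by simp
  qed
  have w: "Re w = 3/2 + real n" by (simp add: w_def s_def)
  have wb: "norm (w - b) \<ge> real n" "norm (w + b) \<ge> real n"
    using complex_Re_le_cmod[of "w - b"] complex_Re_le_cmod[of "w + b"] w by (simp_all add: b_def)
  have wh: "norm (w - 1/2) \<le> norm w"
  proof (rule power2_le_imp_le)
    have "(norm (w - 1/2))\<^sup>2 = (norm w)\<^sup>2 - Re w + 1/4"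
      unfolding cmod_power2 by (simp add: power2_eq_square algebra_simps)
    then show "(norm (w - 1/2))\<^sup>2 \<le> (norm w)\<^sup>2" using w by linarith
  qed auto
  have "2 * norm w = norm ((w - b) + (w + b))" by (simp add: norm_mult)
  also have "\<dots> \<le> norm (w - b) + norm (w + b)" by (rule norm_triangle_ineq)
  finally have w2: "2 * norm w \<le> norm (w - b) + norm (w + b)" .
  have key: "norm (core_symbol \<tau> (s - 1)) * (norm (w - b) * norm (w + b)) = norm (core_symbol \<tau> s) * norm (w - 1/2)"
  proof -
    have 1: "Gamma (s + b) = (s - 1 + b) * Gamma (s - 1 + b)"
      using Gamma_plus1[OF ni[of b]] by (simp add: algebra_simps b_def)
    have 2: "Gamma (s + - b) = (s - 1 + - b) * Gamma (s - 1 + - b)"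
      using Gamma_plus1[OF ni[of "- b"]] by (simp add: algebra_simps b_def)
    have 3: "Gamma (1/2 - (s - 1)) = (1/2 - s) * Gamma (1/2 - s)"
      using Gamma_plus1_complex[of "1/2 - s"] by (simp add: algebra_simps s_def)
    have rearrange: "g1 * g2 * (h * g3) * (p1 * p2) = (p1 * g1) * (p2 * g2) * g3 * h" for g1 g2 g3 h p1 p2 :: complex
      by (simp add: mult_ac)
    have "core_symbol \<tau> (s - 1) * ((s - 1 + b) * (s - 1 + - b)) = core_symbol \<tau> s * (1/2 - s)"
      unfolding core_symbol_def nb b_def[symmetric] 1 2 3 by (rule rearrange)
    also have "s - 1 + b = - (w - b)" by (simp add: w_def)
    also have "s - 1 + - b = - (w + b)" by (simp add: w_def)
    also have "1/2 - s = w - 1/2" by (simp add: w_def)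
    finally have eq: "core_symbol \<tau> (s - 1) * (- (w - b) * - (w + b)) = core_symbol \<tau> s * (w - 1/2)" .
    show ?thesis using arg_cong[OF eq, of norm] by (simp only: norm_mult norm_minus_cancel)
  qed
  define P where "P = norm (w - b) * norm (w + b)"
  have "norm (w - b) > 0" "norm (w + b) > 0" using wb n by linarith+
  then have P: "P > 0" unfolding P_def by (rule mult_pos_pos)
  have "real n * norm w \<le> P"
  proof -
    have "real n * (2 * norm w) \<le> real n * (norm (w - b) + norm (w + b))" using w2 by (intro mult_left_mono) auto
    also have "\<dots> \<le> norm (w - b) * norm (w + b) + norm (w - b) * norm (w + b)"
      using mult_mono[OF wb(2) order_refl[of "norm (w - b)"]] mult_mono[OF wb(1) order_refl[of "norm (w + b)"]]
      by (simp add: algebra_simps)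
    finally show ?thesis by (simp add: P_def)
  qed
  then have "norm (core_symbol \<tau> s) * (real n * norm (w - 1/2)) \<le> norm (core_symbol \<tau> s) * P"
    using wh by (intro mult_left_mono) (auto intro: order_trans[OF mult_left_mono])
  then have "(norm (core_symbol \<tau> (s - 1)) * real n) * P \<le> norm (core_symbol \<tau> s) * P"
    using key by (simp add: P_def mult_ac)
  then have "norm (core_symbol \<tau> (s - 1)) * real n \<le> norm (core_symbol \<tau> s)"
    using P by (rule mult_right_le_imp_le)
  then show ?thesis unfolding s1 using n by (simp add: s_def field_simps)
qed

lemma cos_pi_imaginary: "cos (of_real pi * Complex 0 \<tau>) = of_real (cosh (pi * \<tau>))"
proof -
  have "of_real pi * Complex 0 \<tau> = \<i> * of_real (pi * \<tau>)" by (simp add: complex_eq_iff)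
  then have "cos (of_real pi * Complex 0 \<tau>) = cosh (of_real (pi * \<tau>) :: complex)"
    by (simp only: cosh_conv_cos)
  also have "\<dots> = of_real (cosh (pi * \<tau>))"
    by (simp add: cosh_def exp_of_real scaleR_conv_of_real flip: of_real_minus of_real_mult)
  finally show ?thesis .
qed

text \<open>
  Here the two families of poles give \<open>exp (y/2) * I\<^sub>\<nu>(y/2)\<close> for \<open>\<nu> = \<i> \<tau>\<close> and \<open>\<nu> = -\<i> \<tau>\<close>. The factor
  \<open>1 / cosh (\<pi> \<tau>)\<close> comes from \<open>sin (2 \<pi> \<nu>) = 2 sin (\<pi> \<nu>) cos (\<pi> \<nu>)\<close>: the residues bring the left-hand side,
  \<open>K\<^sub>\<nu>\<close> only the sine on the right.
\<close>

lemma exp_bessel_K_Mellin_Barnes: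
  assumes tau: "\<tau> \<noteq> 0" and c: "0 < c" "c < 1/2" and y: "y > 0"
  shows "(LINT t|lborel. core_symbol \<tau> (Complex c t) * of_real y powr (- Complex c t)) =
    2 * of_real pi * (of_real (sqrt pi) * (of_real (exp (y / 2)) * bessel_K (Complex 0 \<tau>) (of_real (y / 2)) / of_real (cosh (pi * \<tau>))))"
proof -
  define b where "b = Complex 0 \<tau>"
  let ?w = "complex_of_real (y / 2)"
  have nb: "Complex 0 (-\<tau>) = - b" by (simp add: b_def complex_eq_iff)
  have bi: "b \<notin> \<int>" "- b \<notin> \<int>" "2 * b \<notin> \<int>" "- 2 * b \<notin> \<int>" "b - - b \<notin> \<int>"
    using tau by (auto intro!: not_Int_if_Im simp: b_def)
  have half: "(-1/2 :: real) \<notin> \<int>"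
    using fraction_not_in_Ints[of 2 "-1", where 'a = real] by simp
  have res: "(\<lambda>k. (-1) ^ k / fact k * (Gamma (- \<nu> - \<nu> - of_nat k) * Gamma (1/2 - (- \<nu> - of_nat k)) * of_real y powr (\<nu> + of_nat k)))
      sums (- of_real pi / sin (of_real pi * (2 * \<nu>)) * (of_real (sqrt pi) * (of_real (exp (y / 2)) * bessel_I \<nu> ?w)))"
    if nu: "Re \<nu> = 0" "2 * \<nu> \<notin> \<int>" for \<nu>
  proof -
    have "(-1) ^ k / fact k * (Gamma (- \<nu> - \<nu> - of_nat k) * Gamma (1/2 - (- \<nu> - of_nat k)) * of_real y powr (\<nu> + of_nat k)) =
        - of_real pi / sin (of_real pi * (2 * \<nu>)) *
          (of_real y powr (\<nu> + of_nat k) * (Gamma (1/2 + \<nu> + of_nat k) * rGamma (1 + 2 * \<nu> + of_nat k) / fact k))" for k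
    proof -
      have "Gamma (- (2 * \<nu>) - of_nat k) = - ((-1) ^ k) * of_real pi / sin (of_real pi * (2 * \<nu>)) * rGamma (2 * \<nu> + of_nat k + 1)"
        by (rule Gamma_reflection_shift[OF nu(2)])
      then have "Gamma (- \<nu> - \<nu> - of_nat k) = - ((-1) ^ k) * of_real pi / sin (of_real pi * (2 * \<nu>)) * rGamma (1 + 2 * \<nu> + of_nat k)"
        by (simp only: mult_2 minus_add_distrib add.commute add.left_commute diff_conv_add_uminus)
      moreover have "Gamma (1/2 - (- \<nu> - of_nat k)) = Gamma (1/2 + \<nu> + of_nat k)"
        by (rule arg_cong[of _ _ Gamma]) (simp add: algebra_simps)
      ultimately show ?thesis by (cases "even k") (simp_all add: mult_ac)
    qed
    then show ?thesis using sums_mult[OF exp_bessel_I_sums[of \<nu> y], of "- of_real pi / sin (of_real pi * (2 * \<nu>))"] nu y by simp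
  qed
  have "(LINT t|lborel. Gamma (Complex c t + b) * Gamma (Complex c t + - b) * Gamma (1/2 - Complex c t) * of_real y powr (- Complex c t)) =
      2 * of_real pi * (- of_real pi / sin (of_real pi * (2 * b)) * (of_real (sqrt pi) * (of_real (exp (y / 2)) * bessel_I b ?w)) +
        - of_real pi / sin (of_real pi * (2 * - b)) * (of_real (sqrt pi) * (of_real (exp (y / 2)) * bessel_I (- b) ?w)))"
  proof (rule Gamma_pair_residue_expansion[where r = "1/2" and d = "-1/2" and \<rho> = "\<lambda>n. 1 / real n" and E = "\<lambda>s. Gamma (1/2 - s)"])
    show "(\<lambda>s. Gamma (1/2 - s)) holomorphic_on {s. Re s < 1/2}"
      by (intro holomorphic_intros) (auto elim!: nonpos_Ints_cases simp: complex_eq_iff)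
    show "\<exists>C T. \<forall>s. l \<le> Re s \<and> Re s \<le> c \<and> T \<le> \<bar>Im s\<bar> \<longrightarrow>
        norm (Gamma (s + b) * Gamma (s + - b) * Gamma (1/2 - s)) \<le> C * exp (- \<bar>Im s\<bar>)" for l
      using core_symbol_decay[of l c \<tau>] unfolding core_symbol_def nb b_def[symmetric] .
    show "(\<lambda>n. 1 / real n) \<longlonglongrightarrow> 0" by (rule lim_const_over_n)
    show "\<forall>\<^sub>F n in sequentially. \<forall>t.
         norm (Gamma (Complex (-1/2 - real (Suc n)) t + b) * Gamma (Complex (-1/2 - real (Suc n)) t + - b) * Gamma (1/2 - Complex (-1/2 - real (Suc n)) t))
         \<le> 1 / real n * norm (Gamma (Complex (-1/2 - real n) t + b) * Gamma (Complex (-1/2 - real n) t + - b) * Gamma (1/2 - Complex (-1/2 - real n) t))"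
      using core_symbol_ratio[of _ \<tau>] unfolding core_symbol_def nb b_def[symmetric]
      by (intro eventually_sequentiallyI[of 1] allI) blast
    show "(\<lambda>k. (-1) ^ k / fact k * (Gamma (- b - b - of_nat k) * Gamma (1/2 - (- b - of_nat k)) * of_real y powr (b + of_nat k)))
      sums (- of_real pi / sin (of_real pi * (2 * b)) * (of_real (sqrt pi) * (of_real (exp (y / 2)) * bessel_I b ?w)))"
      using bi by (intro res) (auto simp: b_def)
    show "(\<lambda>k. (-1) ^ k / fact k * (Gamma (b - - b - of_nat k) * Gamma (1/2 - (- (- b) - of_nat k)) * of_real y powr (- b + of_nat k)))
      sums (- of_real pi / sin (of_real pi * (2 * - b)) * (of_real (sqrt pi) * (of_real (exp (y / 2)) * bessel_I (- b) ?w)))"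
      using res[of "- b"] bi by (simp add: b_def)
  qed (use c y bi half in \<open>auto simp: b_def\<close>)
  also have "- of_real pi / sin (of_real pi * (2 * b)) * (of_real (sqrt pi) * (of_real (exp (y / 2)) * bessel_I b ?w)) +
        - of_real pi / sin (of_real pi * (2 * - b)) * (of_real (sqrt pi) * (of_real (exp (y / 2)) * bessel_I (- b) ?w))
      = of_real (sqrt pi) * (of_real (exp (y / 2)) * bessel_K b ?w / of_real (cosh (pi * \<tau>)))"
  proof -
    define S Q where "S = sin (of_real pi * b)" and "Q = complex_of_real (cosh (pi * \<tau>))"
    have cosQ: "cos (of_real pi * b) = Q" unfolding b_def Q_def by (rule cos_pi_imaginary)
    have S: "S \<noteq> 0" unfolding S_def by (rule sin_pi_nonint[OF bi(1)])
    have Q: "Q \<noteq> 0" by (simp add: Q_def)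
    have "sin (of_real pi * (2 * b)) = 2 * S * Q"
      unfolding S_def cosQ[symmetric] using sin_double[of "of_real pi * b"] by (simp add: mult_ac)
    moreover have "sin (of_real pi * (2 * - b)) = - sin (of_real pi * (2 * b))" by simp
    ultimately show ?thesis
      using S Q unfolding bessel_K_nonint[OF bi(1)] S_def[symmetric] Q_def[symmetric] by (simp add: field_simps)
  qed
  finally show ?thesis unfolding core_symbol_def nb b_def[symmetric] .
qed

lemma cnj_bessel_I:
  assumes "z > 0"
  shows "cnj (bessel_I \<mu> (of_real z)) = bessel_I (cnj \<mu>) (of_real z)"
proof -
  have "(\<lambda>k. ((of_real z)\<^sup>2 / 4) ^ k * rGamma (\<mu> + of_nat k + 1) / fact k) sums
      (\<Sum>k. ((of_real z)\<^sup>2 / 4) ^ k * rGamma (\<mu> + of_nat k + 1) / fact k)"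
    by (intro summable_sums summable_norm_cancel[OF bessel_series_summable_norm])
  then have "(\<lambda>k. cnj (((of_real z)\<^sup>2 / 4) ^ k * rGamma (\<mu> + of_nat k + 1) / fact k)) sums
      cnj (\<Sum>k. ((of_real z)\<^sup>2 / 4) ^ k * rGamma (\<mu> + of_nat k + 1) / fact k)"
    by (simp only: sums_cnj)
  then have 1: "cnj (\<Sum>k. ((of_real z)\<^sup>2 / 4) ^ k * rGamma (\<mu> + of_nat k + 1) / fact k) =
      (\<Sum>k. ((of_real z)\<^sup>2 / 4) ^ k * rGamma (cnj \<mu> + of_nat k + 1) / fact k)"
    by (simp add: cnj_rGamma sums_iff)
  have 2: "cnj ((of_real z / 2) powr \<mu>) = (of_real z / 2) powr (cnj \<mu>)"
  proof -
    have "cnj (of_real (z / 2) powr \<mu>) = of_real (z / 2) powr (cnj \<mu>)"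
      using assms by (simp add: powr_def Ln_of_real exp_cnj del: of_real_divide)
    then show ?thesis by simp
  qed
  show ?thesis unfolding bessel_I_def complex_cnj_mult 1 2 ..
qed

lemma cnj_bessel_K_nonint:
  assumes "z > 0" "\<mu> \<notin> \<int>" "cnj \<mu> \<notin> \<int>"
  shows "cnj (bessel_K \<mu> (of_real z)) = bessel_K (cnj \<mu>) (of_real z)"
proof -
  have "cnj (sin (of_real pi * \<mu>)) = sin (of_real pi * cnj \<mu>)"
    by (simp add: cnj_sin)
  then show ?thesis
    using assms by (simp add: bessel_K_nonint cnj_bessel_I)
qed

text \<open>
  Reflection replaces \<open>1 / \<Gamma>(1 - s - \<i> \<tau>)\<close> by \<open>\<Gamma>(s + \<i> \<tau>) * sin (\<pi> (s + \<i> \<tau>)) / \<pi>\<close>. Both symbols then contain the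
  same Gamma functions, and the sum of the two sines is \<open>2 sin (\<pi> s) cosh (\<pi> \<tau>)\<close>.
\<close>

lemma KI_symbol_average:
  assumes s: "0 < Re s" "Re s < 1"
  shows "(KI_symbol \<alpha> \<tau> s + KI_symbol \<alpha> (- \<tau>) s) / 2 = real_symbol \<alpha> \<tau> s"
proof -
  define b where "b = Complex 0 \<tau>"
  have nb: "Complex 0 (-\<tau>) = - b" by (simp add: b_def complex_eq_iff)
  have np: "z \<notin> \<int>\<^sub>\<le>\<^sub>0" if "Re z > 0" for z :: complex
    using that by (auto elim!: nonpos_Ints_cases)
  have refl: "rGamma (1 - z) = Gamma z * sin (of_real pi * z) / of_real pi" if "Re z > 0" for z
  proof -
    have "Gamma z \<noteq> 0" using np[OF that] by (simp add: Gamma_eq_zero_iff)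
    then have "rGamma (1 - z) = Gamma z * (rGamma z * rGamma (1 - z))" by (simp add: rGamma_inverse_Gamma)
    then show ?thesis by (simp add: rGamma_reflection_complex)
  qed
  have 1: "rGamma (1 + - b - s) = Gamma (s + b) * sin (of_real pi * (s + b)) / of_real pi"
    using refl[of "s + b"] s by (simp add: b_def algebra_simps)
  have 2: "rGamma (1 + b - s) = Gamma (s + - b) * sin (of_real pi * (s + - b)) / of_real pi"
    using refl[of "s + - b"] s by (simp add: b_def algebra_simps)
  have 3: "rGamma s = Gamma (1 - s) * sin (of_real pi * s) / of_real pi"
    using refl[of "1 - s"] s by (simp add: algebra_simps sin_diff cos_of_real sin_of_real)
  define Q where "Q = complex_of_real (cosh (pi * \<tau>))"
  have cosQ: "cos (of_real pi * b) = Q" unfolding b_def Q_def by (rule cos_pi_imaginary)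
  have sum: "sin (of_real pi * (s + b)) + sin (of_real pi * (s + - b)) = 2 * (sin (of_real pi * s) * Q)"
    by (simp add: distrib_left right_diff_distrib sin_add sin_diff cosQ)
  have rearrange: "(ga * gm * (h * h1 * ra * (gp * s1 / p) / q) + ga * gp * (h * h1 * ra * (gm * s2 / p) / q)) / 2
      = Q / q * (gp * gm * h * (ga * (h1 * s0 / p) * ra))" if "s1 + s2 = 2 * (s0 * Q)"
    for ga gm gp h h1 ra s1 s2 p q s0 :: complex
  proof -
    have "(ga * gm * (h * h1 * ra * (gp * s1 / p) / q) + ga * gp * (h * h1 * ra * (gm * s2 / p) / q)) / 2
      = ga * gm * gp * h * h1 * ra * (s1 + s2) / (p * q * 2)"
      by (simp add: add_divide_distrib ring_distribs mult_ac)
    then show ?thesis unfolding that by (simp add: mult_ac)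
  qed
  show ?thesis
    unfolding KI_symbol_def real_symbol_def core_symbol_def minus_minus nb b_def[symmetric] 1 2 3 Q_def[symmetric]
    by (rule rearrange[OF sum])
qed

section \<open>Bounds for the symbols on vertical lines\<close>

lemma Gamma_line_bound:
  assumes c: "c > 0"
  shows "\<exists>C>0. \<forall>y. norm (Gamma (Complex c y)) \<le> C * exp (- (3/2) * \<bar>y\<bar>)"
proof -
  obtain C where C: "C > 0" "\<And>s. c \<le> Re s \<Longrightarrow> Re s \<le> c \<Longrightarrow> \<bar>Im s\<bar> \<ge> 1 \<Longrightarrow>
     norm (Gamma s) \<le> C * exp (- (3/2) * \<bar>Im s\<bar>)"
    using Gamma_strip_bound[of c c] by blast
  have np: "Complex c y \<notin> \<int>\<^sub>\<le>\<^sub>0" for y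
    using c by (auto elim!: nonpos_Ints_cases simp: complex_eq_iff)
  have "continuous_on {-1..1} (\<lambda>y. Gamma (Complex c y))"
  proof (rule continuous_on_compose2[of "- \<int>\<^sub>\<le>\<^sub>0" Gamma])
    show "continuous_on {-1..1} (\<lambda>y. Complex c y)" unfolding Complex_eq by (intro continuous_intros)
    show "continuous_on (- \<int>\<^sub>\<le>\<^sub>0) (Gamma :: complex \<Rightarrow> complex)" by (intro continuous_on_Gamma) auto
  qed (use np in auto)
  then have "compact ((\<lambda>y. Gamma (Complex c y)) ` {-1..1})"
    by (intro compact_continuous_image) auto
  then obtain M where M: "M > 0" "\<And>y. y \<in> {-1..1} \<Longrightarrow> norm (Gamma (Complex c y)) \<le> M"
    using compact_imp_bounded bounded_pos by (metis imageI)
  have "norm (Gamma (Complex c y)) \<le> (C + M * exp (3/2)) * exp (- (3/2) * \<bar>y\<bar>)" for y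
  proof (cases "\<bar>y\<bar> \<ge> 1")
    case True
    then have "norm (Gamma (Complex c y)) \<le> C * exp (- (3/2) * \<bar>y\<bar>)" using C(2)[of "Complex c y"] by simp
    then show ?thesis using M by (simp add: distrib_right add_increasing2)
  next
    case False
    then have "y \<in> {-1..1}" by auto
    then have "norm (Gamma (Complex c y)) \<le> M * 1" using M(2)[of y] by auto
    also have "\<dots> \<le> M * (exp (3/2) * exp (- (3/2) * \<bar>y\<bar>))"
      using False M(1) by (intro mult_left_mono) (auto simp flip: exp_add)
    finally show ?thesis using C(1) by (simp add: distrib_right add_increasing)
  qed
  then show ?thesis using C M by (intro exI[of _ "C + M * exp (3/2)"]) (auto intro: add_pos_pos)
qed

lemma norm_Gamma_mult_rGamma_le:
  assumes "0 < a" "a \<le> b"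
  shows "norm (Gamma (Complex a t) * rGamma (Complex b t)) \<le> Gamma a / Gamma b"
proof -
  have "Complex b t \<notin> \<int>\<^sub>\<le>\<^sub>0" using assms by (auto elim!: nonpos_Ints_cases simp: complex_eq_iff)
  then have pos: "norm (Gamma (Complex b t)) > 0" by (simp add: Gamma_eq_zero_iff)
  have "Gamma b > 0" using assms by simp
  then have "norm (Gamma (Complex a t)) \<le> Gamma a / Gamma b * norm (Gamma (Complex b t))"
    using norm_Gamma_ratio_le[OF assms, of t] by (simp add: pos_le_divide_eq)
  then have "norm (Gamma (Complex a t)) / norm (Gamma (Complex b t)) \<le> Gamma a / Gamma b"
    by (rule mult_imp_div_pos_le[OF pos])
  then show ?thesis
    by (simp add: rGamma_inverse_Gamma norm_mult norm_inverse divide_inverse)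
qed

lemma norm_rGamma_cnj: "norm (rGamma (Complex b (- t))) = norm (rGamma (Complex b t))"
proof -
  have "Complex b (- t) = cnj (Complex b t)" by (simp add: complex_eq_iff)
  then show ?thesis by (metis cnj_rGamma complex_mod_cnj)
qed

lemma norm_Gamma_cnj: "norm (Gamma (Complex b (- t))) = norm (Gamma (Complex b t))"
proof -
  have "Complex b (- t) = cnj (Complex b t)" by (simp add: complex_eq_iff)
  then show ?thesis by (metis cnj_Gamma complex_mod_cnj)
qed

lemma Gamma_pair_line_bound:
  assumes c: "c > 0"
  shows "\<exists>C>0. \<forall>\<tau> t. norm (Gamma (Complex c (t + \<tau>)) * Gamma (Complex c (t - \<tau>))) \<le> C * exp (- 3 * \<bar>t\<bar>)"
proof -
  obtain C where C: "C > 0" "\<And>y. norm (Gamma (Complex c y)) \<le> C * exp (- (3/2) * \<bar>y\<bar>)"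
    using Gamma_line_bound[OF c] by blast
  have "norm (Gamma (Complex c (t + \<tau>)) * Gamma (Complex c (t - \<tau>))) \<le> C\<^sup>2 * exp (- 3 * \<bar>t\<bar>)" for t \<tau>
  proof -
    have "norm (Gamma (Complex c (t + \<tau>)) * Gamma (Complex c (t - \<tau>)))
        \<le> (C * exp (- (3/2) * \<bar>t + \<tau>\<bar>)) * (C * exp (- (3/2) * \<bar>t - \<tau>\<bar>))"
      unfolding norm_mult using C by (intro mult_mono) auto
    also have "\<dots> = C\<^sup>2 * exp (- (3/2) * (\<bar>t + \<tau>\<bar> + \<bar>t - \<tau>\<bar>))"
      by (simp add: power2_eq_square algebra_simps flip: exp_add)
    also have "\<dots> \<le> C\<^sup>2 * exp (- 3 * \<bar>t\<bar>)"
    proof -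
      have "2 * \<bar>t\<bar> \<le> \<bar>t + \<tau>\<bar> + \<bar>t - \<tau>\<bar>" by arith
      then have "exp (- (3/2) * (\<bar>t + \<tau>\<bar> + \<bar>t - \<tau>\<bar>)) \<le> exp (- 3 * \<bar>t\<bar>)"
        using mult_left_mono_neg[of "2 * \<bar>t\<bar>" "\<bar>t + \<tau>\<bar> + \<bar>t - \<tau>\<bar>" "- (3/2)"] by simp
      then show ?thesis by (intro mult_left_mono) auto
    qed
    finally show ?thesis .
  qed
  then show ?thesis using C by (intro exI[of _ "C\<^sup>2"]) auto
qed

lemma core_symbol_Complex:
  "core_symbol \<tau> (Complex c t) = Gamma (Complex c (t + \<tau>)) * Gamma (Complex c (t - \<tau>)) * Gamma (Complex (1/2 - c) (- t))"
proof -
  have "Complex c t + Complex 0 \<tau> = Complex c (t + \<tau>)" "Complex c t + Complex 0 (- \<tau>) = Complex c (t - \<tau>)"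
      "1/2 - Complex c t = Complex (1/2 - c) (- t)"
    by (simp_all add: complex_eq_iff)
  then show ?thesis by (simp only: core_symbol_def)
qed

lemma core_symbol_line_bound:
  assumes c: "0 < c" "c < 1/2"
  shows "\<exists>C>0. \<forall>\<tau> t. norm (core_symbol \<tau> (Complex c t)) \<le> C * exp (- \<bar>t\<bar>)"
proof -
  obtain C where C: "C > 0" "\<And>\<tau> t. norm (Gamma (Complex c (t + \<tau>)) * Gamma (Complex c (t - \<tau>))) \<le> C * exp (- 3 * \<bar>t\<bar>)"
    using Gamma_pair_line_bound[OF c(1)] by blast
  obtain D where D: "D > 0" "\<And>y. norm (Gamma (Complex (1/2 - c) y)) \<le> D * exp (- (3/2) * \<bar>y\<bar>)"
    using Gamma_line_bound[of "1/2 - c"] c by auto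
  have "norm (core_symbol \<tau> (Complex c t)) \<le> (C * D) * exp (- \<bar>t\<bar>)" for \<tau> t
  proof -
    have "norm (core_symbol \<tau> (Complex c t)) \<le> (C * exp (- 3 * \<bar>t\<bar>)) * (D * exp (- (3/2) * \<bar>- t\<bar>))"
      unfolding core_symbol_Complex norm_mult[of "_ * _"]
      using C(1) D(1) by (intro mult_mono C(2) D(2)) auto
    also have "\<dots> = (C * D) * exp (- (9/2) * \<bar>t\<bar>)" by (simp flip: exp_add)
    also have "\<dots> \<le> (C * D) * exp (- \<bar>t\<bar>)" using C D by simp
    finally show ?thesis .
  qed
  then show ?thesis using C D by (intro exI[of _ "C * D"]) auto
qed

lemma real_symbol_Complex:
  "real_symbol \<alpha> \<tau> (Complex c t) = of_real (cosh (pi * \<tau>)) / (2 * of_real (sqrt pi)) *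
    ((Gamma (Complex c (t + \<tau>)) * Gamma (Complex c (t - \<tau>))) *
     (Gamma (Complex (1/2 - c) (- t)) * rGamma (Complex c t)) *
     (Gamma (Complex (c + \<alpha>) t) * rGamma (Complex (1 + \<alpha> - c) (- t))))"
proof -
  have "Complex c t + of_real \<alpha> = Complex (c + \<alpha>) t" "1 + of_real \<alpha> - Complex c t = Complex (1 + \<alpha> - c) (- t)"
    by (simp_all add: complex_eq_iff)
  then show ?thesis by (simp add: real_symbol_def core_symbol_Complex mult_ac)
qed

lemma norm_real_symbol_prefactor: "norm (of_real (cosh (pi * \<tau>)) / (2 * complex_of_real (sqrt pi))) \<le> cosh (pi * \<tau>)"
proof -
  have one: "1 \<le> sqrt pi" using pi_gt3 by (intro real_le_rsqrt) simp
  then have two: "2 * sqrt pi \<ge> 1" by linarith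
  then have "norm (of_real (cosh (pi * \<tau>)) / (2 * complex_of_real (sqrt pi))) = cosh (pi * \<tau>) / (2 * sqrt pi)"
    using one by (simp add: norm_divide norm_mult)
  also have "\<dots> \<le> cosh (pi * \<tau>) / 1"
    by (intro divide_left_mono two) (auto simp: cosh_real_pos less_imp_le)
  finally show ?thesis by simp
qed

text \<open>
  On a general line a bound proportional to \<open>cosh (\<pi> \<tau>)\<close> is enough. The quotients of Gamma functions
  grow at most linearly in \<open>\<bar>t\<bar>\<close>, by comparison along the real direction, and the two factors
  \<open>\<Gamma>(s + \<i> \<tau>)\<close> and \<open>\<Gamma>(s - \<i> \<tau>)\<close> decay exponentially in \<open>\<bar>t\<bar>\<close> uniformly in \<open>\<tau>\<close>.
\<close>

lemma real_symbol_line_bound: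
  assumes c: "max (-\<alpha>) 0 < c" "c < 1/2"
  shows "\<exists>C>0. \<forall>\<tau> t. norm (real_symbol \<alpha> \<tau> (Complex c t)) \<le> C * cosh (pi * \<tau>) * exp (- \<bar>t\<bar>)"
proof -
  obtain C where C: "C > 0" "\<And>\<tau> t. norm (Gamma (Complex c (t + \<tau>)) * Gamma (Complex c (t - \<tau>))) \<le> C * exp (- 3 * \<bar>t\<bar>)"
    using Gamma_pair_line_bound[of c] c by auto
  define A where "A = Gamma (1/2 - c) / Gamma (c + 1)"
  define B where "B = Gamma (c + \<alpha>) / Gamma (1 + \<alpha> - c)"
  have A: "A > 0" and B: "B > 0" using c by (auto simp: A_def B_def)
  have bA: "norm (Gamma (Complex (1/2 - c) (- t)) * rGamma (Complex c t)) \<le> A * (1 + \<bar>t\<bar>)" for t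
  proof -
    have "rGamma (Complex c t) = Complex c t * rGamma (Complex (c + 1) t)"
      using rGamma_plus1[of "Complex c t"] by (simp add: plus_complex.code one_complex.code)
    then have "norm (Gamma (Complex (1/2 - c) (- t)) * rGamma (Complex c t)) =
        norm (Complex c t) * norm (Gamma (Complex (1/2 - c) t) * rGamma (Complex (c + 1) t))"
      by (simp add: norm_mult norm_Gamma_cnj)
    also have "\<dots> \<le> (1 + \<bar>t\<bar>) * A"
      unfolding A_def using c cmod_le[of "Complex c t"]
      by (intro mult_mono norm_Gamma_mult_rGamma_le) auto
    finally show ?thesis by (simp add: mult.commute)
  qed
  have bB: "norm (Gamma (Complex (c + \<alpha>) t) * rGamma (Complex (1 + \<alpha> - c) (- t))) \<le> B" for t
  proof -
    have "norm (Gamma (Complex (c + \<alpha>) t) * rGamma (Complex (1 + \<alpha> - c) (- t))) =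
        norm (Gamma (Complex (c + \<alpha>) t) * rGamma (Complex (1 + \<alpha> - c) t))"
      by (simp add: norm_mult norm_rGamma_cnj)
    then show ?thesis unfolding B_def using c by (simp add: norm_Gamma_mult_rGamma_le)
  qed
  have "norm (real_symbol \<alpha> \<tau> (Complex c t)) \<le> (C * A * B) * cosh (pi * \<tau>) * exp (- \<bar>t\<bar>)" for \<tau> t
  proof -
    have "norm (real_symbol \<alpha> \<tau> (Complex c t)) \<le>
        cosh (pi * \<tau>) * ((C * exp (- 3 * \<bar>t\<bar>)) * (A * (1 + \<bar>t\<bar>)) * B)"
      unfolding real_symbol_Complex norm_mult[of "_ / _"] norm_mult[of "_ * _ * (_ * _)"]
        norm_mult[of "Gamma (Complex c (t + \<tau>)) * _"]
      using A B C by (intro mult_mono norm_real_symbol_prefactor C bA bB mult_nonneg_nonneg)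
        (auto simp: cosh_real_pos less_imp_le)
    also have "\<dots> \<le> cosh (pi * \<tau>) * ((C * exp (- 3 * \<bar>t\<bar>)) * (A * exp \<bar>t\<bar>) * B)"
      using A B C by (intro mult_left_mono mult_right_mono) (auto simp: cosh_real_pos less_imp_le)
    also have "\<dots> = (C * A * B) * cosh (pi * \<tau>) * (exp (- 3 * \<bar>t\<bar>) * exp \<bar>t\<bar>)" by simp
    also have "exp (- 3 * \<bar>t\<bar>) * exp \<bar>t\<bar> = exp (- 2 * \<bar>t\<bar>)" by (simp flip: exp_add)
    also have "(C * A * B) * cosh (pi * \<tau>) * exp (- 2 * \<bar>t\<bar>) \<le> (C * A * B) * cosh (pi * \<tau>) * exp (- \<bar>t\<bar>)"
      using A B C by (intro mult_left_mono) (auto simp: cosh_real_pos less_imp_le)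
    finally show ?thesis .
  qed
  then show ?thesis using A B C by (intro exI[of _ "C * A * B"]) auto
qed

lemma powr_neg_le_one: "1 \<le> x \<Longrightarrow> a \<le> 0 \<Longrightarrow> x powr a \<le> (1::real)"
  using powr_mono2'[of a 1 x] by simp

lemma powr_neg_half_le:
  assumes "x \<ge> y / 2" "y > 0" "-1 \<le> a" "a \<le> 0"
  shows "x powr a \<le> 2 * y powr (a :: real)"
proof -
  have "x powr a \<le> (y / 2) powr a" using assms by (intro powr_mono2') auto
  also have "\<dots> = 2 powr (- a) * y powr a"
    using assms by (simp add: powr_divide powr_minus field_simps)
  also have "\<dots> \<le> 2 powr 1 * y powr a"
    using assms by (intro mult_right_mono powr_mono) auto
  finally show ?thesis by simp
qed

text \<open>
  Up to the factor \<open>2\<close>, an integrable majorant for \<open>(1 + t) powr (-1/2) * (1 + T) powr (-1/4) * (1 + T - t) powr (-1/4)\<close>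
  on \<open>[0,T]\<close>: at each point one of the factors \<open>1 + t\<close> and \<open>1 + T - t\<close> is comparable to \<open>1 + T\<close> and is
  frozen there. The resulting integral is at most \<open>4\<close> for every \<open>T \<ge> 0\<close>.
\<close>

definition quarter_majorant :: "real \<Rightarrow> real \<Rightarrow> real" where
  "quarter_majorant T t = indicator {0..T} t *
     ((1 + T) powr (-1/2) * (1 + t) powr (-1/2) + (1 + T) powr (-3/4) * (1 + T - t) powr (-1/4))"

lemma quarter_majorant_nonneg: "quarter_majorant T t \<ge> 0"
  by (simp add: quarter_majorant_def)

lemma quarter_majorant_integral:
  assumes T: "T \<ge> 0"
  shows "integrable lborel (quarter_majorant T)" "(LINT t|lborel. quarter_majorant T t) \<le> 4"
proof -
  define f where "f t = (1 + T) powr (-1/2) * (1 + t) powr (-1/2) + (1 + T) powr (-3/4) * (1 + T - t) powr (-1/4)" for t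
  define F where "F t = (1 + T) powr (-1/2) * (2 * (1 + t) powr (1/2)) + (1 + T) powr (-3/4) * (- (4/3) * (1 + T - t) powr (3/4))" for t
  have "(f has_integral (F T - F 0)) {0..T}"
  proof (rule fundamental_theorem_of_calculus[OF T])
    fix t assume t: "t \<in> {0..T}"
    have "(F has_real_derivative f t) (at t within {0..T})"
      unfolding F_def f_def using t
      by (auto intro!: derivative_eq_intros simp: powr_diff field_simps)
    then show "(F has_vector_derivative f t) (at t within {0..T})"
      by (rule has_real_derivative_iff_has_vector_derivative[THEN iffD1])
  qed
  then have hi: "f integrable_on {0..T}" "integral {0..T} f = F T - F 0"
    by (auto simp: has_integral_iff)
  have "f absolutely_integrable_on {0..T}"
    using hi(1) by (intro nonnegative_absolutely_integrable_1) (auto simp: f_def)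
  then have si: "set_integrable lborel {0..T} f"
    unfolding set_integrable_def by (subst (asm) integrable_completion) (auto simp: f_def)
  have q: "quarter_majorant T = (\<lambda>t. indicator {0..T} t *\<^sub>R f t)"
    by (auto simp: quarter_majorant_def f_def)
  show "integrable lborel (quarter_majorant T)" using si unfolding q set_integrable_def .
  have "(LINT t|lborel. quarter_majorant T t) = F T - F 0"
    using set_borel_integral_eq_integral(2)[OF si] unfolding q set_lebesgue_integral_def hi(2) .
  also have "\<dots> = 2 - 2 * (1 + T) powr (-1/2) + (4/3) - (4/3) * (1 + T) powr (-3/4)"
    using T by (simp add: F_def algebra_simps flip: powr_add)
  also have "\<dots> \<le> 4" using powr_ge_zero[of "1 + T" "-1/2"] powr_ge_zero[of "1 + T" "-3/4"] by linarith
  finally show "(LINT t|lborel. quarter_majorant T t) \<le> 4" .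
qed

text \<open>
  The left-hand side is the size of the symbol on the line \<open>Re s = 1/4\<close>, with \<open>T = \<bar>\<tau>\<bar>\<close>; the right-hand
  side has an integral over \<open>t\<close> that is bounded independently of \<open>T\<close>.
\<close>

lemma quarter_weight_le:
  fixes T t :: real
  assumes T: "T \<ge> 0"
  shows "(1 + \<bar>t\<bar>) powr (-1/2) * (1 + \<bar>t\<bar> + T) powr (-1/4) * (1 + \<bar>\<bar>t\<bar> - T\<bar>) powr (-1/4) * exp (- pi * max (\<bar>t\<bar> - T) 0)
    \<le> 2 * (exp (- 1 * \<bar>t - T\<bar>) + exp (- 1 * \<bar>t + T\<bar>) + quarter_majorant T t + quarter_majorant T (- t))"
proof -
  define u where "u = \<bar>t\<bar>"
  have u: "u \<ge> 0" by (simp add: u_def)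
  let ?A = "(1 + u) powr (-1/2)" and ?B = "(1 + u + T) powr (-1/4)" and ?C = "(1 + \<bar>u - T\<bar>) powr (-1/4)"
  have A: "?A \<le> 1" and B: "?B \<le> 1" and C: "?C \<le> 1" using u T by (auto intro!: powr_neg_le_one)
  have maj: "quarter_majorant T u \<le> quarter_majorant T t + quarter_majorant T (- t)"
    unfolding u_def using quarter_majorant_nonneg[of T t] quarter_majorant_nonneg[of T "- t"] by (cases "t \<ge> 0") auto
  have "?A * ?B * ?C * exp (- pi * max (u - T) 0) \<le>
    2 * (exp (- 1 * \<bar>t - T\<bar>) + exp (- 1 * \<bar>t + T\<bar>) + quarter_majorant T t + quarter_majorant T (- t))"
  proof (cases "u \<le> T")
    case True
    have "?A * ?B * ?C \<le> 2 * quarter_majorant T u"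
    proof (cases "u \<le> T / 2")
      \<comment> \<open>Here \<open>1 + T - u\<close> is at least \<open>(1 + T) / 2\<close>; in the other case \<open>1 + u\<close> is.\<close>
      case half: True
      have B': "?B \<le> (1 + T) powr (-1/4)" using u T by (intro powr_mono2') auto
      have C': "?C \<le> 2 * (1 + T) powr (-1/4)" using half T True by (intro powr_neg_half_le) auto
      have "?A * ?B * ?C \<le> ?A * (1 + T) powr (-1/4) * (2 * (1 + T) powr (-1/4))"
        using B' C' by (intro mult_mono) auto
      also have "\<dots> = 2 * ((1 + T) powr (-1/2) * (1 + u) powr (-1/2))"
        using T by (simp flip: powr_add)
      also have "\<dots> \<le> 2 * quarter_majorant T u"
        using True u T by (simp add: quarter_majorant_def)
      finally show ?thesis .
    next
      case half: False
      have B': "?B \<le> (1 + T) powr (-1/4)" using u T by (intro powr_mono2') auto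
      have A': "?A \<le> 2 * (1 + T) powr (-1/2)" using half T by (intro powr_neg_half_le) auto
      have "?A * ?B * ?C \<le> (2 * (1 + T) powr (-1/2)) * (1 + T) powr (-1/4) * ?C"
        using A' B' by (intro mult_mono) auto
      also have "\<dots> = 2 * ((1 + T) powr (-3/4) * (1 + T - u) powr (-1/4))"
      proof -
        have p: "(1 + T) powr (-1/2) * (1 + T) powr (-1/4) = (1 + T) powr (-3/4)"
          using T by (simp flip: powr_add)
        have c: "1 + \<bar>u - T\<bar> = 1 + T - u" using True by simp
        show ?thesis unfolding c p[symmetric] by (simp only: mult.assoc)
      qed
      also have "\<dots> \<le> 2 * quarter_majorant T u"
        using True u T by (simp add: quarter_majorant_def)
      finally show ?thesis .
    qed
    moreover have "exp (- pi * max (u - T) 0) = 1" using True by (simp add: max_def)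
    ultimately have "?A * ?B * ?C * exp (- pi * max (u - T) 0) \<le> 2 * (quarter_majorant T t + quarter_majorant T (- t))"
      using maj by simp
    then show ?thesis using exp_ge_zero[of "- 1 * \<bar>t - T\<bar>"] exp_ge_zero[of "- 1 * \<bar>t + T\<bar>"] by argo
  next
    case False
    have "?A * ?B * ?C \<le> 1 * 1 * 1" using A B C by (intro mult_mono) auto
    then have "?A * ?B * ?C * exp (- pi * max (u - T) 0) \<le> exp (- pi * max (u - T) 0)"
      using mult_right_mono[of "?A * ?B * ?C" "1 * 1 * 1" "exp (- pi * max (u - T) 0)"] by simp
    also have "exp (- pi * max (u - T) 0) \<le> exp (- 1 * (u - T))"
    proof -
      have "1 * (u - T) \<le> pi * (u - T)" using False pi_gt3 by (intro mult_right_mono) auto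
      moreover have "max (u - T) 0 = u - T" using False by simp
      ultimately show ?thesis by (simp only: exp_le_cancel_iff mult_minus_left neg_le_iff_le)
    qed
    also have "exp (- 1 * (u - T)) \<le> exp (- 1 * \<bar>t - T\<bar>) + exp (- 1 * \<bar>t + T\<bar>)"
    proof (cases "t \<ge> 0")
      case True
      then have "u - T = \<bar>t - T\<bar>" using False by (simp add: u_def)
      then show ?thesis by simp
    next
      case neg: False
      then have "u - T = \<bar>t + T\<bar>" using False by (simp add: u_def)
      then show ?thesis by simp
    qed
    finally show ?thesis
      using quarter_majorant_nonneg[of T t] quarter_majorant_nonneg[of T "- t"]
        exp_ge_zero[of "- 1 * \<bar>t - T\<bar>"] exp_ge_zero[of "- 1 * \<bar>t + T\<bar>"] by argo
  qed
  then show ?thesis by (simp only: u_def)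
qed

lemma one_plus_abs_Im_le:
  assumes "a > 0"
  shows "1 + \<bar>t\<bar> \<le> (1 + 1 / a) * norm (Complex a t)"
proof -
  have "a \<le> norm (Complex a t)" "\<bar>t\<bar> \<le> norm (Complex a t)"
    using complex_Re_le_cmod[of "Complex a t"] abs_Im_le_cmod[of "Complex a t"] by simp_all
  moreover have "1 \<le> 1 / a * norm (Complex a t)" using assms calculation(1) by (simp add: field_simps)
  ultimately show ?thesis by (simp add: distrib_right)
qed

lemma norm_Gamma_quarter_powr_le:
  "norm (Gamma (Complex (1/4) y)) \<le> 8 * (1 + \<bar>y\<bar>) powr (-1/4) * exp (- (pi / 2) * \<bar>y\<bar>)"
proof -
  have "norm (Complex (1/4) y) \<ge> (1 + \<bar>y\<bar>) / 5" using one_plus_abs_Im_le[of "1/4" y] by simp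
  then have "norm (Complex (1/4) y) powr (-1/4) \<le> ((1 + \<bar>y\<bar>) / 5) powr (-1/4)"
    by (intro powr_mono2') auto
  also have "\<dots> = 5 powr (1/4) * (1 + \<bar>y\<bar>) powr (-1/4)"
    by (simp add: powr_divide powr_minus field_simps)
  also have "\<dots> \<le> 2 * (1 + \<bar>y\<bar>) powr (-1/4)"
  proof -
    have "5 powr (1/4) \<le> (16::real) powr (1/4)" by (intro powr_mono2) auto
    also have "(16::real) = 2 powr 4" by simp
    also have "(2 powr 4) powr (1/4) = (2::real)" by (subst powr_powr) simp
    finally show ?thesis by (intro mult_right_mono) auto
  qed
  finally have le: "norm (Complex (1/4) y) powr (-1/4) \<le> 2 * (1 + \<bar>y\<bar>) powr (-1/4)" .
  have "norm (Gamma (Complex (1/4) y)) \<le> 4 * norm (Complex (1/4) y) powr (-1/4) * exp (- (pi / 2) * \<bar>y\<bar>)"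
    by (rule norm_Gamma_quarter_le)
  also have "\<dots> \<le> 4 * (2 * (1 + \<bar>y\<bar>) powr (-1/4)) * exp (- (pi / 2) * \<bar>y\<bar>)"
    using le by (intro mult_right_mono mult_left_mono) auto
  finally show ?thesis by simp
qed

lemma norm_Gamma_half_step_ratio:
  assumes a: "a > 0"
  shows "\<exists>K>0. \<forall>t. norm (Gamma (Complex a t) * rGamma (Complex (a + 1/2) (- t))) \<le> K * (1 + \<bar>t\<bar>) powr (-1/2)"
proof -
  define K where "K = sqrt (exp (1 / (4 * a)) * (1 + 1 / a))"
  have K: "K > 0" using a by (auto simp: K_def intro!: mult_pos_pos add_pos_pos)
  have K2: "K\<^sup>2 = exp (1 / (4 * a)) * (1 + 1 / a)" using a by (simp add: K_def)
  have "norm (Gamma (Complex a t) * rGamma (Complex (a + 1/2) (- t))) \<le> K * (1 + \<bar>t\<bar>) powr (-1/2)" for t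
  proof (rule power2_le_imp_le)
    define p where "p = Complex a t"
    define G H where "G = norm (Gamma p)" and "H = norm (Gamma (p + 1/2))"
    have Hpos: "H > 0"
    proof -
      have "p + 1/2 \<notin> \<int>\<^sub>\<le>\<^sub>0" using a by (auto elim!: nonpos_Ints_cases simp: p_def complex_eq_iff)
      then show ?thesis by (simp add: H_def Gamma_eq_zero_iff)
    qed
    have "Complex (a + 1/2) t = p + 1/2" by (simp add: p_def complex_eq_iff)
    then have "norm (rGamma (Complex (a + 1/2) (- t))) = inverse H"
      unfolding norm_rGamma_cnj by (simp add: rGamma_inverse_Gamma norm_inverse H_def)
    then have n: "norm (Gamma (Complex a t) * rGamma (Complex (a + 1/2) (- t))) = G / H"
      by (simp only: norm_mult G_def p_def divide_inverse)
    have ppos: "norm p > 0" using a by (simp add: p_def complex_eq_iff)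
    have "G\<^sup>2 * norm p \<le> exp (1 / (4 * a)) * H\<^sup>2"
      using norm_Gamma_half_step_le[of p] a by (simp add: G_def H_def p_def)
    then have "G\<^sup>2 \<le> exp (1 / (4 * a)) / norm p * H\<^sup>2"
      using ppos by (simp add: pos_le_divide_eq)
    then have "(G / H)\<^sup>2 \<le> exp (1 / (4 * a)) / norm p"
      unfolding power_divide using Hpos by (intro mult_imp_div_pos_le) auto
    also have "\<dots> \<le> exp (1 / (4 * a)) * ((1 + 1 / a) / (1 + \<bar>t\<bar>))"
    proof -
      have "1 / norm p \<le> (1 + 1 / a) / (1 + \<bar>t\<bar>)"
      proof (rule mult_imp_div_pos_le[OF ppos])
        show "1 \<le> (1 + 1 / a) / (1 + \<bar>t\<bar>) * norm p"
          using one_plus_abs_Im_le[OF a, of t] by (simp add: p_def pos_le_divide_eq)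
      qed
      then have "exp (1 / (4 * a)) * (1 / norm p) \<le> exp (1 / (4 * a)) * ((1 + 1 / a) / (1 + \<bar>t\<bar>))"
        by (intro mult_left_mono) auto
      then show ?thesis by simp
    qed
    also have "\<dots> = (K * (1 + \<bar>t\<bar>) powr (-1/2))\<^sup>2"
    proof -
      have "((1 + \<bar>t\<bar>) powr (-1/2))\<^sup>2 = (1 + \<bar>t\<bar>) powr (-1)"
        by (simp add: power2_eq_square flip: powr_add)
      also have "\<dots> = 1 / (1 + \<bar>t\<bar>)" by (simp add: powr_minus_divide)
      finally show ?thesis by (simp add: power_mult_distrib K2)
    qed
    finally show "(norm (Gamma (Complex a t) * rGamma (Complex (a + 1/2) (- t))))\<^sup>2 \<le> (K * (1 + \<bar>t\<bar>) powr (-1/2))\<^sup>2"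
      unfolding n .
  qed (use K in auto)
  then show ?thesis using K by blast
qed

text \<open>
  On the line \<open>Re s = 1/4\<close> the quotient \<open>\<Gamma>(1/2 - s) / \<Gamma>(s)\<close> has modulus one, and \<open>\<alpha> > -1/4\<close> makes the
  half-step inequality applicable to \<open>\<Gamma>(s + \<alpha>) / \<Gamma>(1 + \<alpha> - s)\<close>. The pair \<open>\<Gamma>(s + \<i> \<tau>) \<Gamma>(s - \<i> \<tau>)\<close> contributes
  \<open>exp (-\<pi> max \<bar>t\<bar> \<bar>\<tau>\<bar>)\<close>, which cancels the growth of \<open>cosh (\<pi> \<tau>)\<close>.
\<close>

lemma real_symbol_quarter_pointwise:
  assumes al: "\<alpha> > -1/4"
  shows "\<exists>C>0. \<forall>\<tau> t. norm (real_symbol \<alpha> \<tau> (Complex (1/4) t)) \<le>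
    C * (exp (- 1 * \<bar>t - \<bar>\<tau>\<bar>\<bar>) + exp (- 1 * \<bar>t + \<bar>\<tau>\<bar>\<bar>) + quarter_majorant \<bar>\<tau>\<bar> t + quarter_majorant \<bar>\<tau>\<bar> (- t))"
proof -
  obtain K where K: "K > 0" "\<And>t. norm (Gamma (Complex (1/4 + \<alpha>) t) * rGamma (Complex (1/4 + \<alpha> + 1/2) (- t))) \<le> K * (1 + \<bar>t\<bar>) powr (-1/2)"
    using norm_Gamma_half_step_ratio[of "1/4 + \<alpha>"] al by auto
  have "norm (real_symbol \<alpha> \<tau> (Complex (1/4) t)) \<le> (64 * K * 2) *
      (exp (- 1 * \<bar>t - \<bar>\<tau>\<bar>\<bar>) + exp (- 1 * \<bar>t + \<bar>\<tau>\<bar>\<bar>) + quarter_majorant \<bar>\<tau>\<bar> t + quarter_majorant \<bar>\<tau>\<bar> (- t))" for \<tau> t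
  proof -
    define T u where "T = \<bar>\<tau>\<bar>" and "u = \<bar>t\<bar>"
    let ?m = "max (u - T) 0"
    have third: "norm (Gamma (Complex (1/4 + \<alpha>) t) * rGamma (Complex (1 + \<alpha> - 1/4) (- t))) \<le> K * (1 + u) powr (-1/2)"
      using K(2)[of t] by (simp add: u_def algebra_simps)
    have second: "norm (Gamma (Complex (1/2 - 1/4) (- t)) * rGamma (Complex (1/4) t)) \<le> 1"
    proof -
      have "norm (Gamma (Complex (1/2 - 1/4) (- t)) * rGamma (Complex (1/4) t)) = norm (Gamma (Complex (1/4) t) * rGamma (Complex (1/4) t))"
        by (simp add: norm_mult norm_Gamma_cnj)
      also have "\<dots> \<le> Gamma (1/4) / Gamma (1/4 :: real)" by (rule norm_Gamma_mult_rGamma_le) auto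
      also have "\<dots> = 1"
      proof -
        have "Gamma (1/4 :: real) > 0" by (rule Gamma_real_pos) simp
        then show ?thesis by (simp only: divide_self less_irrefl simp_thms order_less_imp_not_eq2)
      qed
      finally show ?thesis .
    qed
    have first: "cosh (pi * \<tau>) * norm (Gamma (Complex (1/4) (t + \<tau>)) * Gamma (Complex (1/4) (t - \<tau>)))
        \<le> 64 * ((1 + u + T) powr (-1/4) * (1 + \<bar>u - T\<bar>) powr (-1/4) * exp (- pi * ?m))"
    proof -
      have cosh: "cosh (pi * \<tau>) \<le> exp (pi * T)"
      proof -
        have "cosh (pi * \<tau>) = cosh \<bar>pi * \<tau>\<bar>" by simp
        also have "\<bar>pi * \<tau>\<bar> = pi * T" by (simp add: abs_mult T_def)
        also have "cosh (pi * T) \<le> (exp (pi * T) + exp (pi * T)) / 2"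
          unfolding cosh_def by (simp add: T_def)
        finally show ?thesis by simp
      qed
      have split: "\<bar>t + \<tau>\<bar> = u + T \<and> \<bar>t - \<tau>\<bar> = \<bar>u - T\<bar> \<or> \<bar>t + \<tau>\<bar> = \<bar>u - T\<bar> \<and> \<bar>t - \<tau>\<bar> = u + T"
        unfolding u_def T_def by arith
      have "norm (Gamma (Complex (1/4) (t + \<tau>)) * Gamma (Complex (1/4) (t - \<tau>))) \<le>
          (8 * (1 + \<bar>t + \<tau>\<bar>) powr (-1/4) * exp (- (pi / 2) * \<bar>t + \<tau>\<bar>)) * (8 * (1 + \<bar>t - \<tau>\<bar>) powr (-1/4) * exp (- (pi / 2) * \<bar>t - \<tau>\<bar>))"
        unfolding norm_mult by (intro mult_mono norm_Gamma_quarter_powr_le) auto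
      also have "\<dots> = (8 * (1 + (u + T)) powr (-1/4) * exp (- (pi / 2) * (u + T))) * (8 * (1 + \<bar>u - T\<bar>) powr (-1/4) * exp (- (pi / 2) * \<bar>u - T\<bar>))"
        using split by (elim disjE conjE) (simp_all only: mult.commute)
      also have "\<dots> = 64 * ((1 + u + T) powr (-1/4) * (1 + \<bar>u - T\<bar>) powr (-1/4)) * exp (- (pi / 2) * (u + T) - (pi / 2) * \<bar>u - T\<bar>)"
      proof -
        have e: "exp (- (pi / 2) * (u + T)) * exp (- (pi / 2) * \<bar>u - T\<bar>) = exp (- (pi / 2) * (u + T) - (pi / 2) * \<bar>u - T\<bar>)"
          by (simp flip: exp_add)
        have r: "(8 * A * x) * (8 * B * y) = 64 * (A * B) * (x * y)" for A B x y :: real by simp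
        show ?thesis unfolding r e by (simp only: add.assoc)
      qed
      finally have "cosh (pi * \<tau>) * norm (Gamma (Complex (1/4) (t + \<tau>)) * Gamma (Complex (1/4) (t - \<tau>))) \<le>
          exp (pi * T) * (64 * ((1 + u + T) powr (-1/4) * (1 + \<bar>u - T\<bar>) powr (-1/4)) * exp (- (pi / 2) * (u + T) - (pi / 2) * \<bar>u - T\<bar>))"
        using cosh by (intro mult_mono) auto
      also have "\<dots> = 64 * ((1 + u + T) powr (-1/4) * (1 + \<bar>u - T\<bar>) powr (-1/4)) * exp (pi * T + (- (pi / 2) * (u + T) - (pi / 2) * \<bar>u - T\<bar>))"
        by (simp only: exp_add mult_ac)
      also have "pi * T + (- (pi / 2) * (u + T) - (pi / 2) * \<bar>u - T\<bar>) = - pi * ?m"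
        by (cases "u \<le> T") (simp_all add: max_def field_simps)
      finally show ?thesis by (simp only: mult.assoc)
    qed
    have "norm (real_symbol \<alpha> \<tau> (Complex (1/4) t)) \<le>
        cosh (pi * \<tau>) * (norm (Gamma (Complex (1/4) (t + \<tau>)) * Gamma (Complex (1/4) (t - \<tau>))) * 1 * (K * (1 + u) powr (-1/2)))"
      unfolding real_symbol_Complex norm_mult[of "_ / _"] norm_mult[of "_ * _ * (_ * _)"]
        norm_mult[of "Gamma (Complex (1/4) (t + \<tau>)) * Gamma _" "_ * _"]
      by (intro mult_mono norm_real_symbol_prefactor second third mult_nonneg_nonneg)
        (use K in \<open>auto simp: cosh_real_pos less_imp_le\<close>)
    also have "\<dots> = (cosh (pi * \<tau>) * norm (Gamma (Complex (1/4) (t + \<tau>)) * Gamma (Complex (1/4) (t - \<tau>)))) * (K * (1 + u) powr (-1/2))"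
      by (simp only: mult_ac mult_1_right)
    also have "\<dots> \<le> (64 * ((1 + u + T) powr (-1/4) * (1 + \<bar>u - T\<bar>) powr (-1/4) * exp (- pi * ?m))) * (K * (1 + u) powr (-1/2))"
      using first K by (intro mult_right_mono) auto
    also have "\<dots> = 64 * K * ((1 + u) powr (-1/2) * (1 + u + T) powr (-1/4) * (1 + \<bar>u - T\<bar>) powr (-1/4) * exp (- pi * ?m))"
      by (simp only: mult_ac)
    also have "\<dots> \<le> 64 * K * (2 * (exp (- 1 * \<bar>t - T\<bar>) + exp (- 1 * \<bar>t + T\<bar>) + quarter_majorant T t + quarter_majorant T (- t)))"
      using quarter_weight_le[of T t] K unfolding u_def by (intro mult_left_mono) (auto simp: T_def)
    finally show ?thesis by (simp only: T_def mult.assoc)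
  qed
  then show ?thesis using K by (intro exI[of _ "64 * K * 2"]) auto
qed

lemma real_symbol_quarter_integral_bound:
  assumes al: "\<alpha> > -1/4"
  shows "\<exists>C>0. \<forall>\<tau>. \<forall>f. f \<in> borel_measurable lborel \<longrightarrow>
    (\<forall>t. norm (f t) \<le> norm (real_symbol \<alpha> \<tau> (Complex (1/4) t))) \<longrightarrow> norm (LINT t|lborel. f t :: complex) \<le> C"
proof -
  obtain C where C: "C > 0" "\<And>\<tau> t. norm (real_symbol \<alpha> \<tau> (Complex (1/4) t)) \<le>
    C * (exp (- 1 * \<bar>t - \<bar>\<tau>\<bar>\<bar>) + exp (- 1 * \<bar>t + \<bar>\<tau>\<bar>\<bar>) + quarter_majorant \<bar>\<tau>\<bar> t + quarter_majorant \<bar>\<tau>\<bar> (- t))"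
    using real_symbol_quarter_pointwise[OF al] by (elim exE conjE) (rule that, assumption, elim allE)
  define I0 where "I0 = (LINT t|lborel. exp (- 1 * \<bar>t :: real\<bar>))"
  have I0: "I0 \<ge> 0" unfolding I0_def by (intro integral_nonneg_AE) auto
  have "norm (LINT t|lborel. f t) \<le> C * (I0 + I0 + 4 + 4)"
    if f: "f \<in> borel_measurable lborel" "\<And>t. norm (f t) \<le> norm (real_symbol \<alpha> \<tau> (Complex (1/4) t))" for f :: "real \<Rightarrow> complex" and \<tau>
  proof -
    define T where "T = \<bar>\<tau>\<bar>"
    note E = integrable_exp_neg_abs[of 1, OF zero_less_one]
    note Q = quarter_majorant_integral[of T]
    have T: "T \<ge> 0" by (simp add: T_def)
    have e1: "integrable lborel (\<lambda>t. exp (- 1 * \<bar>t - T\<bar>))" "(LINT t|lborel. exp (- 1 * \<bar>t - T\<bar>)) = I0"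
      using lborel_integrable_real_affine[OF E, of 1 "- T"] lborel_integral_real_affine[of 1 "\<lambda>t. exp (- 1 * \<bar>t\<bar>)" "- T"]
      by (simp_all add: I0_def algebra_simps)
    have e2: "integrable lborel (\<lambda>t. exp (- 1 * \<bar>t + T\<bar>))" "(LINT t|lborel. exp (- 1 * \<bar>t + T\<bar>)) = I0"
      using lborel_integrable_real_affine[OF E, of 1 T] lborel_integral_real_affine[of 1 "\<lambda>t. exp (- 1 * \<bar>t\<bar>)" T]
      by (simp_all add: I0_def algebra_simps)
    have q2: "integrable lborel (\<lambda>t. quarter_majorant T (- t))" "(LINT t|lborel. quarter_majorant T (- t)) \<le> 4"
      using lborel_integrable_real_affine[OF Q(1)[OF T], of "-1" 0] lborel_integral_real_affine[of "-1" "quarter_majorant T" 0] Q(2)[OF T]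
      by simp_all
    let ?D = "\<lambda>t. C * (exp (- 1 * \<bar>t - T\<bar>) + exp (- 1 * \<bar>t + T\<bar>) + quarter_majorant T t + quarter_majorant T (- t))"
    have int: "integrable lborel ?D"
      by (intro integrable_mult_right Bochner_Integration.integrable_add e1(1) e2(1) q2(1) Q(1)[OF T])
    have le: "norm (f t) \<le> ?D t" for t using f(2)[of t] C(2)[of \<tau> t] by (simp add: T_def)
    have "norm (LINT t|lborel. f t) \<le> (LINT t|lborel. ?D t)"
    proof (rule order_trans[OF integral_norm_bound])
      have "integrable lborel f"
        using order_trans[OF le abs_ge_self] by (intro Bochner_Integration.integrable_bound[OF int f(1)]) simp
      then show "(LINT t|lborel. norm (f t)) \<le> (LINT t|lborel. ?D t)"
        using int le by (intro integral_mono integrable_norm)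
    qed
    also have "\<dots> = C * (I0 + I0 + (LINT t|lborel. quarter_majorant T t) + (LINT t|lborel. quarter_majorant T (- t)))"
      using e1 e2 q2(1) Q(1)[OF T] by simp
    also have "\<dots> \<le> C * (I0 + I0 + 4 + 4)"
      using C(1) Q(2)[OF T] q2(2) by (intro mult_left_mono add_mono) auto
    finally show ?thesis .
  qed
  then show ?thesis using C I0 by (intro exI[of _ "C * (I0 + I0 + 4 + 4)"]) auto
qed

section \<open>The kernel of the index transform\<close>

lemma continuous_on_Gamma_line:
  assumes "c > 0" "continuous_on A f"
  shows "continuous_on A (\<lambda>p. Gamma (Complex c (f p)))"
proof (rule continuous_on_compose2[of "- \<int>\<^sub>\<le>\<^sub>0" Gamma])
  show "continuous_on A (\<lambda>p. Complex c (f p))"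
    unfolding Complex_eq using assms(2) by (intro continuous_intros)
  show "continuous_on (- \<int>\<^sub>\<le>\<^sub>0) (Gamma :: complex \<Rightarrow> complex)" by (intro continuous_on_Gamma) auto
  show "(\<lambda>p. Complex c (f p)) ` A \<subseteq> - \<int>\<^sub>\<le>\<^sub>0"
    using assms(1) by (auto elim!: nonpos_Ints_cases simp: complex_eq_iff)
qed

lemma continuous_on_rGamma_line:
  assumes "continuous_on A f"
  shows "continuous_on A (\<lambda>p. rGamma (Complex c (f p)))"
proof (rule continuous_on_compose2[of UNIV rGamma])
  show "continuous_on A (\<lambda>p. Complex c (f p))"
    unfolding Complex_eq using assms by (intro continuous_intros)
qed (auto intro: continuous_on_rGamma)

lemma continuous_on_core_symbol:
  assumes c: "0 < c" "c < 1/2" and f: "continuous_on A f" "continuous_on A h"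
  shows "continuous_on A (\<lambda>p. core_symbol (f p) (Complex c (h p)))"
  unfolding core_symbol_Complex using c f
  by (intro continuous_intros continuous_on_Gamma_line) auto

lemma continuous_on_real_symbol:
  assumes c: "max (-\<alpha>) 0 < c" "c < 1/2" and f: "continuous_on A f" "continuous_on A h"
  shows "continuous_on A (\<lambda>p. real_symbol \<alpha> (f p) (Complex c (h p)))"
  unfolding real_symbol_Complex cosh_def using c f
  by (intro continuous_intros continuous_on_Gamma_line continuous_on_rGamma_line) auto

lemma continuous_on_KI_symbol:
  assumes c: "max (-\<alpha>) 0 < c" "c < 1/2"
  shows "continuous_on UNIV (\<lambda>t. KI_symbol \<alpha> \<tau> (Complex c t))"
proof -
  have e: "Complex c t + of_real \<alpha> = Complex (c + \<alpha>) t" "Complex c t + Complex 0 (-\<tau>) = Complex c (t - \<tau>)"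
    "1/2 - Complex c t = Complex (1/2 - c) (- t)" "1 - Complex c t = Complex (1 - c) (- t)"
    "1 + of_real \<alpha> - Complex c t = Complex (1 + \<alpha> - c) (- t)" "1 + Complex 0 (-\<tau>) - Complex c t = Complex (1 - c) (- \<tau> - t)" for t
    by (simp_all add: complex_eq_iff)
  show ?thesis unfolding KI_symbol_def e using c
    by (intro continuous_intros continuous_on_Gamma_line continuous_on_rGamma_line) auto
qed

text \<open>
  The Mellin-Barnes integral without its factor \<open>x powr (-c)\<close>, so that \<open>x\<close> enters only through a
  factor of modulus one.
\<close>

definition phase_kernel :: "real \<Rightarrow> real \<Rightarrow> real \<Rightarrow> real \<Rightarrow> complex" where
  "phase_kernel \<alpha> c x \<tau> = (LINT t|lborel. real_symbol \<alpha> \<tau> (Complex c t) * exp (- (\<i> * of_real (t * ln x)))) / (2 * of_real pi)"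

lemma of_real_powr_line:
  assumes "x > 0"
  shows "of_real x powr (- Complex c t) = of_real (x powr (- c)) * exp (- (\<i> * of_real (t * ln x)))"
proof -
  have "of_real x powr (- Complex c t) = exp (- Complex c t * of_real (ln x))"
    using assms by (simp add: powr_def Ln_of_real)
  also have "- Complex c t * of_real (ln x) = of_real (- c * ln x) + (- (\<i> * of_real (t * ln x)))"
    by (simp add: complex_eq_iff)
  also have "exp \<dots> = of_real (x powr (- c)) * exp (- (\<i> * of_real (t * ln x)))"
    using assms by (simp only: exp_add exp_of_real) (simp add: powr_def)
  finally show ?thesis .
qed

lemma integrable_real_symbol:
  assumes c: "max (-\<alpha>) 0 < c" "c < 1/2"
  shows "integrable lborel (\<lambda>t. real_symbol \<alpha> \<tau> (Complex c t))"
proof -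
  obtain C where C: "C > 0" "\<And>\<tau> t. norm (real_symbol \<alpha> \<tau> (Complex c t)) \<le> C * cosh (pi * \<tau>) * exp (- \<bar>t\<bar>)"
    using real_symbol_line_bound[OF c] by blast
  show ?thesis
  proof (rule integrable_exp_decay[OF continuous_on_real_symbol[OF c] zero_less_one])
    show "norm (real_symbol \<alpha> \<tau> (Complex c t)) \<le> (C * cosh (pi * \<tau>)) * exp (- 1 * \<bar>t\<bar>)" for t
      using C(2)[of \<tau> t] by simp
  qed (auto intro: continuous_intros)
qed

lemma real_symbol_phase_measurable:
  assumes c: "max (-\<alpha>) 0 < c" "c < 1/2"
  shows "(\<lambda>t. real_symbol \<alpha> \<tau> (Complex c t) * exp (- (\<i> * of_real (t * ln x)))) \<in> borel_measurable lborel"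
proof -
  have "continuous_on UNIV (\<lambda>t. real_symbol \<alpha> \<tau> (Complex c t) * exp (- (\<i> * of_real (t * ln x))))"
    by (intro continuous_intros continuous_on_real_symbol[OF c])
  then show ?thesis by (simp add: borel_measurable_continuous_onI)
qed

text \<open>
  The product for \<open>-\<tau>\<close> is the complex conjugate of the product for \<open>\<tau>\<close>, so the real part is the
  average of the two Mellin-Barnes integrals.
\<close>

lemma bessel_product_eq_phase_kernel:
  assumes al: "\<alpha> > -1/2" and c: "max (-\<alpha>) 0 < c" "c < 1/2" and tau: "\<tau> \<noteq> 0" and x: "x > 0"
  shows "of_real (Re (bessel_K (Complex \<alpha> \<tau>) (of_real (sqrt x)) * bessel_I (Complex \<alpha> (- \<tau>)) (of_real (sqrt x))))
    = of_real (x powr (- c)) * phase_kernel \<alpha> c x \<tau>"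
proof -
  define P where "P \<tau> = bessel_K (Complex \<alpha> \<tau>) (of_real (sqrt x)) * bessel_I (Complex \<alpha> (- \<tau>)) (of_real (sqrt x))" for \<tau>
  have MB: "(LINT t|lborel. KI_symbol \<alpha> \<tau> (Complex c t) * of_real x powr (- Complex c t)) = 2 * of_real pi * P \<tau>" if "\<tau> \<noteq> 0" for \<tau>
    unfolding P_def by (rule bessel_product_Mellin_Barnes[OF al that c x])
  have int: "integrable lborel (\<lambda>t. KI_symbol \<alpha> \<tau> (Complex c t) * of_real x powr (- Complex c t))" for \<tau>
  proof -
    obtain C T where CT: "\<And>s. c \<le> Re s \<Longrightarrow> Re s \<le> c \<Longrightarrow> \<bar>Im s\<bar> \<ge> T \<Longrightarrow> norm (KI_symbol \<alpha> \<tau> s) \<le> C * exp (- \<bar>Im s\<bar>)"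
      using KI_symbol_decay[of c c \<alpha> \<tau>] by blast
    show ?thesis unfolding of_real_powr_line[OF x]
    proof (rule integrable_exp_decay[OF _ zero_less_one])
      show "continuous_on UNIV (\<lambda>t. KI_symbol \<alpha> \<tau> (Complex c t) * (of_real (x powr (- c)) * exp (- (\<i> * of_real (t * ln x)))))"
        by (intro continuous_intros continuous_on_KI_symbol[OF c])
      show "norm (KI_symbol \<alpha> \<tau> (Complex c t) * (of_real (x powr (- c)) * exp (- (\<i> * of_real (t * ln x))))) \<le> (C * x powr (- c)) * exp (- 1 * \<bar>t\<bar>)"
        if "T \<le> \<bar>t\<bar>" for t
        using mult_right_mono[OF CT[of "Complex c t"], of "x powr (- c)"] that by (simp add: norm_mult mult_ac)
    qed
  qed
  have cnj: "cnj (P \<tau>) = P (- \<tau>)"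
  proof -
    have "Complex \<alpha> \<tau> \<notin> \<int>" "Complex \<alpha> (- \<tau>) \<notin> \<int>" using tau by (auto intro!: not_Int_if_Im)
    moreover have "cnj (Complex \<alpha> \<tau>) = Complex \<alpha> (- \<tau>)" "cnj (Complex \<alpha> (- \<tau>)) = Complex \<alpha> \<tau>"
      by (simp_all add: complex_eq_iff)
    ultimately show ?thesis using x by (simp add: P_def cnj_bessel_I cnj_bessel_K_nonint)
  qed
  have "2 * of_real pi * of_real (Re (P \<tau>)) = (2 * of_real pi * P \<tau> + 2 * of_real pi * P (- \<tau>)) / 2"
    unfolding cnj[symmetric] by (simp add: complex_eq_iff)
  also have "\<dots> = ((LINT t|lborel. KI_symbol \<alpha> \<tau> (Complex c t) * of_real x powr (- Complex c t)) +
      (LINT t|lborel. KI_symbol \<alpha> (- \<tau>) (Complex c t) * of_real x powr (- Complex c t))) / 2"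
    using tau by (simp add: MB)
  also have "\<dots> = (LINT t|lborel. (KI_symbol \<alpha> \<tau> (Complex c t) * of_real x powr (- Complex c t) +
      KI_symbol \<alpha> (- \<tau>) (Complex c t) * of_real x powr (- Complex c t)) / 2)"
    using int[of \<tau>] int[of "- \<tau>"] by simp
  also have "\<dots> = (LINT t|lborel. of_real (x powr (- c)) * (real_symbol \<alpha> \<tau> (Complex c t) * exp (- (\<i> * of_real (t * ln x)))))"
  proof (rule Bochner_Integration.integral_cong[OF refl])
    fix t
    have avg: "(KI_symbol \<alpha> \<tau> (Complex c t) + KI_symbol \<alpha> (- \<tau>) (Complex c t)) / 2 = real_symbol \<alpha> \<tau> (Complex c t)"
      using c by (intro KI_symbol_average) auto
    have factor: "(a * (r * e) + b * (r * e)) / 2 = r * ((a + b) / 2 * e)" for a b r e :: complex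
      by (simp add: field_simps)
    show "(KI_symbol \<alpha> \<tau> (Complex c t) * of_real x powr (- Complex c t) +
      KI_symbol \<alpha> (- \<tau>) (Complex c t) * of_real x powr (- Complex c t)) / 2
      = of_real (x powr (- c)) * (real_symbol \<alpha> \<tau> (Complex c t) * exp (- (\<i> * of_real (t * ln x))))"
      unfolding of_real_powr_line[OF x] avg[symmetric] by (rule factor)
  qed
  also have "\<dots> = of_real (x powr (- c)) * (2 * of_real pi * phase_kernel \<alpha> c x \<tau>)"
    by (simp add: phase_kernel_def)
  finally have "2 * of_real pi * of_real (Re (P \<tau>)) = 2 * of_real pi * (of_real (x powr (- c)) * phase_kernel \<alpha> c x \<tau>)"
    by (simp only: mult_ac)
  then show ?thesis by (simp add: P_def)
qed

lemma phase_kernel_quarter_bound: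
  assumes al: "\<alpha> > -1/4"
  shows "\<exists>C>0. \<forall>x \<tau>. norm (phase_kernel \<alpha> (1/4) x \<tau>) \<le> C"
proof -
  have c: "max (-\<alpha>) 0 < 1/4" "1/4 < (1/2::real)" using al by auto
  obtain C where C: "C > 0" "\<And>\<tau> f. f \<in> borel_measurable lborel \<Longrightarrow>
    (\<forall>t. norm (f t) \<le> norm (real_symbol \<alpha> \<tau> (Complex (1/4) t))) \<Longrightarrow> norm (LINT t|lborel. f t :: complex) \<le> C"
    using real_symbol_quarter_integral_bound[OF al] by blast
  have "norm (phase_kernel \<alpha> (1/4) x \<tau>) \<le> C" for x \<tau>
  proof -
    have "norm (LINT t|lborel. real_symbol \<alpha> \<tau> (Complex (1/4) t) * exp (- (\<i> * of_real (t * ln x)))) \<le> C"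
      by (rule C(2)[OF real_symbol_phase_measurable[OF c]]) (auto simp: norm_mult)
    moreover have "norm (2 * complex_of_real pi) \<ge> 1" using pi_gt3 by (simp add: norm_mult)
    then have "norm (LINT t|lborel. real_symbol \<alpha> \<tau> (Complex (1/4) t) * exp (- (\<i> * of_real (t * ln x)))) / norm (2 * complex_of_real pi)
        \<le> norm (LINT t|lborel. real_symbol \<alpha> \<tau> (Complex (1/4) t) * exp (- (\<i> * of_real (t * ln x)))) / 1"
      by (intro divide_left_mono) auto
    ultimately show ?thesis by (simp add: phase_kernel_def norm_divide)
  qed
  then show ?thesis using C by blast
qed

lemma phase_kernel_line_bound:
  assumes c: "max (-\<alpha>) 0 < c" "c < 1/2"
  shows "\<exists>C>0. \<forall>x \<tau>. norm (phase_kernel \<alpha> c x \<tau>) \<le> C * cosh (pi * \<tau>)"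
proof -
  obtain C where C: "C > 0" "\<And>\<tau> t. norm (real_symbol \<alpha> \<tau> (Complex c t)) \<le> C * cosh (pi * \<tau>) * exp (- \<bar>t\<bar>)"
    using real_symbol_line_bound[OF c] by blast
  define I0 where "I0 = (LINT t|lborel. exp (- 1 * \<bar>t :: real\<bar>))"
  have I0: "I0 \<ge> 0" unfolding I0_def by (intro integral_nonneg_AE) auto
  note E = integrable_exp_neg_abs[of 1, OF zero_less_one]
  have "norm (phase_kernel \<alpha> c x \<tau>) \<le> (C * (I0 + 1)) * cosh (pi * \<tau>)" for x \<tau>
  proof -
    let ?J = "LINT t|lborel. real_symbol \<alpha> \<tau> (Complex c t) * exp (- (\<i> * of_real (t * ln x)))"
    have "norm ?J \<le> (LINT t|lborel. norm (real_symbol \<alpha> \<tau> (Complex c t) * exp (- (\<i> * of_real (t * ln x)))))"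
      by (rule integral_norm_bound)
    also have "\<dots> = (LINT t|lborel. norm (real_symbol \<alpha> \<tau> (Complex c t)))"
      by (simp add: norm_mult)
    also have "\<dots> \<le> (LINT t|lborel. (C * cosh (pi * \<tau>)) * exp (- 1 * \<bar>t\<bar>))"
      using C(2)[of \<tau>] by (intro integral_mono integrable_norm integrable_real_symbol[OF c] integrable_mult_right E) auto
    also have "\<dots> = (C * cosh (pi * \<tau>)) * I0" by (simp add: I0_def)
    also have "\<dots> \<le> (C * cosh (pi * \<tau>)) * (I0 + 1)"
      using C by (intro mult_left_mono) (auto simp: cosh_real_pos less_imp_le)
    finally have J: "norm ?J \<le> (C * (I0 + 1)) * cosh (pi * \<tau>)" by (simp only: mult_ac)
    have "norm (2 * complex_of_real pi) \<ge> 1" using pi_gt3 by (simp add: norm_mult)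
    then have "norm ?J / norm (2 * complex_of_real pi) \<le> norm ?J / 1"
      by (intro divide_left_mono) auto
    then show ?thesis using J by (simp add: phase_kernel_def norm_divide)
  qed
  then show ?thesis using C I0 by (intro exI[of _ "C * (I0 + 1)"]) (auto intro!: mult_pos_pos add_nonneg_pos)
qed

lemma phase_kernel_continuous:
  assumes c: "max (-\<alpha>) 0 < c" "c < 1/2"
  shows "continuous_on {0<..} (\<lambda>x. phase_kernel \<alpha> c x \<tau>)"
proof -
  have "continuous_on {0<..} (\<lambda>x. LINT t|lborel. real_symbol \<alpha> \<tau> (Complex c t) * exp (- (\<i> * of_real (t * ln x))))"
  proof (rule continuous_on_sequentiallyI)
    fix X :: "nat \<Rightarrow> real" and x assume X: "\<forall>n. X n \<in> {0<..}" "x \<in> {0<..}" "X \<longlonglongrightarrow> x"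
    show "(\<lambda>n. LINT t|lborel. real_symbol \<alpha> \<tau> (Complex c t) * exp (- (\<i> * of_real (t * ln (X n))))) \<longlonglongrightarrow>
        (LINT t|lborel. real_symbol \<alpha> \<tau> (Complex c t) * exp (- (\<i> * of_real (t * ln x))))"
    proof (rule integral_dominated_convergence)
      show "integrable lborel (\<lambda>t. norm (real_symbol \<alpha> \<tau> (Complex c t)))"
        by (intro integrable_norm integrable_real_symbol[OF c])
      show "AE t in lborel. (\<lambda>n. real_symbol \<alpha> \<tau> (Complex c t) * exp (- (\<i> * of_real (t * ln (X n))))) \<longlonglongrightarrow>
          real_symbol \<alpha> \<tau> (Complex c t) * exp (- (\<i> * of_real (t * ln x)))"
        using X by (intro AE_I2 tendsto_intros) auto
      show "(\<lambda>t. real_symbol \<alpha> \<tau> (Complex c t) * exp (- (\<i> * of_real (t * ln (X n))))) \<in> borel_measurable lborel" for n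
        by (rule real_symbol_phase_measurable[OF c])
      show "(\<lambda>t. real_symbol \<alpha> \<tau> (Complex c t) * exp (- (\<i> * of_real (t * ln x)))) \<in> borel_measurable lborel"
        by (rule real_symbol_phase_measurable[OF c])
    qed (auto simp: norm_mult)
  qed
  then show ?thesis unfolding phase_kernel_def by (intro continuous_intros) auto
qed

lemma phase_kernel_measurable:
  assumes c: "max (-\<alpha>) 0 < c" "c < 1/2"
  shows "(\<lambda>p. phase_kernel \<alpha> c (fst p) (snd p)) \<in> borel_measurable (borel \<Otimes>\<^sub>M borel)"
proof -
  have "continuous_on UNIV (\<lambda>q::real \<times> real. real_symbol \<alpha> (fst q) (Complex c (snd q)))"
    by (intro continuous_on_real_symbol[OF c] continuous_intros)
  then have m: "(\<lambda>q::real \<times> real. real_symbol \<alpha> (fst q) (Complex c (snd q))) \<in> borel_measurable (borel \<Otimes>\<^sub>M borel)"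
    unfolding borel_prod by (rule borel_measurable_continuous_onI)
  have "(\<lambda>r::(real \<times> real) \<times> real. real_symbol \<alpha> (snd (fst r)) (Complex c (snd r)))
      \<in> borel_measurable ((borel \<Otimes>\<^sub>M borel) \<Otimes>\<^sub>M lborel)"
    using measurable_compose[OF _ m, of "\<lambda>r::(real \<times> real) \<times> real. (snd (fst r), snd r)" "(borel \<Otimes>\<^sub>M borel) \<Otimes>\<^sub>M lborel"]
    by simp
  then have "(\<lambda>r::(real \<times> real) \<times> real. real_symbol \<alpha> (snd (fst r)) (Complex c (snd r)) * exp (- (\<i> * of_real (snd r * ln (fst (fst r))))))
      \<in> borel_measurable ((borel \<Otimes>\<^sub>M borel) \<Otimes>\<^sub>M lborel)"
    by measurable
  then have "(\<lambda>p::real \<times> real. LINT t|lborel. real_symbol \<alpha> (snd p) (Complex c t) * exp (- (\<i> * of_real (t * ln (fst p)))))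
      \<in> borel_measurable (borel \<Otimes>\<^sub>M borel)"
    by (intro lborel.borel_measurable_lebesgue_integral) (simp add: case_prod_beta')
  then show ?thesis unfolding phase_kernel_def by measurable
qed

section \<open>The Mellin transform of the kernel\<close>

text \<open>
  The form in which Fubini's theorem is applied throughout.
\<close>

lemma (in pair_sigma_finite) integrable_product_bound:
  fixes f :: "'a \<times> 'b \<Rightarrow> complex"
  assumes f: "f \<in> borel_measurable (M1 \<Otimes>\<^sub>M M2)"
    and u: "integrable M1 (u :: 'a \<Rightarrow> real)" and v: "integrable M2 (v :: 'b \<Rightarrow> real)"
    and le: "\<And>x y. norm (f (x, y)) \<le> u x * v y"
  shows "integrable (M1 \<Otimes>\<^sub>M M2) f"
proof -
  have [measurable]: "u \<in> borel_measurable M1" "v \<in> borel_measurable M2" using u v by auto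
  have "integrable (M1 \<Otimes>\<^sub>M M2) (\<lambda>p. u (fst p) * v (snd p))"
  proof (rule Fubini_integrable)
    show "integrable M1 (\<lambda>x. LINT y|M2. norm (u (fst (x, y)) * v (snd (x, y))))"
      using u by (simp add: abs_mult)
    show "AE x in M1. integrable M2 (\<lambda>y. u (fst (x, y)) * v (snd (x, y)))"
      using v by simp
  qed measurable
  then show ?thesis
    using f by (rule Bochner_Integration.integrable_bound)
      (use le in \<open>auto intro!: AE_I2 order_trans[OF _ abs_ge_self]\<close>)
qed

lemma exp_ln_has_derivative:
  fixes z :: complex
  assumes "x > 0" "z \<noteq> 0"
  shows "((\<lambda>x. exp (z * of_real (ln x)) / z) has_vector_derivative exp ((z - 1) * of_real (ln x))) (at x)"
proof -
  have "((\<lambda>x. z * of_real (ln x)) has_vector_derivative z * of_real (1 / x)) (at x)"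
    using assms by (intro has_vector_derivative_mult_right has_vector_derivative_of_real)
      (auto intro!: derivative_eq_intros simp flip: has_real_derivative_iff_has_vector_derivative)
  then have "((\<lambda>x. exp (z * of_real (ln x)) * (1 / z)) has_vector_derivative (z * of_real (1 / x) * exp (z * of_real (ln x))) * (1 / z)) (at x)"
    by (intro has_vector_derivative_mult_left field_vector_diff_chain_at[of "\<lambda>x. z * of_real (ln x)" _ _ exp, unfolded o_def])
      (auto intro!: derivative_eq_intros)
  moreover have "z * of_real (1 / x) * exp (z * of_real (ln x)) * (1 / z) = exp ((z - 1) * of_real (ln x))"
  proof -
    have "exp ((z - 1) * of_real (ln x)) = exp (z * of_real (ln x)) / exp (of_real (ln x))"
      by (simp add: left_diff_distrib exp_diff)
    also have "exp (complex_of_real (ln x)) = of_real x" using assms by (simp add: exp_of_real)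
    finally show ?thesis using assms by simp
  qed
  ultimately show ?thesis by simp
qed

text \<open>
  \<open>exp ((z - 1) * ln x)\<close> stands for \<open>x powr (z - 1)\<close>; its primitive is \<open>exp (z * ln x) / z\<close>, and the same
  primitive with \<open>Re z\<close> for \<open>z\<close> gives absolute convergence. The end points are extended reals, so that
  \<open>(0,1)\<close> and \<open>(1,\<infinity>)\<close> are both covered.
\<close>

lemma power_integral_einterval:
  fixes a b :: ereal
  assumes ab: "0 \<le> a" "a < b" and z: "Re z \<noteq> 0"
    and A: "((\<lambda>x. exp (Re z * ln x) / Re z) \<longlongrightarrow> A) (filtermap real_of_ereal (at_right a))"
    and B: "((\<lambda>x. exp (Re z * ln x) / Re z) \<longlongrightarrow> B) (filtermap real_of_ereal (at_left b))"
    and A': "((\<lambda>x. exp (z * of_real (ln x)) / z) \<longlongrightarrow> A') (filtermap real_of_ereal (at_right a))"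
    and B': "((\<lambda>x. exp (z * of_real (ln x)) / z) \<longlongrightarrow> B') (filtermap real_of_ereal (at_left b))"
  shows "integrable lborel (\<lambda>x. indicator (einterval a b) x *\<^sub>R exp ((z - 1) * of_real (ln x)))"
    "(LINT x|lborel. indicator (einterval a b) x *\<^sub>R exp ((z - 1) * of_real (ln x))) = B' - A'"
proof -
  define r where "r = Re z"
  have z0: "z \<noteq> 0" and r: "r \<noteq> 0" using z by (auto simp: r_def)
  have pos: "x > 0" if "a < ereal x" for x using le_less_trans[OF ab(1) that] by simp
  have si: "set_integrable lborel (einterval a b) (\<lambda>x. exp ((r - 1) * ln x))"
  proof (rule interval_integral_FTC_nonneg[OF ab(2), where F = "\<lambda>x. exp (r * ln x) / r" and A = A and B = B])
    fix x assume x: "a < ereal x" "ereal x < b"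
    note x = pos[OF x(1)]
    have "((\<lambda>x. exp (r * ln x) / r) has_real_derivative exp (r * ln x) / x) (at x)"
      using x r by (auto intro!: derivative_eq_intros)
    moreover have "exp (r * ln x) / x = exp ((r - 1) * ln x)"
      using x by (simp add: left_diff_distrib exp_diff)
    ultimately show "((\<lambda>x. exp (r * ln x) / r) has_real_derivative exp ((r - 1) * ln x)) (at x)" by simp
    show "isCont (\<lambda>x. exp ((r - 1) * ln x)) x" using x by (intro continuous_intros) auto
  qed (use A B in \<open>simp_all add: r_def filterlim_filtermap comp_def\<close>)
  have cont: "continuous_on (einterval a b) (\<lambda>x. exp ((z - 1) * of_real (ln x)))"
    by (intro continuous_intros) (auto simp: einterval_iff dest: pos)
  have meas: "(\<lambda>x. indicator (einterval a b) x *\<^sub>R exp ((z - 1) * of_real (ln x))) \<in> borel_measurable lborel"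
    using borel_measurable_continuous_on_indicator[OF _ cont] by simp
  show int: "integrable lborel (\<lambda>x. indicator (einterval a b) x *\<^sub>R exp ((z - 1) * of_real (ln x)))"
    using si[unfolded set_integrable_def] meas
    by (rule Bochner_Integration.integrable_bound) (auto simp: indicator_def r_def)
  have "(LBINT x=a..b. exp ((z - 1) * of_real (ln x))) = B' - A'"
  proof (rule interval_integral_FTC_integrable[OF ab(2), where F = "\<lambda>x. exp (z * of_real (ln x)) / z"])
    fix x assume "a < ereal x" "ereal x < b"
    note x = pos[OF this(1)]
    show "((\<lambda>x. exp (z * of_real (ln x)) / z) has_vector_derivative exp ((z - 1) * of_real (ln x))) (at x)"
      using x z0 by (rule exp_ln_has_derivative)
    show "isCont (\<lambda>x. exp ((z - 1) * of_real (ln x))) x" using x by (intro continuous_intros) auto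
  qed (use int A' B' in \<open>simp_all add: set_integrable_def filterlim_filtermap comp_def\<close>)
  then show "(LINT x|lborel. indicator (einterval a b) x *\<^sub>R exp ((z - 1) * of_real (ln x))) = B' - A'"
    using less_imp_le[OF ab(2)] by (simp add: interval_lebesgue_integral_def set_lebesgue_integral_def)
qed

lemma tendsto_exp_ln_at_one:
  assumes "z \<noteq> 0"
  shows "((\<lambda>x. exp (z * of_real (ln x)) / z) \<longlongrightarrow> 1 / (z :: 'a :: {real_normed_field, banach})) (at 1 within S)"
proof -
  have "((\<lambda>x. exp (z * of_real (ln x)) / z) \<longlongrightarrow> exp (z * of_real (ln 1)) / z) (at (1::real) within S)"
    using assms by (intro tendsto_intros) auto
  then show ?thesis by simp
qed

lemma tendsto_exp_ln_zero:
  assumes "filterlim (\<lambda>x. Re z * ln x) at_bot F" "Re z \<noteq> 0"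
  shows "((\<lambda>x. exp (Re z * ln x) / Re z) \<longlongrightarrow> 0) F" "((\<lambda>x. exp (z * of_real (ln x)) / z) \<longlongrightarrow> 0) F"
proof -
  have lim: "((\<lambda>x. exp (Re z * ln x)) \<longlongrightarrow> 0) F" using assms(1) by (rule filterlim_compose[OF exp_at_bot])
  have z0: "z \<noteq> 0" using assms(2) by auto
  show "((\<lambda>x. exp (Re z * ln x) / Re z) \<longlongrightarrow> 0) F"
    using tendsto_divide[OF lim tendsto_const assms(2)] by simp
  have "((\<lambda>x. norm (exp (z * of_real (ln x)) / z)) \<longlongrightarrow> 0) F"
    using tendsto_divide[OF lim tendsto_const, of "norm z"] z0 by (simp add: norm_divide)
  then show "((\<lambda>x. exp (z * of_real (ln x)) / z) \<longlongrightarrow> 0) F" by (rule tendsto_norm_zero_cancel)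
qed

lemma power_integral_01:
  assumes z: "Re z > 0"
  shows "integrable lborel (\<lambda>x. indicator {0<..<1} x *\<^sub>R exp ((z - 1) * of_real (ln x)))"
    "(LINT x|lborel. indicator {0<..<1} x *\<^sub>R exp ((z - 1) * of_real (ln x))) = 1 / z"
proof -
  have ei: "einterval 0 1 = {0<..<1::real}" by (auto simp: einterval_iff zero_ereal_def one_ereal_def)
  have z0: "z \<noteq> 0" "Re z \<noteq> 0" using z by auto
  have "filterlim (\<lambda>x. Re z * ln x) at_bot (at_right (0::real))"
    using z by (intro filterlim_tendsto_pos_mult_at_bot[OF tendsto_const] ln_at_0)
  note lim0 = tendsto_exp_ln_zero[OF this z0(2)]
  have flt: "filtermap real_of_ereal (at_right 0) = at_right 0" "filtermap real_of_ereal (at_left 1) = at_left 1"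
    unfolding zero_ereal_def one_ereal_def at_right_ereal at_left_ereal
    by (simp_all add: filtermap_filtermap)
  note I = power_integral_einterval[of 0 1 z 0 "1 / Re z" 0 "1 / z", unfolded flt ei]
  show "integrable lborel (\<lambda>x. indicator {0<..<1} x *\<^sub>R exp ((z - 1) * of_real (ln x)))"
    "(LINT x|lborel. indicator {0<..<1} x *\<^sub>R exp ((z - 1) * of_real (ln x))) = 1 / z"
    using I lim0 tendsto_exp_ln_at_one[OF z0(1)] tendsto_exp_ln_at_one[OF z0(2)] z0 by simp_all
qed

lemma power_integral_1_inf:
  assumes z: "Re z < 0"
  shows "integrable lborel (\<lambda>x. indicator {1..} x *\<^sub>R exp ((z - 1) * of_real (ln x)))"
    "(LINT x|lborel. indicator {1..} x *\<^sub>R exp ((z - 1) * of_real (ln x))) = - 1 / z"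
proof -
  have ei: "einterval 1 \<infinity> = {(1::real)<..}" by (auto simp: einterval_iff one_ereal_def)
  have z0: "z \<noteq> 0" "Re z \<noteq> 0" using z by auto
  have "filterlim (\<lambda>x. Re z * ln x) at_bot at_top"
    using z by (intro filterlim_tendsto_neg_mult_at_bot[OF tendsto_const] ln_at_top)
  note lim0 = tendsto_exp_ln_zero[OF this z0(2)]
  have flt: "filtermap real_of_ereal (at_right 1) = at_right 1" "filtermap real_of_ereal (at_left \<infinity>) = at_top"
    unfolding one_ereal_def at_right_ereal at_left_PInf by (simp_all add: filtermap_filtermap)
  note I = power_integral_einterval[of 1 \<infinity> z "1 / Re z" 0 "1 / z" 0, unfolded flt ei]
  have int: "integrable lborel (\<lambda>x. indicator {(1::real)<..} x *\<^sub>R exp ((z - 1) * of_real (ln x)))"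
    and val: "(LINT x|lborel. indicator {(1::real)<..} x *\<^sub>R exp ((z - 1) * of_real (ln x))) = - 1 / z"
    using I lim0 tendsto_exp_ln_at_one[OF z0(1)] tendsto_exp_ln_at_one[OF z0(2)] z0 by simp_all
  have ae: "AE x in lborel. indicator {1<..} x *\<^sub>R exp ((z - 1) * of_real (ln x)) = indicator {1..} x *\<^sub>R exp ((z - 1) * of_real (ln x))"
    using AE_lborel_singleton[of "1::real"] by eventually_elim (auto simp: indicator_def)
  have "continuous_on {(1::real)..} (\<lambda>x. exp ((z - 1) * of_real (ln x)))"
    by (intro continuous_intros) auto
  then have meas: "(\<lambda>x. indicator {(1::real)..} x *\<^sub>R exp ((z - 1) * of_real (ln x))) \<in> borel_measurable lborel"
    using borel_measurable_continuous_on_indicator[of "{(1::real)..}"] by simp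
  show "integrable lborel (\<lambda>x. indicator {1..} x *\<^sub>R exp ((z - 1) * of_real (ln x)))"
    using integrable_cong_AE[OF borel_measurable_integrable[OF int] meas ae] int by simp
  show "(LINT x|lborel. indicator {1..} x *\<^sub>R exp ((z - 1) * of_real (ln x))) = - 1 / z"
    using integral_cong_AE[OF borel_measurable_integrable[OF int] meas ae] val by simp
qed

text \<open>
  Fubini's theorem moves the integral over \<open>x \<in> S\<close> inside, where it becomes the elementary
  integral \<open>J\<close>. The set \<open>S\<close> will be \<open>(0,1)\<close> or \<open>[1,\<infinity>)\<close>.
\<close>

lemma phase_kernel_Mellin_piece:
  fixes S :: "real set"
  assumes c: "max (-\<alpha>) 0 < c" "c < 1/2" and S: "S \<in> sets borel" "S \<subseteq> {0<..}"
    and J: "\<And>z. Re z = Re s - c \<Longrightarrow> integrable lborel (\<lambda>x. indicator S x *\<^sub>R exp ((z - 1) * of_real (ln x)))"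
      "\<And>z. Re z = Re s - c \<Longrightarrow> (LINT x|lborel. indicator S x *\<^sub>R exp ((z - 1) * of_real (ln x))) = J z"
  shows "integrable lborel (\<lambda>x. indicator S x *\<^sub>R (of_real (x powr (- c)) * phase_kernel \<alpha> c x \<tau> * exp ((s - 1) * of_real (ln x))))"
    "(LINT x|lborel. indicator S x *\<^sub>R (of_real (x powr (- c)) * phase_kernel \<alpha> c x \<tau> * exp ((s - 1) * of_real (ln x))))
     = (LINT t|lborel. real_symbol \<alpha> \<tau> (Complex c t) * J (s - Complex c t)) / (2 * of_real pi)"
proof -
  define f where "f x t = real_symbol \<alpha> \<tau> (Complex c t) * (indicator S x *\<^sub>R exp ((s - Complex c t - 1) * of_real (ln x)))" for x t :: real
  have split: "indicator S x *\<^sub>R (of_real (x powr (- c)) * phase_kernel \<alpha> c x \<tau> * exp ((s - 1) * of_real (ln x)))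
      = (LINT t|lborel. f x t) / (2 * of_real pi)" for x
  proof (cases "x \<in> S")
    case True
    then have x: "x > 0" using S by auto
    have "f x t = of_real (x powr (- c)) * exp ((s - 1) * of_real (ln x)) * (real_symbol \<alpha> \<tau> (Complex c t) * exp (- (\<i> * of_real (t * ln x))))" for t
    proof -
      have "(s - Complex c t - 1) * of_real (ln x) = of_real (- c * ln x) + (s - 1) * of_real (ln x) + (- (\<i> * of_real (t * ln x)))"
        by (simp add: complex_eq_iff algebra_simps)
      then have "exp ((s - Complex c t - 1) * of_real (ln x)) = of_real (x powr (- c)) * exp ((s - 1) * of_real (ln x)) * exp (- (\<i> * of_real (t * ln x)))"
        using x by (simp only: exp_add exp_of_real) (simp add: powr_def)
      then show ?thesis using True by (simp add: f_def)
    qed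
    then have "(LINT t|lborel. f x t) = of_real (x powr (- c)) * exp ((s - 1) * of_real (ln x)) *
        (LINT t|lborel. real_symbol \<alpha> \<tau> (Complex c t) * exp (- (\<i> * of_real (t * ln x))))"
      by simp
    then show ?thesis using True by (simp add: phase_kernel_def)
  qed (simp add: f_def)
  have fint: "integrable (lborel \<Otimes>\<^sub>M lborel) (case_prod f)"
  proof (rule lborel_pair.integrable_product_bound)
    show "integrable lborel (\<lambda>x. norm (indicator S x *\<^sub>R exp ((of_real (Re s - c) - 1) * complex_of_real (ln x))))"
      by (intro integrable_norm J(1)) simp
    show "integrable lborel (\<lambda>t. norm (real_symbol \<alpha> \<tau> (Complex c t)))"
      by (intro integrable_norm integrable_real_symbol[OF c])
    show "norm (case_prod f (x, t)) \<le> norm (indicator S x *\<^sub>R exp ((of_real (Re s - c) - 1) * complex_of_real (ln x))) * norm (real_symbol \<alpha> \<tau> (Complex c t))" for x t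
      by (simp add: f_def norm_mult)
    have "continuous_on UNIV (\<lambda>t. real_symbol \<alpha> \<tau> (Complex c t))"
      by (intro continuous_on_real_symbol[OF c] continuous_intros)
    then have cm: "(\<lambda>t. real_symbol \<alpha> \<tau> (Complex c t)) \<in> borel_measurable borel"
      by (rule borel_measurable_continuous_onI)
    define r where "r t = real_symbol \<alpha> \<tau> (Complex c t)" for t
    have [measurable]: "r \<in> borel_measurable borel" using cm unfolding r_def .
    have [measurable]: "S \<in> sets borel" by (rule S(1))
    have "(\<lambda>p. r (snd p) * (indicator S (fst p) *\<^sub>R exp ((s - (of_real c + \<i> * of_real (snd p)) - 1) * of_real (ln (fst p)))))
        \<in> borel_measurable (lborel \<Otimes>\<^sub>M lborel)"
      by measurable
    then show "case_prod f \<in> borel_measurable (lborel \<Otimes>\<^sub>M lborel)"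
      unfolding f_def[abs_def] r_def Complex_eq case_prod_beta' .
  qed
  show "integrable lborel (\<lambda>x. indicator S x *\<^sub>R (of_real (x powr (- c)) * phase_kernel \<alpha> c x \<tau> * exp ((s - 1) * of_real (ln x))))"
    unfolding split by (intro integrable_divide lborel_pair.integrable_fst[OF fint])
  have "(LINT x|lborel. LINT t|lborel. f x t) = (LINT t|lborel. LINT x|lborel. f x t)"
    by (rule lborel_pair.Fubini_integral[OF fint, symmetric])
  also have "\<dots> = (LINT t|lborel. real_symbol \<alpha> \<tau> (Complex c t) * J (s - Complex c t))"
  proof (rule Bochner_Integration.integral_cong[OF refl])
    fix t
    show "(LINT x|lborel. f x t) = real_symbol \<alpha> \<tau> (Complex c t) * J (s - Complex c t)"
      unfolding f_def integral_mult_right_zero by (subst J(2)) simp_all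
  qed
  finally show "(LINT x|lborel. indicator S x *\<^sub>R (of_real (x powr (- c)) * phase_kernel \<alpha> c x \<tau> * exp ((s - 1) * of_real (ln x))))
     = (LINT t|lborel. real_symbol \<alpha> \<tau> (Complex c t) * J (s - Complex c t)) / (2 * of_real pi)"
    unfolding split by simp
qed

lemma real_symbol_decay:
  assumes l: "0 < l" "u < 1"
  shows "\<exists>C T. \<forall>s. l \<le> Re s \<and> Re s \<le> u \<and> \<bar>Im s\<bar> \<ge> T \<longrightarrow> norm (real_symbol \<alpha> \<tau> s) \<le> C * exp (- \<bar>Im s\<bar>)"
proof -
  obtain C1 T1 where 1: "\<And>s. l \<le> Re s \<Longrightarrow> Re s \<le> u \<Longrightarrow> \<bar>Im s\<bar> \<ge> T1 \<Longrightarrow> norm (KI_symbol \<alpha> \<tau> s) \<le> C1 * exp (- \<bar>Im s\<bar>)"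
    using KI_symbol_decay[of l u \<alpha> \<tau>] by blast
  obtain C2 T2 where 2: "\<And>s. l \<le> Re s \<Longrightarrow> Re s \<le> u \<Longrightarrow> \<bar>Im s\<bar> \<ge> T2 \<Longrightarrow> norm (KI_symbol \<alpha> (- \<tau>) s) \<le> C2 * exp (- \<bar>Im s\<bar>)"
    using KI_symbol_decay[of l u \<alpha> "- \<tau>"] by blast
  have "norm (real_symbol \<alpha> \<tau> s) \<le> (C1 + C2) / 2 * exp (- \<bar>Im s\<bar>)"
    if s: "l \<le> Re s" "Re s \<le> u" "\<bar>Im s\<bar> \<ge> max T1 T2" for s
  proof -
    have "norm (real_symbol \<alpha> \<tau> s) = norm (KI_symbol \<alpha> \<tau> s + KI_symbol \<alpha> (- \<tau>) s) / 2"
      using s l by (subst KI_symbol_average[symmetric]) (auto simp: norm_divide)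
    also have "\<dots> \<le> (norm (KI_symbol \<alpha> \<tau> s) + norm (KI_symbol \<alpha> (- \<tau>) s)) / 2"
      by (intro divide_right_mono norm_triangle_ineq) auto
    also have "\<dots> \<le> (C1 * exp (- \<bar>Im s\<bar>) + C2 * exp (- \<bar>Im s\<bar>)) / 2"
      using s by (intro divide_right_mono add_mono 1 2) auto
    finally show ?thesis by (simp add: distrib_right)
  qed
  then show ?thesis by blast
qed

text \<open>
  For \<open>x > 0\<close> and \<open>\<tau> \<noteq> 0\<close> this is \<open>Re (K\<^sub>\<mu>(sqrt x) * I\<^sub>\<nu>(sqrt x))\<close>, for any two lines
  \<open>c\<close> and \<open>d\<close> in the strip \<open>max (-\<alpha>) 0 < Re s < 1/2\<close>. Two lines are used so that the bounds \<open>x powr (-c)\<close> near \<open>0\<close> and \<open>x powr (-d)\<close> near infinity make the Mellin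
  integral converge absolutely at abscissas between \<open>c\<close> and \<open>d\<close>.
\<close>

definition split_kernel :: "real \<Rightarrow> real \<Rightarrow> real \<Rightarrow> real \<Rightarrow> real \<Rightarrow> complex" where
  "split_kernel \<alpha> c d x \<tau> = indicator {0<..<1} x *\<^sub>R (of_real (x powr (- c)) * phase_kernel \<alpha> c x \<tau>)
     + indicator {1..} x *\<^sub>R (of_real (x powr (- d)) * phase_kernel \<alpha> d x \<tau>)"

text \<open>
  Integrating \<open>x powr (s - w - 1)\<close> over \<open>(0,1)\<close> gives \<open>1 / (s - w)\<close>, and over \<open>[1,\<infinity>)\<close> gives \<open>1 / (w - s)\<close>. The two
  pieces are therefore Cauchy integrals of the symbol along \<open>Re w = c\<close> and \<open>Re w = d\<close>, and their sum is
  the residue at the pole \<open>w = s\<close> between the lines.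
\<close>

lemma split_kernel_Mellin:
  assumes c: "max (-\<alpha>) 0 < c" "c < Re s" and d: "Re s < d" "d < 1/2"
  shows "(LINT x|lborel. split_kernel \<alpha> c d x \<tau> * exp ((s - 1) * of_real (ln x))) = real_symbol \<alpha> \<tau> s"
proof -
  have c': "c < 1/2" and d': "max (-\<alpha>) 0 < d" using c d by auto
  note A = phase_kernel_Mellin_piece[OF c(1) c', of "{0<..<1}" s "\<lambda>z. 1 / z" \<tau>, OF _ _ power_integral_01]
  note B = phase_kernel_Mellin_piece[OF d' d(2), of "{1..}" s "\<lambda>z. - 1 / z" \<tau>, OF _ _ power_integral_1_inf]
  have "(LINT x|lborel. split_kernel \<alpha> c d x \<tau> * exp ((s - 1) * of_real (ln x))) =
      (LINT x|lborel. indicator {0<..<1} x *\<^sub>R (of_real (x powr (- c)) * phase_kernel \<alpha> c x \<tau> * exp ((s - 1) * of_real (ln x)))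
      + indicator {1..} x *\<^sub>R (of_real (x powr (- d)) * phase_kernel \<alpha> d x \<tau> * exp ((s - 1) * of_real (ln x))))"
    by (simp add: split_kernel_def distrib_right)
  also have "\<dots> = (LINT t|lborel. real_symbol \<alpha> \<tau> (Complex c t) * (1 / (s - Complex c t))) / (2 * of_real pi)
     + (LINT t|lborel. real_symbol \<alpha> \<tau> (Complex d t) * (- 1 / (s - Complex d t))) / (2 * of_real pi)"
    using A B c d by (subst Bochner_Integration.integral_add) (auto simp: subset_eq)
  also have "(LINT t|lborel. real_symbol \<alpha> \<tau> (Complex c t) * (1 / (s - Complex c t))) =
      - (LINT t|lborel. real_symbol \<alpha> \<tau> (Complex c t) / (Complex c t - s))"
  proof -
    have "real_symbol \<alpha> \<tau> (Complex c t) * (1 / (s - Complex c t)) = - (real_symbol \<alpha> \<tau> (Complex c t) / (Complex c t - s))" for t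
      by (metis divide_minus_right minus_diff_eq mult.right_neutral times_divide_eq_right)
    then show ?thesis by simp
  qed
  also have "(LINT t|lborel. real_symbol \<alpha> \<tau> (Complex d t) * (- 1 / (s - Complex d t))) =
      (LINT t|lborel. real_symbol \<alpha> \<tau> (Complex d t) / (Complex d t - s))"
  proof -
    have "real_symbol \<alpha> \<tau> (Complex d t) * (- 1 / (s - Complex d t)) = real_symbol \<alpha> \<tau> (Complex d t) / (Complex d t - s)" for t
      by (metis divide_minus_left minus_diff_eq minus_divide_right mult.right_neutral times_divide_eq_right)
    then show ?thesis by simp
  qed
  also have "- (LINT t|lborel. real_symbol \<alpha> \<tau> (Complex c t) / (Complex c t - s)) / (2 * of_real pi) +
      (LINT t|lborel. real_symbol \<alpha> \<tau> (Complex d t) / (Complex d t - s)) / (2 * of_real pi) =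
      ((LINT t|lborel. real_symbol \<alpha> \<tau> (Complex d t) / (Complex d t - s))
       - (LINT t|lborel. real_symbol \<alpha> \<tau> (Complex c t) / (Complex c t - s))) / (2 * of_real pi)"
    by (simp add: diff_divide_distrib)
  also have "(LINT t|lborel. real_symbol \<alpha> \<tau> (Complex d t) / (Complex d t - s))
       - (LINT t|lborel. real_symbol \<alpha> \<tau> (Complex c t) / (Complex c t - s)) =
       2 * of_real pi * (\<Sum>p\<in>{s}. residue (\<lambda>w. real_symbol \<alpha> \<tau> w / (w - s)) p)"
  proof -
    define S where "S = {w. max (-\<alpha>) 0 < Re w} \<inter> {w. Re w < 1/2}"
    have openS: "open S" unfolding S_def by (intro open_Int open_halfspace_Re_gt open_halfspace_Re_lt)
    have holo: "real_symbol \<alpha> \<tau> holomorphic_on S"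
      unfolding real_symbol_def[abs_def] core_symbol_def
      by (intro holomorphic_intros) (auto elim!: nonpos_Ints_cases simp: S_def complex_eq_iff)
    obtain C T where CT: "\<And>w. c \<le> Re w \<Longrightarrow> Re w \<le> d \<Longrightarrow> \<bar>Im w\<bar> \<ge> T \<Longrightarrow> norm (real_symbol \<alpha> \<tau> w) \<le> C * exp (- \<bar>Im w\<bar>)"
      using real_symbol_decay[of c d \<alpha> \<tau>] c d by auto
    show ?thesis
    proof (rule vertical_line_shift[where S = S and T = "max T (\<bar>Im s\<bar> + 1)" and C = C and c = 1])
      show "open S" by (rule openS)
      show "connected S" unfolding S_def
        by (intro convex_connected convex_Int convex_halfspace_Re_gt convex_halfspace_Re_lt)
      show "(\<lambda>w. real_symbol \<alpha> \<tau> w / (w - s)) holomorphic_on S - {s}"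
        by (intro holomorphic_intros holomorphic_on_subset[OF holo]) auto
      fix w assume w: "c \<le> Re w" "Re w \<le> d" "max T (\<bar>Im s\<bar> + 1) \<le> \<bar>Im w\<bar>"
      have "\<bar>Im s\<bar> + 1 \<le> \<bar>Im w\<bar>" using w by simp
      then have "1 \<le> norm (w - s)"
        using abs_Im_le_cmod[of "w - s"] unfolding minus_complex.sel by linarith
      then have "norm (real_symbol \<alpha> \<tau> w / (w - s)) \<le> norm (real_symbol \<alpha> \<tau> w) / 1"
        unfolding norm_divide by (intro divide_left_mono) auto
      also have "\<dots> \<le> C * exp (- \<bar>Im w\<bar>)" using CT[of w] w by simp
      finally show "norm (real_symbol \<alpha> \<tau> w / (w - s)) \<le> C * exp (- 1 * \<bar>Im w\<bar>)" by simp
    qed (use c d in \<open>auto simp: S_def\<close>)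
  qed
  also have "(\<Sum>p\<in>{s}. residue (\<lambda>w. real_symbol \<alpha> \<tau> w / (w - s)) p) = real_symbol \<alpha> \<tau> s"
  proof -
    define S where "S = {w. max (-\<alpha>) 0 < Re w} \<inter> {w. Re w < 1/2}"
    have "real_symbol \<alpha> \<tau> holomorphic_on S"
      unfolding real_symbol_def[abs_def] core_symbol_def
      by (intro holomorphic_intros) (auto elim!: nonpos_Ints_cases simp: S_def complex_eq_iff)
    moreover have "open S" unfolding S_def by (intro open_Int open_halfspace_Re_gt open_halfspace_Re_lt)
    ultimately show ?thesis using c d by (simp add: residue_simple S_def)
  qed
  finally show ?thesis by simp
qed

section \<open>The index transform\<close>

lemma sigma_finite_lebesgue: "sigma_finite_measure (lebesgue :: real measure)"
proof
  show "\<exists>A. countable A \<and> A \<subseteq> sets (lebesgue :: real measure) \<and> \<Union> A = space lebesgue \<and> (\<forall>a\<in>A. emeasure lebesgue a \<noteq> \<infinity>)"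
  proof (intro exI[of _ "range (\<lambda>n::nat. {- real n..real n})"] conjI)
    show "\<Union> (range (\<lambda>n::nat. {- real n..real n})) = space lebesgue"
    proof -
      have "\<exists>n::nat. - real n \<le> x \<and> x \<le> real n" for x :: real
      proof -
        obtain n :: nat where "\<bar>x\<bar> \<le> n" using real_arch_simple by blast
        then show ?thesis by (intro exI[of _ n]) auto
      qed
      then show ?thesis by auto
    qed
  qed auto
qed

text \<open>
  The formulas for the kernels hold for \<open>\<tau> \<noteq> 0\<close> only: at \<open>\<tau> = 0\<close> the order of \<open>K\<close> may be an integer, where \<open>K\<close>
  is a limit and the two families of poles may coincide.
\<close>

lemma lebesgue_cong_except_zero:
  fixes F G :: "real \<Rightarrow> complex"
  assumes F: "integrable lebesgue F" and eq: "\<And>\<tau>. \<tau> \<noteq> 0 \<Longrightarrow> G \<tau> = F \<tau>"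
  shows "integrable lebesgue G" "(LINT \<tau>|lebesgue. G \<tau>) = (LINT \<tau>|lebesgue. F \<tau>)"
proof -
  have G: "G = (\<lambda>\<tau>. if \<tau> \<in> {0} then G 0 else F \<tau>)" using eq by auto
  have "(\<lambda>\<tau>. if \<tau> \<in> {0} then G 0 else F \<tau>) \<in> borel_measurable lebesgue"
    using F by (intro measurable_If_set) auto
  then have Gm: "G \<in> borel_measurable lebesgue" using G by simp
  have ae: "AE \<tau> in lebesgue. G \<tau> = F \<tau>"
    using AE_completion[OF AE_lborel_singleton[of "0::real"]] eq by (auto elim: eventually_mono)
  show "integrable lebesgue G" using integrable_cong_AE[OF Gm _ ae] F by auto
  show "(LINT \<tau>|lebesgue. G \<tau>) = (LINT \<tau>|lebesgue. F \<tau>)" using integral_cong_AE[OF Gm _ ae] F by auto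
qed

lemma weighted_L1_UNIV:
  assumes "g \<in> weighted_L1 UNIV W"
  shows "g \<in> borel_measurable lebesgue" "integrable lebesgue (\<lambda>x. norm (g x) * W x)"
    "weighted_L1_norm UNIV W g = (LINT x|lebesgue. norm (g x) * W x)"
  using assms by (simp_all add: weighted_L1_def weighted_L1_norm_def set_borel_measurable_def set_integrable_def
      set_lebesgue_integral_def)

lemma phase_kernel_lebesgue_measurable:
  assumes c: "max (-\<alpha>) 0 < c" "c < 1/2"
  shows "(\<lambda>\<tau>. phase_kernel \<alpha> c x \<tau>) \<in> borel_measurable lebesgue"
proof (rule measurable_completion)
  have "(\<lambda>\<tau>. phase_kernel \<alpha> c (fst (x, \<tau>)) (snd (x, \<tau>))) \<in> borel_measurable borel"
    by (rule measurable_compose[OF _ phase_kernel_measurable[OF c]]) simp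
  then show "(\<lambda>\<tau>. phase_kernel \<alpha> c x \<tau>) \<in> borel_measurable lborel" by simp
qed

lemma G_integrand_eq_phase_kernel:
  assumes "\<alpha> > -1/2" "max (-\<alpha>) 0 < c" "c < 1/2" "\<tau> \<noteq> 0" "x > 0"
  shows "G_integrand \<alpha> g x \<tau> = of_real (x powr (- c)) * (phase_kernel \<alpha> c x \<tau> * (g \<tau> / of_real (cosh (pi * \<tau>))))"
  unfolding G_integrand_def bessel_product_eq_phase_kernel[OF assms] by simp

text \<open>
  On the line \<open>c = 1/4\<close> the kernel is \<open>x powr (-1/4)\<close> times a function that is continuous in \<open>x\<close> and
  bounded uniformly in \<open>x\<close> and \<open>\<tau>\<close>, so all claims follow by dominated convergence.
\<close>

lemma G_transform_uniform_bound:
  assumes al: "\<alpha> > -1/4"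
  shows "\<exists>C>0. \<forall>g \<in> weighted_L1 UNIV (\<lambda>\<tau>. inverse (cosh (pi * \<tau>))).
        (\<forall>x>0. integrable lebesgue (G_integrand \<alpha> g x)) \<and>
        bounded ((\<lambda>x. of_real (x powr (1 / 4)) * G_transform \<alpha> g x) ` {0<..}) \<and>
        continuous_on {0<..} (\<lambda>x. of_real (x powr (1 / 4)) * G_transform \<alpha> g x) \<and>
        (SUP x\<in>{0<..}. x powr (1 / 4) * norm (G_transform \<alpha> g x))
          \<le> C * weighted_L1_norm UNIV (\<lambda>\<tau>. inverse (cosh (pi * \<tau>))) g"
proof -
  have c: "max (-\<alpha>) 0 < 1/4" "1/4 < (1/2::real)" and al': "\<alpha> > -1/2" using al by auto
  obtain C where C: "C > 0" "\<And>x \<tau>. norm (phase_kernel \<alpha> (1/4) x \<tau>) \<le> C"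
    using phase_kernel_quarter_bound[OF al] by blast
  define D where "D = 2 * sqrt pi * C"
  have D: "D > 0" using C by (simp add: D_def)
  show ?thesis
  proof (intro exI[of _ D] conjI ballI D)
    fix g assume g: "g \<in> weighted_L1 UNIV (\<lambda>\<tau>. inverse (cosh (pi * \<tau>)))"
    note gm = weighted_L1_UNIV(1)[OF g] and gi = weighted_L1_UNIV(2)[OF g] and gn = weighted_L1_UNIV(3)[OF g]
    define w where "w \<tau> = g \<tau> / of_real (cosh (pi * \<tau>))" for \<tau>
    have cm: "(\<lambda>\<tau>. complex_of_real (cosh (pi * \<tau>))) \<in> borel_measurable lebesgue"
      unfolding cosh_def by (intro measurable_completion) (measurable)
    have wm: "w \<in> borel_measurable lebesgue"
      unfolding w_def[abs_def] using gm cm by measurable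
    have wn: "norm (w \<tau>) = norm (g \<tau>) * inverse (cosh (pi * \<tau>))" for \<tau>
      by (simp add: w_def norm_divide cosh_real_pos less_imp_le field_simps)
    have wi: "integrable lebesgue (\<lambda>\<tau>. norm (w \<tau>))" using gi by (simp only: wn)
    have km: "(\<lambda>\<tau>. phase_kernel \<alpha> (1/4) x \<tau> * w \<tau>) \<in> borel_measurable lebesgue" for x
      using phase_kernel_lebesgue_measurable[OF c, of x] wm by measurable
    have kle: "norm (phase_kernel \<alpha> (1/4) x \<tau> * w \<tau>) \<le> C * norm (w \<tau>)" for x \<tau>
      unfolding norm_mult using C by (intro mult_right_mono) auto
    have ki: "integrable lebesgue (\<lambda>\<tau>. phase_kernel \<alpha> (1/4) x \<tau> * w \<tau>)" for x
      using integrable_mult_right[OF wi, of C] km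
      by (rule Bochner_Integration.integrable_bound) (use kle in \<open>auto intro!: AE_I2 order_trans[OF _ abs_ge_self]\<close>)
    define H where "H x = (LINT \<tau>|lebesgue. phase_kernel \<alpha> (1/4) x \<tau> * w \<tau>)" for x
    have Gi: "integrable lebesgue (G_integrand \<alpha> g x)"
      and Gx: "of_real (x powr (1/4)) * G_transform \<alpha> g x = of_real (2 * sqrt pi) * H x" if x: "x > 0" for x
    proof -
      have Fi: "integrable lebesgue (\<lambda>\<tau>. of_real (x powr (- (1/4))) * (phase_kernel \<alpha> (1/4) x \<tau> * w \<tau>))"
        by (intro integrable_mult_right ki)
      have eq: "G_integrand \<alpha> g x \<tau> = of_real (x powr (- (1/4))) * (phase_kernel \<alpha> (1/4) x \<tau> * w \<tau>)" if "\<tau> \<noteq> 0" for \<tau>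
        unfolding w_def by (rule G_integrand_eq_phase_kernel[OF al' c that x])
      show "integrable lebesgue (G_integrand \<alpha> g x)" by (rule lebesgue_cong_except_zero(1)[OF Fi eq])
      have "(LINT \<tau>|lebesgue. G_integrand \<alpha> g x \<tau>) = of_real (x powr (- (1/4))) * H x"
        by (rule trans[OF lebesgue_cong_except_zero(2)[OF Fi eq]]) (simp_all add: H_def)
      moreover have "complex_of_real (x powr (1/4)) * of_real (x powr (- (1/4))) = 1"
      proof -
        have "x powr (1/4) * x powr (- (1/4)) = 1" using x by (simp flip: powr_add)
        then show ?thesis by (metis of_real_1 of_real_mult)
      qed
      ultimately show "of_real (x powr (1/4)) * G_transform \<alpha> g x = of_real (2 * sqrt pi) * H x"
        unfolding G_transform_def by (metis (no_types, lifting) mult.assoc mult.commute mult.left_neutral)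
    qed
    have Hle: "norm (H x) \<le> C * (LINT \<tau>|lebesgue. norm (w \<tau>))" for x
    proof -
      have "norm (H x) \<le> (LINT \<tau>|lebesgue. norm (phase_kernel \<alpha> (1/4) x \<tau> * w \<tau>))"
        unfolding H_def by (rule integral_norm_bound)
      also have "\<dots> \<le> (LINT \<tau>|lebesgue. C * norm (w \<tau>))"
        using kle by (intro integral_mono integrable_norm ki integrable_mult_right wi) auto
      finally show ?thesis by simp
    qed
    have norm_le: "norm (of_real (x powr (1/4)) * G_transform \<alpha> g x) \<le> D * weighted_L1_norm UNIV (\<lambda>\<tau>. inverse (cosh (pi * \<tau>))) g"
      if "x > 0" for x
    proof -
      have "norm (of_real (x powr (1/4)) * G_transform \<alpha> g x) = 2 * sqrt pi * norm (H x)"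
        unfolding Gx[OF that] by (simp add: norm_mult)
      also have "\<dots> \<le> 2 * sqrt pi * (C * (LINT \<tau>|lebesgue. norm (w \<tau>)))"
        by (intro mult_left_mono Hle) auto
      finally show ?thesis unfolding gn by (simp add: D_def wn mult.assoc)
    qed
    show "\<forall>x>0. integrable lebesgue (G_integrand \<alpha> g x)" using Gi by blast
    show "bounded ((\<lambda>x. of_real (x powr (1 / 4)) * G_transform \<alpha> g x) ` {0<..})"
      unfolding bounded_iff using norm_le by blast
    show "continuous_on {0<..} (\<lambda>x. of_real (x powr (1 / 4)) * G_transform \<alpha> g x)"
    proof -
      have "continuous_on {0<..} H"
      proof (rule continuous_on_sequentiallyI)
        fix X :: "nat \<Rightarrow> real" and x assume X: "\<forall>n. X n \<in> {0<..}" "x \<in> {0<..}" "X \<longlonglongrightarrow> x"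
        show "(\<lambda>n. H (X n)) \<longlonglongrightarrow> H x"
          unfolding H_def
        proof (rule integral_dominated_convergence)
          show "integrable lebesgue (\<lambda>\<tau>. C * norm (w \<tau>))" by (intro integrable_mult_right wi)
          show "AE \<tau> in lebesgue. (\<lambda>n. phase_kernel \<alpha> (1/4) (X n) \<tau> * w \<tau>) \<longlonglongrightarrow> phase_kernel \<alpha> (1/4) x \<tau> * w \<tau>"
          proof (intro AE_I2 tendsto_mult tendsto_const)
            fix \<tau>
            show "(\<lambda>n. phase_kernel \<alpha> (1/4) (X n) \<tau>) \<longlonglongrightarrow> phase_kernel \<alpha> (1/4) x \<tau>"
              using continuous_on_tendsto_compose[OF phase_kernel_continuous[OF c] X(3,2)] X(1) by simp
          qed
          show "AE \<tau> in lebesgue. norm (phase_kernel \<alpha> (1/4) (X n) \<tau> * w \<tau>) \<le> C * norm (w \<tau>)" for n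
            by (intro AE_I2 kle)
        qed (rule km)+
      qed
      then have "continuous_on {0<..} (\<lambda>x. of_real (2 * sqrt pi) * H x)" by (intro continuous_intros)
      then show ?thesis by (rule continuous_on_cong[THEN iffD1, rotated 2]) (use Gx in auto)
    qed
    show "(SUP x\<in>{0<..}. x powr (1 / 4) * norm (G_transform \<alpha> g x)) \<le> D * weighted_L1_norm UNIV (\<lambda>\<tau>. inverse (cosh (pi * \<tau>))) g"
    proof (rule cSUP_least)
      fix x :: real assume "x \<in> {0<..}"
      then show "x powr (1 / 4) * norm (G_transform \<alpha> g x) \<le> D * weighted_L1_norm UNIV (\<lambda>\<tau>. inverse (cosh (pi * \<tau>))) g"
        using norm_le[of x] by (simp add: norm_mult)
    qed auto
  qed
qed

lemma split_kernel_bound: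
  assumes c: "max (-\<alpha>) 0 < c" "c < \<nu>" and d: "\<nu> < d" "d < 1/2"
  shows "\<exists>u. integrable lborel u \<and> (\<forall>x \<tau> s. Re s = \<nu> \<longrightarrow>
    norm (split_kernel \<alpha> c d x \<tau> * exp ((s - 1) * of_real (ln x))) \<le> u x * cosh (pi * \<tau>))"
proof -
  have c': "c < 1/2" and d': "max (-\<alpha>) 0 < d" using c d by auto
  obtain C where C: "C > 0" "\<And>x \<tau>. norm (phase_kernel \<alpha> c x \<tau>) \<le> C * cosh (pi * \<tau>)"
    using phase_kernel_line_bound[OF c(1) c'] by blast
  obtain D where D: "D > 0" "\<And>x \<tau>. norm (phase_kernel \<alpha> d x \<tau>) \<le> D * cosh (pi * \<tau>)"
    using phase_kernel_line_bound[OF d' d(2)] by blast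
  define p where "p x = norm (indicator {0<..<1} x *\<^sub>R exp ((of_real (\<nu> - c) - 1) * complex_of_real (ln x)))" for x
  define q where "q x = norm (indicator {1..} x *\<^sub>R exp ((of_real (\<nu> - d) - 1) * complex_of_real (ln x)))" for x
  define u where "u x = C * p x + D * q x" for x
  have "integrable lborel p" unfolding p_def using c by (intro integrable_norm power_integral_01(1)) auto
  moreover have "integrable lborel q" unfolding q_def using d by (intro integrable_norm power_integral_1_inf(1)) auto
  ultimately have "integrable lborel u" unfolding u_def by simp
  moreover have "norm (split_kernel \<alpha> c d x \<tau> * exp ((s - 1) * of_real (ln x))) \<le> u x * cosh (pi * \<tau>)" if s: "Re s = \<nu>" for x \<tau> s
  proof -
    have shift: "x powr (- b) * exp ((\<nu> - 1) * ln x) = exp ((\<nu> - b - 1) * ln x)" if "x > 0" for b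
      using that by (simp add: powr_def exp_add[symmetric] algebra_simps)
    consider "x \<le> 0" | "0 < x" "x < 1" | "1 \<le> x" by linarith
    then show ?thesis
    proof cases
      case 1
      then show ?thesis by (simp add: split_kernel_def u_def p_def q_def)
    next
      case 2
      then have "norm (split_kernel \<alpha> c d x \<tau> * exp ((s - 1) * of_real (ln x))) = norm (phase_kernel \<alpha> c x \<tau>) * (x powr (- c) * exp ((\<nu> - 1) * ln x))"
        by (simp add: split_kernel_def norm_mult s)
      also have "\<dots> \<le> (C * cosh (pi * \<tau>)) * (x powr (- c) * exp ((\<nu> - 1) * ln x))"
        by (intro mult_right_mono C) auto
      also have "\<dots> = u x * cosh (pi * \<tau>)"
        using 2 by (simp add: shift u_def p_def q_def)
      finally show ?thesis .
    next
      case 3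
      then have "norm (split_kernel \<alpha> c d x \<tau> * exp ((s - 1) * of_real (ln x))) = norm (phase_kernel \<alpha> d x \<tau>) * (x powr (- d) * exp ((\<nu> - 1) * ln x))"
        by (simp add: split_kernel_def norm_mult s)
      also have "\<dots> \<le> (D * cosh (pi * \<tau>)) * (x powr (- d) * exp ((\<nu> - 1) * ln x))"
        by (intro mult_right_mono D) auto
      also have "\<dots> = u x * cosh (pi * \<tau>)"
        using 3 by (simp add: shift u_def p_def q_def)
      finally show ?thesis .
    qed
  qed
  ultimately show ?thesis by blast
qed

lemma split_kernel_measurable:
  assumes c: "max (-\<alpha>) 0 < c" "c < 1/2" and d: "max (-\<alpha>) 0 < d" "d < 1/2"
  shows "(\<lambda>p. split_kernel \<alpha> c d (fst p) (snd p)) \<in> borel_measurable (borel \<Otimes>\<^sub>M borel)"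
proof -
  note [measurable] = phase_kernel_measurable[OF c] phase_kernel_measurable[OF d]
  show ?thesis unfolding split_kernel_def by measurable
qed

text \<open>
  The kernels are Borel functions, whereas \<open>g\<close> is only Lebesgue measurable; hence the second
  factor of the product space carries the completed measure.
\<close>

lemma measurable_borel_lebesgue_pair:
  assumes "f \<in> borel_measurable (borel \<Otimes>\<^sub>M borel)"
  shows "(f :: real \<times> real \<Rightarrow> complex) \<in> borel_measurable (lborel \<Otimes>\<^sub>M lebesgue)"
proof -
  have id: "(\<lambda>x. x) \<in> lebesgue \<rightarrow>\<^sub>M (borel :: real measure)" by (rule measurable_completion) simp
  have "fst \<in> (lborel :: real measure) \<Otimes>\<^sub>M (lebesgue :: real measure) \<rightarrow>\<^sub>M borel"
    using measurable_fst[of "lborel :: real measure" "lebesgue :: real measure"] by simp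
  moreover have "snd \<in> (lborel :: real measure) \<Otimes>\<^sub>M (lebesgue :: real measure) \<rightarrow>\<^sub>M borel"
    by (rule measurable_compose[OF measurable_snd id])
  ultimately have "(\<lambda>p. (fst p, snd p)) \<in> (lborel :: real measure) \<Otimes>\<^sub>M (lebesgue :: real measure) \<rightarrow>\<^sub>M borel \<Otimes>\<^sub>M borel"
    by (rule measurable_Pair)
  from measurable_compose[OF this assms] show ?thesis by simp
qed

text \<open>
  The kernel is bounded by \<open>cosh (\<pi> \<tau>)\<close> times an integrable function of \<open>x\<close>, and \<open>g\<close> is integrable, so the
  order of integration can be exchanged.
\<close>

lemma G_transform_Mellin:
  assumes al: "\<alpha> > -1/4" and g: "g \<in> borel_measurable lebesgue" "integrable lebesgue (\<lambda>\<tau>. norm (g \<tau>))"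
    and s: "max (-\<alpha>) 0 < Re s" "Re s < 1/2"
  shows "set_integrable lebesgue {0<..} (\<lambda>x. G_transform \<alpha> g x * of_real x powr (s - 1))"
    "mellin (G_transform \<alpha> g) s = of_real (2 * sqrt pi) *
      (LINT \<tau>|lebesgue. real_symbol \<alpha> \<tau> s * (g \<tau> / of_real (cosh (pi * \<tau>))))"
proof -
  interpret L: sigma_finite_measure "lebesgue :: real measure" by (rule sigma_finite_lebesgue)
  interpret P: pair_sigma_finite "lborel :: real measure" "lebesgue :: real measure" ..
  define \<nu> where "\<nu> = Re s"
  define c where "c = (max (-\<alpha>) 0 + \<nu>) / 2"
  define d where "d = (\<nu> + 1/2) / 2"
  have c: "max (-\<alpha>) 0 < c" "c < \<nu>" and d: "\<nu> < d" "d < 1/2" using s by (auto simp: c_def d_def \<nu>_def field_simps max_def)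
  have c': "c < 1/2" and d': "max (-\<alpha>) 0 < d" using c d by auto
  have al': "\<alpha> > -1/2" using al by simp
  define w where "w \<tau> = g \<tau> / of_real (cosh (pi * \<tau>))" for \<tau>
  have cm: "(\<lambda>\<tau>. complex_of_real (cosh (pi * \<tau>))) \<in> borel_measurable lebesgue"
    unfolding cosh_def by (intro measurable_completion) (measurable)
  have wm: "w \<in> borel_measurable lebesgue"
    unfolding w_def[abs_def] using g(1) cm by measurable
  have wn: "cosh (pi * \<tau>) * norm (w \<tau>) = norm (g \<tau>)" for \<tau>
    by (simp add: w_def norm_divide cosh_real_pos less_imp_le)
  define e where "e x = exp ((s - 1) * of_real (ln x))" for x
  obtain u where u: "integrable lborel u"
      "\<And>x \<tau>. norm (split_kernel \<alpha> c d x \<tau> * e x) \<le> u x * cosh (pi * \<tau>)"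
    using split_kernel_bound[OF c d] unfolding e_def \<nu>_def by blast
  \<comment> \<open>The integrand of the double integral; it vanishes for \<open>x \<le> 0\<close>.\<close>
  define \<Theta> where "\<Theta> x \<tau> = split_kernel \<alpha> c d x \<tau> * e x * w \<tau>" for x \<tau>
  have Tm: "case_prod \<Theta> \<in> borel_measurable (lborel \<Otimes>\<^sub>M lebesgue)"
  proof -
    have "(\<lambda>p. split_kernel \<alpha> c d (fst p) (snd p) * e (fst p)) \<in> borel_measurable (borel \<Otimes>\<^sub>M borel)"
    proof -
      note [measurable] = split_kernel_measurable[OF c(1) c' d' d(2)]
      show ?thesis unfolding e_def by measurable
    qed
    from measurable_borel_lebesgue_pair[OF this]
    have "(\<lambda>p. split_kernel \<alpha> c d (fst p) (snd p) * e (fst p)) \<in> borel_measurable (lborel \<Otimes>\<^sub>M lebesgue)" .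
    moreover have "(\<lambda>p. w (snd p)) \<in> borel_measurable (lborel \<Otimes>\<^sub>M lebesgue)"
      by (rule measurable_compose[OF measurable_snd wm])
    ultimately have "(\<lambda>p. split_kernel \<alpha> c d (fst p) (snd p) * e (fst p) * w (snd p)) \<in> borel_measurable (lborel \<Otimes>\<^sub>M lebesgue)"
      by (rule borel_measurable_times)
    then show ?thesis by (simp add: \<Theta>_def case_prod_beta')
  qed
  have Ti: "integrable (lborel \<Otimes>\<^sub>M lebesgue) (case_prod \<Theta>)"
  proof (rule P.integrable_product_bound[OF Tm u(1) g(2)])
    fix x \<tau>
    have "norm (case_prod \<Theta> (x, \<tau>)) = norm (split_kernel \<alpha> c d x \<tau> * e x) * norm (w \<tau>)"
      by (simp add: \<Theta>_def norm_mult)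
    also have "\<dots> \<le> (u x * cosh (pi * \<tau>)) * norm (w \<tau>)" by (intro mult_right_mono u) auto
    also have "\<dots> = u x * norm (g \<tau>)" by (simp only: mult.assoc wn)
    finally show "norm (case_prod \<Theta> (x, \<tau>)) \<le> u x * norm (g \<tau>)" .
  qed
  have row: "integrable lebesgue (\<lambda>\<tau>. phase_kernel \<alpha> b x \<tau> * w \<tau>)" if b: "max (-\<alpha>) 0 < b" "b < 1/2" for b x
  proof -
    obtain K where K: "K > 0" "\<And>x \<tau>. norm (phase_kernel \<alpha> b x \<tau>) \<le> K * cosh (pi * \<tau>)"
      using phase_kernel_line_bound[OF b] by blast
    have "(\<lambda>\<tau>. phase_kernel \<alpha> b x \<tau> * w \<tau>) \<in> borel_measurable lebesgue"
      using phase_kernel_lebesgue_measurable[OF b, of x] wm by measurable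
    moreover have "norm (phase_kernel \<alpha> b x \<tau> * w \<tau>) \<le> K * norm (g \<tau>)" for \<tau>
      unfolding norm_mult wn[symmetric] mult.assoc[symmetric] using K by (intro mult_right_mono) auto
    ultimately show ?thesis
      by (intro Bochner_Integration.integrable_bound[OF integrable_mult_right[OF g(2), of K]])
        (auto intro!: AE_I2 order_trans[OF _ abs_ge_self])
  qed
  have inner: "indicator {0<..} x *\<^sub>R (G_transform \<alpha> g x * of_real x powr (s - 1)) =
      of_real (2 * sqrt pi) * (LINT \<tau>|lebesgue. \<Theta> x \<tau>)" for x
  proof (cases "x > 0")
    case False
    then show ?thesis by (simp add: \<Theta>_def split_kernel_def)
  next
    case True
    have pe: "of_real x powr (s - 1) = e x" using True by (simp add: powr_def Ln_of_real e_def)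
    define b where "b = (if x < 1 then c else d)"
    have b: "max (-\<alpha>) 0 < b" "b < 1/2" using c c' d d' by (auto simp: b_def)
    have sk: "split_kernel \<alpha> c d x \<tau> = of_real (x powr (- b)) * phase_kernel \<alpha> b x \<tau>" for \<tau>
      using True by (simp add: split_kernel_def b_def)
    have "(LINT \<tau>|lebesgue. G_integrand \<alpha> g x \<tau>) = (LINT \<tau>|lebesgue. of_real (x powr (- b)) * (phase_kernel \<alpha> b x \<tau> * w \<tau>))"
      by (rule lebesgue_cong_except_zero(2)[OF integrable_mult_right[OF row[OF b]]])
        (simp add: w_def G_integrand_eq_phase_kernel[OF al' b _ True])
    moreover have "(LINT \<tau>|lebesgue. \<Theta> x \<tau>) = (LINT \<tau>|lebesgue. of_real (x powr (- b)) * (phase_kernel \<alpha> b x \<tau> * w \<tau>)) * e x"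
      unfolding \<Theta>_def sk by (simp add: mult_ac)
    ultimately show ?thesis using True by (simp add: G_transform_def pe)
  qed
  have Ii: "integrable lborel (\<lambda>x. of_real (2 * sqrt pi) * (LINT \<tau>|lebesgue. \<Theta> x \<tau>))"
    by (intro integrable_mult_right P.integrable_fst[OF Ti])
  then have Im: "(\<lambda>x. of_real (2 * sqrt pi) * (LINT \<tau>|lebesgue. \<Theta> x \<tau>)) \<in> borel_measurable lborel"
    by (rule borel_measurable_integrable)
  show "set_integrable lebesgue {0<..} (\<lambda>x. G_transform \<alpha> g x * of_real x powr (s - 1))"
    unfolding set_integrable_def inner integrable_completion[OF Im] by (rule Ii)
  have "mellin (G_transform \<alpha> g) s = (LINT x|lborel. of_real (2 * sqrt pi) * (LINT \<tau>|lebesgue. \<Theta> x \<tau>))"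
    unfolding mellin_def set_lebesgue_integral_def inner by (rule integral_completion[OF Im])
  also have "\<dots> = of_real (2 * sqrt pi) * (LINT x|lborel. LINT \<tau>|lebesgue. \<Theta> x \<tau>)" by simp
  also have "(LINT x|lborel. LINT \<tau>|lebesgue. \<Theta> x \<tau>) = (LINT \<tau>|lebesgue. LINT x|lborel. \<Theta> x \<tau>)"
    by (rule P.Fubini_integral[OF Ti, symmetric])
  also have "\<dots> = (LINT \<tau>|lebesgue. real_symbol \<alpha> \<tau> s * w \<tau>)"
  proof (rule Bochner_Integration.integral_cong[OF refl])
    fix \<tau>
    show "(LINT x|lborel. \<Theta> x \<tau>) = real_symbol \<alpha> \<tau> s * w \<tau>"
      using split_kernel_Mellin[of \<alpha> c s d \<tau>] c d unfolding \<Theta>_def e_def \<nu>_def by simp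
  qed
  finally show "mellin (G_transform \<alpha> g) s = of_real (2 * sqrt pi) *
      (LINT \<tau>|lebesgue. real_symbol \<alpha> \<tau> s * (g \<tau> / of_real (cosh (pi * \<tau>))))"
    unfolding w_def .
qed

section \<open>The inversion formula\<close>

text \<open>
  The Gamma factor of the inversion formula is the reciprocal of the \<open>\<alpha>\<close>-dependent part of the
  symbol, and the factors \<open>cosh (\<pi> \<tau>)\<close> cancel as well.
\<close>

lemma inversion_integrand_eq:
  assumes al: "\<alpha> > -1/4" and g: "g \<in> borel_measurable lebesgue" "integrable lebesgue (\<lambda>\<tau>. norm (g \<tau>))"
    and s: "max (-\<alpha>) 0 < Re s" "Re s < 1/2"
  shows "inversion_integrand \<alpha> g y s = (LINT \<tau>|lebesgue. core_symbol \<tau> s * of_real y powr (- s) * g \<tau>)"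
proof -
  have np: "z \<notin> \<int>\<^sub>\<le>\<^sub>0" if "Re z > 0" for z :: complex
    using that by (auto elim!: nonpos_Ints_cases)
  have nz: "Gamma s \<noteq> 0" "Gamma (1 + of_real \<alpha> - s) \<noteq> 0" "Gamma (s + of_real \<alpha>) \<noteq> 0"
    using s al by (simp_all add: Gamma_eq_zero_iff np)
  let ?R = "Gamma (s + of_real \<alpha>) * rGamma s * rGamma (1 + of_real \<alpha> - s)"
  have "inversion_integrand \<alpha> g y s = Gamma s * Gamma (1 + of_real \<alpha> - s) / Gamma (s + of_real \<alpha>) *
      (of_real (2 * sqrt pi) * (LINT \<tau>|lebesgue. real_symbol \<alpha> \<tau> s * (g \<tau> / of_real (cosh (pi * \<tau>))))) * of_real y powr (- s)"
    unfolding inversion_integrand_def G_transform_Mellin(2)[OF al g s] ..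
  also have "of_real (2 * sqrt pi) * (LINT \<tau>|lebesgue. real_symbol \<alpha> \<tau> s * (g \<tau> / of_real (cosh (pi * \<tau>)))) =
      (LINT \<tau>|lebesgue. ?R * (core_symbol \<tau> s * g \<tau>))"
    unfolding integral_mult_right_zero[symmetric]
  proof (rule Bochner_Integration.integral_cong[OF refl])
    fix \<tau>
    have "complex_of_real (cosh (pi * \<tau>)) \<noteq> 0" by simp
    moreover have "(2 * complex_of_real (sqrt pi)) \<noteq> 0" by simp
    moreover have "q * (h / q * (k * R) * (v / h)) = R * (k * v)" if "h \<noteq> 0" "q \<noteq> 0" for q h k R v :: complex
      using that by simp
    ultimately show "of_real (2 * sqrt pi) * (real_symbol \<alpha> \<tau> s * (g \<tau> / of_real (cosh (pi * \<tau>)))) = ?R * (core_symbol \<tau> s * g \<tau>)"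
      unfolding real_symbol_def by (simp only: of_real_mult of_real_numeral)
  qed
  also have "\<dots> = ?R * (LINT \<tau>|lebesgue. core_symbol \<tau> s * g \<tau>)"
    by (rule integral_mult_right_zero)
  also have "Gamma s * Gamma (1 + of_real \<alpha> - s) / Gamma (s + of_real \<alpha>) * (?R * (LINT \<tau>|lebesgue. core_symbol \<tau> s * g \<tau>)) * of_real y powr (- s)
      = of_real y powr (- s) * (LINT \<tau>|lebesgue. core_symbol \<tau> s * g \<tau>)"
  proof -
    have "a * b / c * ((c * inverse a * inverse b) * I) * Y = Y * I" if "a \<noteq> 0" "b \<noteq> 0" "c \<noteq> 0" for a b c I Y :: complex
      using that by (simp add: field_simps)
    from this[OF nz] show ?thesis unfolding rGamma_inverse_Gamma .
  qed
  also have "\<dots> = (LINT \<tau>|lebesgue. of_real y powr (- s) * (core_symbol \<tau> s * g \<tau>))"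
    by (rule integral_mult_right_zero[symmetric])
  finally show ?thesis by (simp only: mult_ac)
qed

lemma inversion_formula:
  assumes al: "\<alpha> > -1/4" and g: "g \<in> borel_measurable lebesgue" "integrable lebesgue (\<lambda>\<tau>. norm (g \<tau>))"
    and nu: "max (-\<alpha>) 0 < \<nu>" "\<nu> < 1/2" and y: "y > 0"
  shows "vertical_integrable \<nu> (inversion_integrand \<alpha> g y)" "integrable lebesgue (K_integrand g y)"
    "1 / (2 * of_real pi * \<i>) * vertical_integral \<nu> (inversion_integrand \<alpha> g y) =
      of_real (sqrt pi) * (LINT \<tau>|lebesgue. K_integrand g y \<tau>)"
proof -
  interpret L: sigma_finite_measure "lebesgue :: real measure" by (rule sigma_finite_lebesgue)
  interpret P: pair_sigma_finite "lborel :: real measure" "lebesgue :: real measure" ..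
  have nu': "0 < \<nu>" using nu by simp
  define f where "f t \<tau> = core_symbol \<tau> (Complex \<nu> t) * of_real y powr (- Complex \<nu> t) * g \<tau>" for t \<tau>
  obtain C where C: "C > 0" "\<And>\<tau> t. norm (core_symbol \<tau> (Complex \<nu> t)) \<le> C * exp (- \<bar>t\<bar>)"
    using core_symbol_line_bound[OF nu' nu(2)] by blast
  have fm: "case_prod f \<in> borel_measurable (lborel \<Otimes>\<^sub>M lebesgue)"
  proof -
    have "continuous_on UNIV (\<lambda>p::real \<times> real. core_symbol (snd p) (Complex \<nu> (fst p)) * of_real y powr (- Complex \<nu> (fst p)))"
      unfolding of_real_powr_line[OF y] using nu' nu
      by (intro continuous_intros continuous_on_core_symbol) auto
    then have "(\<lambda>p::real \<times> real. core_symbol (snd p) (Complex \<nu> (fst p)) * of_real y powr (- Complex \<nu> (fst p))) \<in> borel_measurable (borel \<Otimes>\<^sub>M borel)"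
      unfolding borel_prod by (rule borel_measurable_continuous_onI)
    from borel_measurable_times[OF measurable_borel_lebesgue_pair[OF this] measurable_compose[OF measurable_snd g(1)]]
    show ?thesis by (simp add: f_def case_prod_beta')
  qed
  have fi: "integrable (lborel \<Otimes>\<^sub>M lebesgue) (case_prod f)"
  proof (rule P.integrable_product_bound[OF fm _ g(2)])
    show "integrable lborel (\<lambda>t. C * y powr (- \<nu>) * exp (- 1 * \<bar>t\<bar>))"
      by (intro integrable_mult_right integrable_exp_neg_abs) simp
    fix t \<tau>
    have "norm (case_prod f (t, \<tau>)) = norm (core_symbol \<tau> (Complex \<nu> t)) * y powr (- \<nu>) * norm (g \<tau>)"
      unfolding f_def of_real_powr_line[OF y] by (simp add: norm_mult)
    also have "\<dots> \<le> (C * exp (- \<bar>t\<bar>)) * y powr (- \<nu>) * norm (g \<tau>)"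
      by (intro mult_right_mono C) auto
    finally show "norm (case_prod f (t, \<tau>)) \<le> C * y powr (- \<nu>) * exp (- 1 * \<bar>t\<bar>) * norm (g \<tau>)" by (simp add: mult_ac)
  qed
  have inv: "inversion_integrand \<alpha> g y (Complex \<nu> t) = (LINT \<tau>|lebesgue. f t \<tau>)" for t
    unfolding f_def using nu by (intro inversion_integrand_eq al g) auto
  have Ii: "integrable lborel (\<lambda>t. LINT \<tau>|lebesgue. f t \<tau>)" by (rule P.integrable_fst[OF fi])
  then have Im: "(\<lambda>t. LINT \<tau>|lebesgue. f t \<tau>) \<in> borel_measurable lborel" by (rule borel_measurable_integrable)
  show "vertical_integrable \<nu> (inversion_integrand \<alpha> g y)"
    unfolding vertical_integrable_def inv integrable_completion[OF Im] by (rule Ii)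
  have Ki: "integrable lebesgue (\<lambda>\<tau>. 1 / (2 * of_real pi * of_real (sqrt pi)) * (LINT t|lborel. f t \<tau>))"
    by (intro integrable_mult_right P.integrable_snd[OF fi])
  have Keq: "K_integrand g y \<tau> = 1 / (2 * of_real pi * of_real (sqrt pi)) * (LINT t|lborel. f t \<tau>)" if "\<tau> \<noteq> 0" for \<tau>
  proof -
    let ?V = "of_real (exp (y / 2)) * bessel_K (Complex 0 \<tau>) (of_real (y / 2)) / complex_of_real (cosh (pi * \<tau>))"
    have "(LINT t|lborel. f t \<tau>) = (LINT t|lborel. core_symbol \<tau> (Complex \<nu> t) * of_real y powr (- Complex \<nu> t)) * g \<tau>"
      unfolding f_def by (rule integral_mult_left_zero)
    also have "\<dots> = 2 * of_real pi * (of_real (sqrt pi) * ?V) * g \<tau>"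
      unfolding exp_bessel_K_Mellin_Barnes[OF that nu' nu(2) y] ..
    finally have "(LINT t|lborel. f t \<tau>) = (2 * of_real pi * of_real (sqrt pi)) * (?V * g \<tau>)" by (simp only: mult_ac)
    moreover have "(2 * of_real pi * of_real (sqrt pi)) \<noteq> (0::complex)" by simp
    moreover have "K_integrand g y \<tau> = ?V * g \<tau>" by (simp add: K_integrand_def)
    ultimately show ?thesis by (metis (no_types, lifting) divide_inverse mult.commute mult.left_neutral nonzero_mult_div_cancel_left)
  qed
  show "integrable lebesgue (K_integrand g y)" by (rule lebesgue_cong_except_zero(1)[OF Ki Keq])
  have "(LINT \<tau>|lebesgue. K_integrand g y \<tau>) = 1 / (2 * of_real pi * of_real (sqrt pi)) * (LINT \<tau>|lebesgue. LINT t|lborel. f t \<tau>)"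
    by (rule trans[OF lebesgue_cong_except_zero(2)[OF Ki Keq] integral_mult_right_zero])
  also have "(LINT \<tau>|lebesgue. LINT t|lborel. f t \<tau>) = (LINT t|lborel. LINT \<tau>|lebesgue. f t \<tau>)"
    by (rule P.Fubini_integral[OF fi])
  finally have "of_real (sqrt pi) * (LINT \<tau>|lebesgue. K_integrand g y \<tau>) = (LINT t|lborel. LINT \<tau>|lebesgue. f t \<tau>) / (2 * of_real pi)"
    by simp
  moreover have "vertical_integral \<nu> (inversion_integrand \<alpha> g y) = \<i> * (LINT t|lborel. LINT \<tau>|lebesgue. f t \<tau>)"
    unfolding vertical_integral_def inv integral_completion[OF Im] ..
  ultimately show "1 / (2 * of_real pi * \<i>) * vertical_integral \<nu> (inversion_integrand \<alpha> g y) =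
      of_real (sqrt pi) * (LINT \<tau>|lebesgue. K_integrand g y \<tau>)"
    by simp
qed

theorem theorem3:
  fixes \<alpha> :: real
  assumes "\<alpha> > - 1 / 4"
  shows
    "(\<exists>C>0. \<forall>g \<in> weighted_L1 UNIV (\<lambda>\<tau>. inverse (cosh (pi * \<tau>))).
        (\<forall>x>0. integrable lebesgue (G_integrand \<alpha> g x)) \<and>
        bounded ((\<lambda>x. of_real (x powr (1 / 4)) * G_transform \<alpha> g x) ` {0<..}) \<and>
        continuous_on {0<..} (\<lambda>x. of_real (x powr (1 / 4)) * G_transform \<alpha> g x) \<and>
        (SUP x\<in>{0<..}. x powr (1 / 4) * norm (G_transform \<alpha> g x))
          \<le> C * weighted_L1_norm UNIV (\<lambda>\<tau>. inverse (cosh (pi * \<tau>))) g) \<and>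
     (\<forall>g \<nu>. g \<in> weighted_L1 UNIV (\<lambda>\<tau>. 1) \<longrightarrow>
        max (- \<alpha>) 0 < \<nu> \<longrightarrow> \<nu> < 1 / 2 \<longrightarrow>
        G_transform \<alpha> g \<in> weighted_L1 {0<..<1} (\<lambda>x. x powr (\<nu> - 1)) \<longrightarrow>
        (\<forall>s. Re s = \<nu> \<longrightarrow>
           set_integrable lebesgue {0<..} (\<lambda>x. G_transform \<alpha> g x * of_real x powr (s - 1))) \<and>
        (\<forall>y>0.
           vertical_integrable \<nu> (inversion_integrand \<alpha> g y) \<and>
           integrable lebesgue (K_integrand g y) \<and>
           1 / (2 * of_real pi * \<i>) * vertical_integral \<nu> (inversion_integrand \<alpha> g y) =
             of_real (sqrt pi) * (LINT \<tau>|lebesgue. K_integrand g y \<tau>)))"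
proof (intro conjI allI impI)
  have al: "\<alpha> > -1/4" using assms by simp
  show "\<exists>C>0. \<forall>g \<in> weighted_L1 UNIV (\<lambda>\<tau>. inverse (cosh (pi * \<tau>))).
        (\<forall>x>0. integrable lebesgue (G_integrand \<alpha> g x)) \<and>
        bounded ((\<lambda>x. of_real (x powr (1 / 4)) * G_transform \<alpha> g x) ` {0<..}) \<and>
        continuous_on {0<..} (\<lambda>x. of_real (x powr (1 / 4)) * G_transform \<alpha> g x) \<and>
        (SUP x\<in>{0<..}. x powr (1 / 4) * norm (G_transform \<alpha> g x))
          \<le> C * weighted_L1_norm UNIV (\<lambda>\<tau>. inverse (cosh (pi * \<tau>))) g"
    by (rule G_transform_uniform_bound[OF al])
  fix g \<nu>
  assume g: "g \<in> weighted_L1 UNIV (\<lambda>\<tau>. 1)" and nu: "max (- \<alpha>) 0 < \<nu>" "\<nu> < 1 / 2"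
  have gm: "g \<in> borel_measurable lebesgue" and gi: "integrable lebesgue (\<lambda>\<tau>. norm (g \<tau>))"
    using weighted_L1_UNIV(1,2)[OF g] by simp_all
  show "set_integrable lebesgue {0<..} (\<lambda>x. G_transform \<alpha> g x * of_real x powr (s - 1))" if "Re s = \<nu>" for s
    using G_transform_Mellin(1)[OF al gm gi, of s] nu that by simp
  fix y :: real assume y: "y > 0"
  show "vertical_integrable \<nu> (inversion_integrand \<alpha> g y)" "integrable lebesgue (K_integrand g y)"
    "1 / (2 * of_real pi * \<i>) * vertical_integral \<nu> (inversion_integrand \<alpha> g y) =
      of_real (sqrt pi) * (LINT \<tau>|lebesgue. K_integrand g y \<tau>)"
    by (rule inversion_formula[OF al gm gi nu y])+
qed

end
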